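(* Let $(X,d,\mu,\mathcal E,\mathcal F)$ be a sub-Gaussian Dirichlet space with parameters $d_H,d_W$ that satisfies $wBE(\kappa)$ with $\kappa=d_W-\lambda_1^\#$. There exist constants $c,C>0$ such that for every $f\in BV(X)\cap L^\infty(X,\mu)$, every BV measure $\gamma_f$ associated with $f$, and every $g\in\mathcal D$ with $g\ge0$, $$c\limsup_{t\to0^+}\int_Xg(y)\,\mathcal Q_tf(y)\,d\mu(y)\le\int_Xg(y)\,d\gamma_f(y)\le C\liminf_{t\to0^+}\int_Xg(y)\,\mathcal Q_tf(y)\,d\mu(y),$$ where $$\mathcal Q_tf(y)=\frac1{t^{1-\frac{\kappa}{d_W}}}\int_Xp_t(x,y)|f(x)-f(y)|\,d\mu(x).$$ In particular, all the BV measures associated to a given such $f$ are mutually equivalent with uniformly bounded densities.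
   Context: A sub-Gaussian Dirichlet space $(X,d,\mu,\mathcal E,\mathcal F)$ with parameters $d_H,d_W$ means: $(X,d,\mu)$ is a locally compact metric measure space, $\mu$ is a Radon measure with support $X$, $(\mathcal E,\mathcal F)$ is a Dirichlet form on $L^2(X,\mu)$, and (i) every ball $B(x,r)=\{y: d(x,y)<r\}$, $x\in X$, $0<r<\infty$, has compact closure; (ii) $\mu$ is Ahlfors $d_H$-regular: there are $c_1,c_2,d_H\in(0,\infty)$ with $c_1r^{d_H}\le\mu(B(x,r))\le c_2r^{d_H}$ for all $x\in X$, $r\in[0,\infty)$; (iii) $\mathcal E$ is regular and strongly local (i.e. $\mathcal E(u,v)=0$ for $u,v\in\mathcal F$ with compact supports such that $u$ is constant in a neighborhood of the support of $v$); (iv) the heat semigroup $\{P_t\}$ of $(\mathcal E,\mathcal F)$ has a continuous heat kernel $p_t(x,y)$ (so $P_tg(x)=\int_Xp_t(x,y)g(y)\,d\mu(y)$) satisfying, for some $c_3,c_4,c_5,c_6\in(0,\infty)$ and $d_W\in(2,\infty)$, $$c_5t^{-d_H/d_W}\exp\Big(-c_6\Big(\tfrac{d(x,y)^{d_W}}{t}\Big)^{\frac1{d_W-1}}\Big)\le p_t(x,y)\le c_3t^{-d_H/d_W}\exp\Big(-c_4\Big(\tfrac{d(x,y)^{d_W}}{t}\Big)^{\frac1{d_W-1}}\Big)$$ for $\mu\times\mu$-a.e. $(x,y)$ and all $t>0$. In this setting $P_t1=1$. $X$ satisfies $wBE(\kappa)$ if $0<\kappa<d_W$ and there is $C>0$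 such that $|P_tg(x)-P_tg(y)|\le C\frac{d(x,y)^\kappa}{t^{\kappa/d_W}}\|g\|_{L^\infty(X,\mu)}$ for all $t>0$, $g\in L^\infty(X,\mu)$, $x,y\in X$. Let $\Delta_r=\{(x,y)\in X\times X: d(x,y)<r\}$. For $\lambda>0$, $KS^{\lambda,1}(X)$ is the set of $f\in L^1(X,\mu)$ such that $\limsup_{r\to0^+}\iint_{\Delta_r}\frac{|f(y)-f(x)|}{r^\lambda\mu(B(x,r))}\,d\mu(y)\,d\mu(x)<\infty$. Set $\lambda_1^\#=\sup\{\lambda>0: KS^{\lambda,1}(X)\text{ contains non-constant functions}\}$ and $BV(X)=KS^{\lambda_1^\#,1}(X)$. For $f\in L^1(X,\mu)$ let $\mathcal M_rf(y)=\frac1{r^{d_W-\kappa}\mu(B(y,r))}\int_{B(y,r)}|f(x)-f(y)|\,d\mu(x)$. $C_c(X)$ is the space of continuous compactly supported functions and $C_0(X)$ its closure in the supremum norm. For $f\in BV(X)$, a BV measure associated with $f$ is a Radon measure $\gamma_f$ on $X$ for which there is a sequence $r_n\searrow0$ such that $\lim_n\int_Xg\,\mathcal M_{r_n}f\,d\mu=\int_Xg\,d\gamma_f$ for every $g\in C_0(X)$. Finally $\mathcal D=\{P_\varepsilon u:\varepsilon>0,\ u\in C_c(X)\}$. *)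

theory Defs
  imports "HOL-Probability.Probability"
begin

section \<open>Function spaces\<close>

text \<open>Elements of the spaces of classes \<open>L\<^sup>2\<close>, \<open>L\<^sup>\<infinity>\<close>, \<dots> are represented by functions;
  every notion below that is applied to them is invariant under equality almost everywhere.\<close>

definition L2 :: "'a measure \<Rightarrow> ('a \<Rightarrow> real) set" where
  "L2 \<mu> = {f \<in> borel_measurable \<mu>. integrable \<mu> (\<lambda>x. (f x)\<^sup>2)}"

definition L2_inner :: "'a measure \<Rightarrow> ('a \<Rightarrow> real) \<Rightarrow> ('a \<Rightarrow> real) \<Rightarrow> real" where
  "L2_inner \<mu> f g = (\<integral>x. f x * g x \<partial>\<mu>)"

definition L2_norm :: "'a measure \<Rightarrow> ('a \<Rightarrow> real) \<Rightarrow> real" where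
  "L2_norm \<mu> f = sqrt (L2_inner \<mu> f f)"

definition Linf :: "'a measure \<Rightarrow> ('a \<Rightarrow> real) set" where
  "Linf \<mu> = {g \<in> borel_measurable \<mu>. esssup \<mu> (\<lambda>x. ereal \<bar>g x\<bar>) < \<infinity>}"

definition Linf_norm :: "'a measure \<Rightarrow> ('a \<Rightarrow> real) \<Rightarrow> real" where
  "Linf_norm \<mu> g = real_of_ereal (esssup \<mu> (\<lambda>x. ereal \<bar>g x\<bar>))"

definition Cc :: "('a::metric_space \<Rightarrow> real) set" where
  "Cc = {g. continuous_on UNIV g \<and> compact (closure {x. g x \<noteq> 0})}"

text \<open>The closure of \<open>Cc\<close> in the supremum norm. Uniform limits of functions in \<open>Cc\<close> are
  automatically bounded and continuous.\<close>

definition C0 :: "('a::metric_space \<Rightarrow> real) set" where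
  "C0 = {g. \<forall>e>0. \<exists>h\<in>Cc. \<forall>x. \<bar>g x - h x\<bar> \<le> e}"

definition radon_measure :: "'a::metric_space measure \<Rightarrow> bool" where
  "radon_measure M \<longleftrightarrow>
     sets M = sets borel \<and>
     (\<forall>K. compact K \<longrightarrow> emeasure M K < \<infinity>) \<and>
     (\<forall>A\<in>sets borel. emeasure M A = (INF U\<in>{U. open U \<and> A \<subseteq> U}. emeasure M U)) \<and>
     (\<forall>U. open U \<longrightarrow> emeasure M U = (SUP K\<in>{K. compact K \<and> K \<subseteq> U}. emeasure M K))"


section \<open>Dirichlet forms and their heat semigroups\<close>

definition dirichlet_form ::
  "'a measure \<Rightarrow> (('a \<Rightarrow> real) \<Rightarrow> ('a \<Rightarrow> real) \<Rightarrow> real) \<Rightarrow> ('a \<Rightarrow> real) set \<Rightarrow> bool" where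
  "dirichlet_form \<mu> \<E> \<F> \<longleftrightarrow>
     \<comment> \<open>\<open>\<F>\<close> is a dense linear subspace of \<open>L\<^sup>2\<close>\<close>
     \<F> \<subseteq> L2 \<mu> \<and> (\<lambda>x. 0) \<in> \<F> \<and>
     (\<forall>u\<in>\<F>. \<forall>v\<in>\<F>. (\<lambda>x. u x + v x) \<in> \<F>) \<and>
     (\<forall>a. \<forall>u\<in>\<F>. (\<lambda>x. a * u x) \<in> \<F>) \<and>
     (\<forall>f\<in>L2 \<mu>. \<forall>e>0. \<exists>u\<in>\<F>. L2_norm \<mu> (\<lambda>x. f x - u x) < e) \<and>
     \<comment> \<open>\<open>\<F>\<close> and \<open>\<E>\<close> are well defined on classes modulo null sets\<close>
     (\<forall>u\<in>\<F>. \<forall>u'\<in>borel_measurable \<mu>. (AE x in \<mu>. u x = u' x) \<longrightarrow>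
        u' \<in> \<F> \<and> (\<forall>v\<in>\<F>. \<E> u v = \<E> u' v)) \<and>
     \<comment> \<open>\<open>\<E>\<close> is a nonnegative symmetric bilinear form on \<open>\<F>\<close>\<close>
     (\<forall>u\<in>\<F>. \<forall>v\<in>\<F>. \<E> u v = \<E> v u) \<and>
     (\<forall>u\<in>\<F>. \<forall>v\<in>\<F>. \<forall>w\<in>\<F>. \<E> (\<lambda>x. u x + v x) w = \<E> u w + \<E> v w) \<and>
     (\<forall>a. \<forall>u\<in>\<F>. \<forall>v\<in>\<F>. \<E> (\<lambda>x. a * u x) v = a * \<E> u v) \<and>
     (\<forall>u\<in>\<F>. 0 \<le> \<E> u u) \<and>
     \<comment> \<open>closedness: \<open>\<F>\<close> is complete for the norm \<open>(\<E>(u,u) + \<parallel>u\<parallel>\<^sup>2)\<^sup>1\<^sup>/\<^sup>2\<close>\<close>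
     (\<forall>u :: nat \<Rightarrow> 'a \<Rightarrow> real. (\<forall>n. u n \<in> \<F>) \<longrightarrow>
        (\<forall>e>0. \<exists>N. \<forall>m\<ge>N. \<forall>n\<ge>N.
           \<E> (\<lambda>x. u m x - u n x) (\<lambda>x. u m x - u n x) + (L2_norm \<mu> (\<lambda>x. u m x - u n x))\<^sup>2 < e) \<longrightarrow>
        (\<exists>w\<in>\<F>. (\<lambda>n. \<E> (\<lambda>x. u n x - w x) (\<lambda>x. u n x - w x)
                      + (L2_norm \<mu> (\<lambda>x. u n x - w x))\<^sup>2) \<longlonglongrightarrow> 0)) \<and>
     \<comment> \<open>Markov property: unit contractions operate\<close>
     (\<forall>u\<in>\<F>. (\<lambda>x. min (max (u x) 0) 1) \<in> \<F> \<and>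
        \<E> (\<lambda>x. min (max (u x) 0) 1) (\<lambda>x. min (max (u x) 0) 1) \<le> \<E> u u)"

definition regular_form ::
  "'a::metric_space measure \<Rightarrow> (('a \<Rightarrow> real) \<Rightarrow> ('a \<Rightarrow> real) \<Rightarrow> real) \<Rightarrow> ('a \<Rightarrow> real) set \<Rightarrow> bool" where
  "regular_form \<mu> \<E> \<F> \<longleftrightarrow>
     (\<forall>h\<in>Cc. \<forall>e>0. \<exists>u\<in>\<F> \<inter> Cc. \<forall>x. \<bar>h x - u x\<bar> \<le> e) \<and>
     (\<forall>w\<in>\<F>. \<forall>e>0. \<exists>u\<in>\<F> \<inter> Cc.
        \<E> (\<lambda>x. w x - u x) (\<lambda>x. w x - u x) + (L2_norm \<mu> (\<lambda>x. w x - u x))\<^sup>2 < e)"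

text \<open>The support of the class of \<open>u\<close>: the complement of the largest open set on which \<open>u = 0\<close>
  almost everywhere.\<close>

definition ess_support :: "'a::metric_space measure \<Rightarrow> ('a \<Rightarrow> real) \<Rightarrow> 'a set" where
  "ess_support \<mu> u = - \<Union> {U. open U \<and> (AE x in \<mu>. x \<in> U \<longrightarrow> u x = 0)}"

definition strongly_local_form ::
  "'a::metric_space measure \<Rightarrow> (('a \<Rightarrow> real) \<Rightarrow> ('a \<Rightarrow> real) \<Rightarrow> real) \<Rightarrow> ('a \<Rightarrow> real) set \<Rightarrow> bool" where
  "strongly_local_form \<mu> \<E> \<F> \<longleftrightarrow>
     (\<forall>u\<in>\<F>. \<forall>v\<in>\<F>. compact (ess_support \<mu> u) \<longrightarrow> compact (ess_support \<mu> v) \<longrightarrow>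
        (\<exists>U a. open U \<and> ess_support \<mu> v \<subseteq> U \<and> (AE x in \<mu>. x \<in> U \<longrightarrow> u x = a)) \<longrightarrow>
        \<E> u v = 0)"

text \<open>\<open>P\<close> is the strongly continuous contraction semigroup on \<open>L\<^sup>2\<close> whose infinitesimal generator
  is the operator \<open>A\<close> associated with the form, that is, \<open>u \<in> dom A\<close> and \<open>A u = w\<close> if and only if
  \<open>u \<in> \<F>\<close> and \<open>\<E>(u,v) = - \<langle>w,v\<rangle>\<close> for all \<open>v \<in> \<F>\<close>. Only the operators \<open>P t\<close>, \<open>t > 0\<close>, matter.\<close>

definition heat_semigroup ::
  "'a measure \<Rightarrow> (('a \<Rightarrow> real) \<Rightarrow> ('a \<Rightarrow> real) \<Rightarrow> real) \<Rightarrow> ('a \<Rightarrow> real) set \<Rightarrow>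
   (real \<Rightarrow> ('a \<Rightarrow> real) \<Rightarrow> 'a \<Rightarrow> real) \<Rightarrow> bool" where
  "heat_semigroup \<mu> \<E> \<F> P \<longleftrightarrow>
     (\<forall>t>0. \<forall>u\<in>L2 \<mu>. P t u \<in> L2 \<mu> \<and> L2_norm \<mu> (P t u) \<le> L2_norm \<mu> u) \<and>
     (\<forall>t>0. \<forall>u\<in>L2 \<mu>. \<forall>v\<in>L2 \<mu>. AE x in \<mu>. P t (\<lambda>y. u y + v y) x = P t u x + P t v x) \<and>
     (\<forall>t>0. \<forall>a. \<forall>u\<in>L2 \<mu>. AE x in \<mu>. P t (\<lambda>y. a * u y) x = a * P t u x) \<and>
     (\<forall>s>0. \<forall>t>0. \<forall>u\<in>L2 \<mu>. AE x in \<mu>. P (s + t) u x = P s (P t u) x) \<and>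
     (\<forall>u\<in>L2 \<mu>. ((\<lambda>t. L2_norm \<mu> (\<lambda>x. P t u x - u x)) \<longlongrightarrow> 0) (at_right 0)) \<and>
     (\<forall>u\<in>L2 \<mu>. \<forall>w\<in>L2 \<mu>.
        ((\<lambda>t. L2_norm \<mu> (\<lambda>x. (P t u x - u x) / t - w x)) \<longlongrightarrow> 0) (at_right 0) \<longleftrightarrow>
        u \<in> \<F> \<and> (\<forall>v\<in>\<F>. \<E> u v = - L2_inner \<mu> w v))"

definition heat_op ::
  "'a measure \<Rightarrow> (real \<Rightarrow> 'a \<Rightarrow> 'a \<Rightarrow> real) \<Rightarrow> real \<Rightarrow> ('a \<Rightarrow> real) \<Rightarrow> 'a \<Rightarrow> real" where
  "heat_op \<mu> p t g x = (\<integral>y. p t x y * g y \<partial>\<mu>)"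


section \<open>Sub-Gaussian Dirichlet spaces\<close>

text \<open>The space \<open>X\<close> is the whole type \<open>'a\<close>; its local compactness is contained in
  \<open>compact_balls\<close>. The powers are \<open>powr\<close>, for which \<open>0 powr a = 0\<close>.\<close>

locale sub_gaussian_dirichlet_space =
  fixes \<mu> :: "'a::metric_space measure"
    and \<E> :: "('a \<Rightarrow> real) \<Rightarrow> ('a \<Rightarrow> real) \<Rightarrow> real"
    and \<F> :: "('a \<Rightarrow> real) set"
    and p :: "real \<Rightarrow> 'a \<Rightarrow> 'a \<Rightarrow> real"
    and d\<^sub>H d\<^sub>W :: real
  assumes radon: "radon_measure \<mu>"
    and full_support: "\<And>U. open U \<Longrightarrow> U \<noteq> {} \<Longrightarrow> emeasure \<mu> U > 0"
    and compact_balls: "\<And>(x::'a) r. 0 < r \<Longrightarrow> compact (closure (ball x r))"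
    and dH_pos: "0 < d\<^sub>H"
    and ahlfors: "\<exists>c\<^sub>1>0. \<exists>c\<^sub>2>0. \<forall>x. \<forall>r\<ge>0.
        ennreal (c\<^sub>1 * r powr d\<^sub>H) \<le> emeasure \<mu> (ball x r) \<and>
        emeasure \<mu> (ball x r) \<le> ennreal (c\<^sub>2 * r powr d\<^sub>H)"
    and dirichlet: "dirichlet_form \<mu> \<E> \<F>"
    and regular: "regular_form \<mu> \<E> \<F>"
    and strongly_local: "strongly_local_form \<mu> \<E> \<F>"
    and heat_kernel: "heat_semigroup \<mu> \<E> \<F> (heat_op \<mu> p)"
    and heat_kernel_continuous: "\<And>t. 0 < t \<Longrightarrow> continuous_on UNIV (\<lambda>(x, y). p t x y)"
    and dW_gt_2: "2 < d\<^sub>W"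
    and heat_kernel_bounds: "\<exists>c\<^sub>3>0. \<exists>c\<^sub>4>0. \<exists>c\<^sub>5>0. \<exists>c\<^sub>6>0.
        AE (x, y) in \<mu> \<Otimes>\<^sub>M \<mu>. \<forall>t>0.
          c\<^sub>5 * t powr (- d\<^sub>H / d\<^sub>W) * exp (- c\<^sub>6 * (dist x y powr d\<^sub>W / t) powr (1 / (d\<^sub>W - 1))) \<le> p t x y \<and>
          p t x y \<le> c\<^sub>3 * t powr (- d\<^sub>H / d\<^sub>W) * exp (- c\<^sub>4 * (dist x y powr d\<^sub>W / t) powr (1 / (d\<^sub>W - 1)))"

definition wBE ::
  "'a::metric_space measure \<Rightarrow> (real \<Rightarrow> 'a \<Rightarrow> 'a \<Rightarrow> real) \<Rightarrow> real \<Rightarrow> real \<Rightarrow> bool" where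
  "wBE \<mu> p d\<^sub>W \<kappa> \<longleftrightarrow> 0 < \<kappa> \<and> \<kappa> < d\<^sub>W \<and>
     (\<exists>C>0. \<forall>t>0. \<forall>g\<in>Linf \<mu>. \<forall>x y.
        \<bar>heat_op \<mu> p t g x - heat_op \<mu> p t g y\<bar>
          \<le> C * (dist x y powr \<kappa> / t powr (\<kappa> / d\<^sub>W)) * Linf_norm \<mu> g)"

definition heat_class ::
  "'a::metric_space measure \<Rightarrow> (real \<Rightarrow> 'a \<Rightarrow> 'a \<Rightarrow> real) \<Rightarrow> ('a \<Rightarrow> real) set" where
  "heat_class \<mu> p = {heat_op \<mu> p \<epsilon> u | \<epsilon> u. 0 < \<epsilon> \<and> u \<in> Cc}"


section \<open>Korevaar--Schoen spaces, BV functions and BV measures\<close>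

definition diagonal_nbhd :: "real \<Rightarrow> ('a::metric_space \<times> 'a) set" where
  "diagonal_nbhd r = {(x, y). dist x y < r}"

definition KS :: "'a::metric_space measure \<Rightarrow> real \<Rightarrow> ('a \<Rightarrow> real) set" where
  "KS \<mu> s = {f. integrable \<mu> f \<and>
     Limsup (at_right 0) (\<lambda>r. \<integral>\<^sup>+x. \<integral>\<^sup>+y.
        ennreal (\<bar>f y - f x\<bar> / (r powr s * measure \<mu> (ball x r))) * indicator (diagonal_nbhd r) (x, y)
        \<partial>\<mu> \<partial>\<mu>) < \<infinity>}"

text \<open>The supremum is taken in \<open>ereal\<close>, so that it is meaningful also for empty or unbounded sets
  of exponents. Being constant is understood modulo null sets.\<close>

definition critical_exponent :: "'a::metric_space measure \<Rightarrow> ereal" where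
  "critical_exponent \<mu> =
     Sup {ereal s | s. 0 < s \<and> (\<exists>f\<in>KS \<mu> s. \<not> (\<exists>a. AE x in \<mu>. f x = a))}"

definition BV :: "'a::metric_space measure \<Rightarrow> ('a \<Rightarrow> real) set" where
  "BV \<mu> = KS \<mu> (real_of_ereal (critical_exponent \<mu>))"

definition mean_osc ::
  "'a::metric_space measure \<Rightarrow> real \<Rightarrow> real \<Rightarrow> real \<Rightarrow> ('a \<Rightarrow> real) \<Rightarrow> 'a \<Rightarrow> real" where
  "mean_osc \<mu> d\<^sub>W \<kappa> r f y =
     1 / (r powr (d\<^sub>W - \<kappa>) * measure \<mu> (ball y r)) * (LINT x:ball y r|\<mu>. \<bar>f x - f y\<bar>)"

definition is_BV_measure ::
  "'a::metric_space measure \<Rightarrow> real \<Rightarrow> real \<Rightarrow> ('a \<Rightarrow> real) \<Rightarrow> 'a measure \<Rightarrow> bool" where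
  "is_BV_measure \<mu> d\<^sub>W \<kappa> f \<gamma> \<longleftrightarrow> radon_measure \<gamma> \<and>
     (\<exists>r :: nat \<Rightarrow> real. (\<forall>n. 0 < r n) \<and> decseq r \<and> r \<longlonglongrightarrow> 0 \<and>
        (\<forall>g\<in>C0. integrable \<gamma> g \<and>
           (\<lambda>n. \<integral>y. g y * mean_osc \<mu> d\<^sub>W \<kappa> (r n) f y \<partial>\<mu>) \<longlonglongrightarrow> (\<integral>y. g y \<partial>\<gamma>)))"

definition heat_osc ::
  "'a measure \<Rightarrow> (real \<Rightarrow> 'a \<Rightarrow> 'a \<Rightarrow> real) \<Rightarrow> real \<Rightarrow> real \<Rightarrow> real \<Rightarrow> ('a \<Rightarrow> real) \<Rightarrow> 'a \<Rightarrow> ennreal" where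
  "heat_osc \<mu> p d\<^sub>W \<kappa> t f y =
     ennreal (1 / t powr (1 - \<kappa> / d\<^sub>W)) * (\<integral>\<^sup>+x. ennreal (p t x y * \<bar>f x - f y\<bar>) \<partial>\<mu>)"

end

(* Write Delta f = f(x) - f(y), lambda = d_W - kappa, and
     N_g(t) = t^(-lambda/d_W) iint g(y) p_t(x,y) |Delta f|,   m_g(r) = int g M_r f,
   where up to constants m_g(r) is r^(-lambda-d_H) times the integral of g(y) |Delta f| over d(x,y) < r.
   The lower kernel bound gives m_g(r) <= C N_g(r^(d_W)) at once, so everything rests on the
   reverse comparison limsup N_g <= C liminf m_g.

   By the coarea formula the integral of a kernel against |Delta f| may be computed for
   f = 1_E. There, with h = 1_E, k = g (1 - 2h) and tau = t/n, conservativeness and symmetry give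
     iint g p_t |Delta h| = int k (P_t h - h) = sum_{j<n} int (P_{j tau} k) (P_tau h - h),
   and each summand is a double integral of p_tau (P_{j tau} k(x) - P_{j tau} k(y)) Delta h. A
   localized form of wBE bounds the increment of P_s k by d(x,y)^kappa s^(-kappa/d_W) (g(x) + small),
   and summing over j yields the factor t^(lambda/d_W) / tau. The resulting integral of
   tau^(-1) p_tau d(x,y)^kappa |Delta f| is split at d(x,y) = r, r ~ A tau^(1/d_W): the inner part is
   m_g(r), the outer part is a small multiple of N_g(B tau) and is absorbed once A is large.

   Symmetry of the kernel is derived from that of the form, and P_t 1 = 1 from wBE together with
   the two-sided kernel bounds.

   The comparison holds for all bounded uniformly continuous g >= 0 in C_0, in particular for
   Lipschitz cut-off functions; regularity of Radon measures then compares any two BV measures. *)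

theory Submission
  imports Defs
begin

section \<open>Symmetry of the heat semigroup\<close>


text \<open>The obstacle is that |Delta f| is not linear in f, so semigroup identities do not reach
  it. For an indicator h the sign of a nonzero h(y) - h(x) depends on x alone: |h(x) - h(y)| = (1 -
  2 h(x)) (h(y) - h(x)). The energy becomes a linear pairing that can be telescoped, hence the
  detour through level sets. The condition \<kappa> < \<open>dW\<close> enters as summability of
  j^(-\<kappa>/dW), with partial sums of order n^(1 - \<kappa>/dW). Global wBE would only give sup g
  in place of g(x). Localizing it costs an error made of the modulus of continuity of g and the
  kernel tail, times the energy for g = 1, which is bounded for f in the Korevaar-Schoen class; the
  error vanishes as t tends to 0, so the constants do not depend on g. The increment j = 0 has no
  smoothing time and is bounded by sup g times the energy at time tau, of relative size
  (tau/t)^(lambda/dW); therefore t is fixed before r, and with it tau, tends to 0. Every small r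
  determines its own number of steps, so the ball energy enters as a liminf over all r and the
  particular sequence of a BV measure drops out.\<close>

lemma quadratic_nonneg_discriminant:
  fixes a b c :: real
  assumes "\<And>t. 0 \<le> c + 2 * t * b + t\<^sup>2 * a" and "0 \<le> a"
  shows "b\<^sup>2 \<le> a * c"
proof (cases "a = 0")
  case True
  have "b = 0"
  proof (rule ccontr)
    assume "b \<noteq> 0"
    \<comment> \<open>In the degenerate case the expression is affine in t and takes the value -1 at
      this t.\<close>
    with assms(1)[of "- (c + 1) / (2 * b)"] True show False by (simp add: field_simps)
  qed
  then show ?thesis using True by simp
next
  case False
  with assms(2) have a: "0 < a" by simp
  have "0 \<le> c + 2 * (- b / a) * b + (- b / a)\<^sup>2 * a" by (rule assms(1))
  also have "\<dots> = c - b\<^sup>2 / a" using a by (simp add: power2_eq_square field_simps)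
  finally show ?thesis using a by (simp add: field_simps)
qed

lemma tendsto_0_squeeze:
  fixes f g :: "'b \<Rightarrow> real"
  assumes "\<And>n. 0 \<le> f n" "\<And>n. f n \<le> g n" "(g \<longlongrightarrow> 0) F"
  shows "(f \<longlongrightarrow> 0) F"
  by (rule tendsto_sandwich[OF _ _ tendsto_const assms(3)]) (auto simp: assms)

section \<open>Semidefinite forms on spaces of functions: Cauchy-Schwarz and Riesz
  representation\<close>

lemma psd_form_Cauchy_Schwarz:
  fixes B :: "('a \<Rightarrow> real) \<Rightarrow> ('a \<Rightarrow> real) \<Rightarrow> real"
  assumes add: "\<And>u v. u \<in> V \<Longrightarrow> v \<in> V \<Longrightarrow> (\<lambda>x. u x + v x) \<in> V"
    and scale: "\<And>a u. u \<in> V \<Longrightarrow> (\<lambda>x. a * u x) \<in> V"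
    and sym: "\<And>u v. u \<in> V \<Longrightarrow> v \<in> V \<Longrightarrow> B u v = B v u"
    and Badd: "\<And>u v w. u \<in> V \<Longrightarrow> v \<in> V \<Longrightarrow> w \<in> V \<Longrightarrow> B (\<lambda>x. u x + v x) w = B u w + B v w"
    and Bscale: "\<And>a u v. u \<in> V \<Longrightarrow> v \<in> V \<Longrightarrow> B (\<lambda>x. a * u x) v = a * B u v"
    and Bpos: "\<And>u. u \<in> V \<Longrightarrow> 0 \<le> B u u"
    and u: "u \<in> V" and v: "v \<in> V"
  shows "(B u v)\<^sup>2 \<le> B u u * B v v"
proof -
  have "0 \<le> B v v + 2 * t * B u v + t\<^sup>2 * B u u" for t
  proof -
    have tu: "(\<lambda>x. t * u x) \<in> V" using u by (rule scale)
    have s: "(\<lambda>x. t * u x + v x) \<in> V" using tu v by (rule add)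
    have "B (\<lambda>x. t * u x + v x) (\<lambda>x. t * u x + v x)
        = t * (t * B u u + B u v) + (t * B u v + B v v)"
      using Badd[OF tu v s] Bscale[OF u s] sym[OF u s] sym[OF v s] Badd[OF tu v u] Badd[OF tu v v]
        Bscale[OF u u] Bscale[OF u v] sym[OF u v] by simp
    with Bpos[OF s] show ?thesis by (simp add: algebra_simps power2_eq_square)
  qed
  from quadratic_nonneg_discriminant[OF this Bpos[OF u]] show ?thesis by simp
qed

text \<open>Direct method: \<open>Q v = B v v - 2 * l v\<close> is bounded below by
  \<open>-K\<close>, the parallelogram law makes a minimizing sequence Cauchy, and its limit
  satisfies the Euler-Lagrange equation. Elements are functions rather than classes and
  \<open>B\<close> may be degenerate, so limits are not unique and only existence is
  claimed.\<close>

lemma psd_form_riesz: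
  fixes B :: "('a \<Rightarrow> real) \<Rightarrow> ('a \<Rightarrow> real) \<Rightarrow> real"
  assumes V0: "V \<noteq> {}"
    and add: "\<And>u v. u \<in> V \<Longrightarrow> v \<in> V \<Longrightarrow> (\<lambda>x. u x + v x) \<in> V"
    and scale: "\<And>a u. u \<in> V \<Longrightarrow> (\<lambda>x. a * u x) \<in> V"
    and sym: "\<And>u v. u \<in> V \<Longrightarrow> v \<in> V \<Longrightarrow> B u v = B v u"
    and Badd: "\<And>u v w. u \<in> V \<Longrightarrow> v \<in> V \<Longrightarrow> w \<in> V \<Longrightarrow> B (\<lambda>x. u x + v x) w = B u w + B v w"
    and Bscale: "\<And>a u v. u \<in> V \<Longrightarrow> v \<in> V \<Longrightarrow> B (\<lambda>x. a * u x) v = a * B u v"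
    and Bpos: "\<And>u. u \<in> V \<Longrightarrow> 0 \<le> B u u"
    and complete: "\<And>u :: nat \<Rightarrow> 'a \<Rightarrow> real. (\<And>n. u n \<in> V) \<Longrightarrow>
        (\<forall>e>0. \<exists>N. \<forall>m\<ge>N. \<forall>n\<ge>N. B (\<lambda>x. u m x - u n x) (\<lambda>x. u m x - u n x) < e) \<Longrightarrow>
        \<exists>w\<in>V. (\<lambda>n. B (\<lambda>x. u n x - w x) (\<lambda>x. u n x - w x)) \<longlonglongrightarrow> 0"
    and ladd: "\<And>u v. u \<in> V \<Longrightarrow> v \<in> V \<Longrightarrow> l (\<lambda>x. u x + v x) = l u + l v"
    and lscale: "\<And>a u. u \<in> V \<Longrightarrow> l (\<lambda>x. a * u x) = a * l u"
    and lbound: "\<And>v. v \<in> V \<Longrightarrow> (l v)\<^sup>2 \<le> K * B v v" and K: "0 \<le> (K::real)"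
  shows "\<exists>w\<in>V. \<forall>v\<in>V. B w v = l v"
proof -
  define Q where "Q v = B v v - 2 * l v" for v
  have Qlow: "- K \<le> Q v" if v: "v \<in> V" for v
  proof -
    have "(2 * l v)\<^sup>2 \<le> 4 * (K * B v v)" using lbound[OF v] by (simp add: power2_eq_square)
    also have "\<dots> \<le> (K + B v v)\<^sup>2"
    proof -
      have "0 \<le> (K - B v v)\<^sup>2" by simp
      then show ?thesis by (simp add: power2_eq_square algebra_simps)
    qed
    finally have "2 * l v \<le> K + B v v" using K Bpos[OF v] by (auto intro: power2_le_imp_le)
    then show ?thesis by (simp add: Q_def)
  qed
  define m where "m = (INF v\<in>V. Q v)"
  have bdd: "bdd_below (Q ` V)" using Qlow by (auto intro!: bdd_belowI2[where m="-K"])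
  have m: "m \<le> Q v" if "v \<in> V" for v unfolding m_def using bdd that by (rule cINF_lower)
  have "\<exists>v\<in>V. Q v < m + inverse (real (Suc n))" for n
    using cINF_less_iff[OF V0 bdd, of "m + inverse (real (Suc n))"] unfolding m_def by simp
  then obtain u where u: "\<And>n. u n \<in> V" and Qu: "\<And>n. Q (u n) < m + inverse (real (Suc n))"
    by metis
  have diff: "(\<lambda>x. f x - g x) \<in> V" if "f \<in> V" "g \<in> V" for f g
    using add[OF that(1) scale[OF that(2), of "-1"]] by simp
  have Bdiff: "B (\<lambda>x. f x - g x) h = B f h - B g h" if "f \<in> V" "g \<in> V" "h \<in> V" for f g h
    using Badd[OF that(1) scale[OF that(2), of "-1"] that(3)] Bscale[OF that(2,3), of "-1"] by simp
  \<comment> \<open>Parallelogram law combined with \<open>m \<le> Q\<close> at the midpoint of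
    \<open>f\<close> and \<open>g\<close>.\<close>
  have par: "B (\<lambda>x. f x - g x) (\<lambda>x. f x - g x) \<le> 2 * (Q f - m) + 2 * (Q g - m)"
    if f: "f \<in> V" and g: "g \<in> V" for f g
  proof -
    have s: "(\<lambda>x. f x + g x) \<in> V" using f g by (rule add)
    have h: "(\<lambda>x. (1/2) * (f x + g x)) \<in> V" using scale[OF s, of "1/2"] by simp
    have d: "(\<lambda>x. f x - g x) \<in> V" using f g by (rule diff)
    have 1: "B (\<lambda>x. f x - g x) (\<lambda>x. f x - g x) = B f f - 2 * B f g + B g g"
      using Bdiff[OF f g d] sym[OF f d] sym[OF g d] Bdiff[OF f g f] Bdiff[OF f g g] sym[OF f g] by simp
    have 2: "B (\<lambda>x. f x + g x) (\<lambda>x. f x + g x) = B f f + 2 * B f g + B g g"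
      using Badd[OF f g s] sym[OF f s] sym[OF g s] Badd[OF f g f] Badd[OF f g g] sym[OF f g] by simp
    have 3: "Q (\<lambda>x. (1/2) * (f x + g x)) = (1/4) * B (\<lambda>x. f x + g x) (\<lambda>x. f x + g x) - (l f + l g)"
      unfolding Q_def using Bscale[OF s h, of "1/2"] sym[OF s h] Bscale[OF s s, of "1/2"]
        lscale[OF s, of "1/2"] ladd[OF f g] by simp
    have gen: "bff - 2 * bfg + bgg \<le> 2 * (bff - 2 * lf - m') + 2 * (bgg - 2 * lg - m')"
      if "m' \<le> (1/4) * (bff + 2 * bfg + bgg) - (lf + lg)" for bff bfg bgg lf lg m' :: real
      using that by (simp add: field_simps)
    show ?thesis unfolding 1 unfolding Q_def by (rule gen) (use m[OF h] in \<open>simp only: 3 2\<close>)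
  qed
  have Cauchy: "\<forall>e>0. \<exists>N. \<forall>m\<ge>N. \<forall>n\<ge>N. B (\<lambda>x. u m x - u n x) (\<lambda>x. u m x - u n x) < e"
  proof (intro allI impI)
    fix e :: real assume e: "0 < e"
    then obtain N where N: "inverse (real (Suc N)) < e / 4" using reals_Archimedean[of "e/4"] by auto
    have *: "Q (u n) - m < e / 4" if "n \<ge> N" for n
    proof -
      have "inverse (real (Suc n)) \<le> inverse (real (Suc N))" using that by (simp add: le_imp_inverse_le)
      then show ?thesis using Qu[of n] N by linarith
    qed
    show "\<exists>N. \<forall>m\<ge>N. \<forall>n\<ge>N. B (\<lambda>x. u m x - u n x) (\<lambda>x. u m x - u n x) < e"
    proof (intro exI[of _ N] allI impI)
      fix a b assume "N \<le> a" "N \<le> b"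
      then show "B (\<lambda>x. u a x - u b x) (\<lambda>x. u a x - u b x) < e"
        using par[OF u u, of a b] *[of a] *[of b] by simp
    qed
  qed
  obtain w where w: "w \<in> V" and lim: "(\<lambda>n. B (\<lambda>x. u n x - w x) (\<lambda>x. u n x - w x)) \<longlonglongrightarrow> 0"
    using complete[OF u Cauchy] by blast
  have "B w v = l v" if v: "v \<in> V" for v
  proof -
    \<comment> \<open>An approximate Euler-Lagrange equation: \<open>Q\<close> at
      \<open>u n + t v\<close> is at least \<open>m\<close> for every t, and the discriminant of
      this quadratic polynomial in t bounds the defect by the excess of \<open>Q (u n)\<close> over
      the infimum.\<close>
    have EL: "(B (u n) v - l v)\<^sup>2 \<le> B v v * (Q (u n) - m)" for n
    proof (rule quadratic_nonneg_discriminant)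
      fix t
      have tv: "(\<lambda>x. t * v x) \<in> V" using v by (rule scale)
      have s: "(\<lambda>x. u n x + t * v x) \<in> V" using u tv by (rule add)
      have "Q (\<lambda>x. u n x + t * v x) = Q (u n) + 2 * t * (B (u n) v - l v) + t\<^sup>2 * B v v"
        unfolding Q_def using Badd[OF u tv s] sym[OF u s] sym[OF tv s] Badd[OF u tv u] Badd[OF u tv tv]
          sym[OF u tv] Bscale[OF v u] sym[OF u v] Bscale[OF v tv] sym[OF v tv] Bscale[OF v v] ladd[OF u tv]
          lscale[OF v] by (simp add: algebra_simps power2_eq_square)
      then show "0 \<le> Q (u n) - m + 2 * t * (B (u n) v - l v) + t\<^sup>2 * B v v"
        using m[OF s] by simp
    qed (rule Bpos[OF v])
    have CS: "(B (\<lambda>x. u n x - w x) v)\<^sup>2 \<le> B (\<lambda>x. u n x - w x) (\<lambda>x. u n x - w x) * B v v" for n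
      by (rule psd_form_Cauchy_Schwarz[OF add scale sym Badd Bscale Bpos diff[OF u w] v])
    have "(\<lambda>n. inverse (real (Suc n))) \<longlonglongrightarrow> 0" by (rule LIMSEQ_inverse_real_of_nat)
    then have Q0: "(\<lambda>n. Q (u n) - m) \<longlonglongrightarrow> 0"
      by (rule tendsto_0_squeeze[rotated 2]) (use m u Qu in \<open>auto simp: less_imp_le algebra_simps\<close>)
    have "(\<lambda>n. B v v * (Q (u n) - m)) \<longlonglongrightarrow> 0" using tendsto_mult_right_zero[OF Q0] by simp
    then have "(\<lambda>n. (B (u n) v - l v)\<^sup>2) \<longlonglongrightarrow> 0"
      by (rule tendsto_0_squeeze[rotated 2]) (use EL in auto)
    then have 1: "(\<lambda>n. B (u n) v - l v) \<longlonglongrightarrow> 0" by simp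
    have "(\<lambda>n. B (\<lambda>x. u n x - w x) (\<lambda>x. u n x - w x) * B v v) \<longlonglongrightarrow> 0"
      using tendsto_mult_left_zero[OF lim] by simp
    then have "(\<lambda>n. (B (\<lambda>x. u n x - w x) v)\<^sup>2) \<longlonglongrightarrow> 0"
      by (rule tendsto_0_squeeze[rotated 2]) (use CS in auto)
    then have 2: "(\<lambda>n. B (\<lambda>x. u n x - w x) v) \<longlonglongrightarrow> 0" by simp
    have "(\<lambda>n. (B (u n) v - l v) - B (\<lambda>x. u n x - w x) v) \<longlonglongrightarrow> 0 - 0"
      using 1 2 by (rule tendsto_diff)
    moreover have "(B (u n) v - l v) - B (\<lambda>x. u n x - w x) v = B w v - l v" for n
      using Bdiff[OF u w v] by simp
    ultimately have "B w v - l v = 0" by (simp add: LIMSEQ_const_iff)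
    then show ?thesis by simp
  qed
  with w show ?thesis by blast
qed


section \<open>Square integrable functions with their semidefinite inner product\<close>

lemma L2_measurable [measurable_dest]: "u \<in> L2 \<mu> \<Longrightarrow> u \<in> borel_measurable \<mu>"
  by (simp add: L2_def)

lemma L2_integrable_mult:
  assumes "u \<in> L2 \<mu>" "v \<in> L2 \<mu>"
  shows "integrable \<mu> (\<lambda>x. u x * v x)"
proof (rule Bochner_Integration.integrable_bound)
  show "integrable \<mu> (\<lambda>x. (u x)\<^sup>2 + (v x)\<^sup>2)" using assms by (simp add: L2_def)
  show "AE x in \<mu>. norm (u x * v x) \<le> norm ((u x)\<^sup>2 + (v x)\<^sup>2)"
  proof (rule AE_I2)
    fix x
    have "2 * (\<bar>u x\<bar> * \<bar>v x\<bar>) \<le> \<bar>u x\<bar>\<^sup>2 + \<bar>v x\<bar>\<^sup>2"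
      using sum_squares_bound[of "\<bar>u x\<bar>" "\<bar>v x\<bar>"] by (simp add: mult.assoc)
    moreover have "0 \<le> \<bar>u x\<bar> * \<bar>v x\<bar>" by simp
    ultimately have "\<bar>u x\<bar> * \<bar>v x\<bar> \<le> (u x)\<^sup>2 + (v x)\<^sup>2" unfolding power2_abs by linarith
    then show "norm (u x * v x) \<le> norm ((u x)\<^sup>2 + (v x)\<^sup>2)" by (simp add: abs_mult)
  qed
qed (use assms in \<open>auto simp: L2_def\<close>)

lemma L2_add: "u \<in> L2 \<mu> \<Longrightarrow> v \<in> L2 \<mu> \<Longrightarrow> (\<lambda>x. u x + v x) \<in> L2 \<mu>"
  using L2_integrable_mult[of u \<mu> v] by (auto simp: L2_def power2_sum mult.assoc)

lemma L2_scale: "u \<in> L2 \<mu> \<Longrightarrow> (\<lambda>x. a * u x) \<in> L2 \<mu>"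
  by (auto simp: L2_def power_mult_distrib)

lemma L2_diff: "u \<in> L2 \<mu> \<Longrightarrow> v \<in> L2 \<mu> \<Longrightarrow> (\<lambda>x. u x - v x) \<in> L2 \<mu>"
  using L2_add[OF _ L2_scale, of u \<mu> v "-1"] by simp

lemma L2_inner_sym: "L2_inner \<mu> u v = L2_inner \<mu> v u"
  by (simp add: L2_inner_def mult.commute)

lemma L2_inner_add:
  assumes "u \<in> L2 \<mu>" "v \<in> L2 \<mu>" "w \<in> L2 \<mu>"
  shows "L2_inner \<mu> (\<lambda>x. u x + v x) w = L2_inner \<mu> u w + L2_inner \<mu> v w"
  using assms by (simp add: L2_inner_def distrib_right L2_integrable_mult)

lemma L2_inner_diff:
  assumes "u \<in> L2 \<mu>" "v \<in> L2 \<mu>" "w \<in> L2 \<mu>"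
  shows "L2_inner \<mu> (\<lambda>x. u x - v x) w = L2_inner \<mu> u w - L2_inner \<mu> v w"
  using assms by (simp add: L2_inner_def left_diff_distrib L2_integrable_mult)

lemma L2_inner_scale: "L2_inner \<mu> (\<lambda>x. a * u x) w = a * L2_inner \<mu> u w"
  by (simp add: L2_inner_def mult.assoc)

lemma L2_inner_self_nonneg: "0 \<le> L2_inner \<mu> u u"
  by (simp add: L2_inner_def)

lemma L2_inner_cong_AE:
  assumes "AE x in \<mu>. u x = u' x" "u \<in> borel_measurable \<mu>" "u' \<in> borel_measurable \<mu>" "v \<in> borel_measurable \<mu>"
  shows "L2_inner \<mu> u v = L2_inner \<mu> u' v"
  unfolding L2_inner_def by (rule integral_cong_AE) (use assms in auto)

lemma L2_norm_cong_AE: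
  assumes "AE x in \<mu>. u x = u' x" "u \<in> borel_measurable \<mu>" "u' \<in> borel_measurable \<mu>"
  shows "L2_norm \<mu> u = L2_norm \<mu> u'"
  unfolding L2_norm_def L2_inner_def
  by (rule arg_cong[where f=sqrt], rule integral_cong_AE) (use assms in auto)

lemma L2_norm_nonneg: "0 \<le> L2_norm \<mu> u"
  by (simp add: L2_norm_def L2_inner_self_nonneg)

lemma L2_norm_square: "(L2_norm \<mu> u)\<^sup>2 = L2_inner \<mu> u u"
  by (simp add: L2_norm_def L2_inner_self_nonneg)

lemma L2_norm_minus_commute: "L2_norm \<mu> (\<lambda>x. u x - v x) = L2_norm \<mu> (\<lambda>x. v x - u x)"
  by (simp add: L2_norm_def L2_inner_def) (auto intro!: Bochner_Integration.integral_cong simp: algebra_simps)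

lemma L2_Cauchy_Schwarz:
  assumes "u \<in> L2 \<mu>" "v \<in> L2 \<mu>"
  shows "\<bar>L2_inner \<mu> u v\<bar> \<le> L2_norm \<mu> u * L2_norm \<mu> v"
proof -
  have "(L2_inner \<mu> u v)\<^sup>2 \<le> L2_inner \<mu> u u * L2_inner \<mu> v v"
    by (rule psd_form_Cauchy_Schwarz[OF L2_add L2_scale L2_inner_sym L2_inner_add L2_inner_scale
          L2_inner_self_nonneg assms])
  then have "\<bar>L2_inner \<mu> u v\<bar>\<^sup>2 \<le> (L2_norm \<mu> u * L2_norm \<mu> v)\<^sup>2"
    by (simp add: L2_norm_square power_mult_distrib)
  then show ?thesis by (rule power2_le_imp_le) (simp add: L2_norm_nonneg)
qed

section \<open>Density of the generator domain and self-adjointness of the semigroup\<close>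

lemma dirichlet_form_diff:
  assumes "dirichlet_form \<mu> \<E> \<F>" "u \<in> \<F>" "v \<in> \<F>" shows "(\<lambda>x. u x - v x) \<in> \<F>"
proof -
  note D = assms(1)[unfolded dirichlet_form_def, THEN conjunct2, THEN conjunct2]
  from D[THEN conjunct2, THEN conjunct1] assms(3) have "(\<lambda>x. -1 * v x) \<in> \<F>" by blast
  from D[THEN conjunct1, THEN bspec, THEN bspec, OF assms(2) this] show ?thesis by simp
qed

text \<open>The approximant is the resolvent \<open>\<lambda>(\<lambda> - A)\<^sup>-\<^sup>1 f\<close> with \<open>\<lambda>\<close> large.\<close>

lemma generator_domain_dense:
  assumes D: "dirichlet_form \<mu> \<E> \<F>" and f: "f \<in> \<F>" and e: "0 < e"
  shows "\<exists>u\<in>\<F>. \<exists>w\<in>L2 \<mu>. (\<forall>v\<in>\<F>. \<E> u v = - L2_inner \<mu> w v) \<and> L2_norm \<mu> (\<lambda>x. f x - u x) < e"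
proof -
  note D' = D[unfolded dirichlet_form_def]
  have mem: "u \<in> L2 \<mu>" if "u \<in> \<F>" for u using D'[THEN conjunct1] that by blast
  note F0 = D'[THEN conjunct2, THEN conjunct1]
  have Fadd: "(\<lambda>x. u x + v x) \<in> \<F>" if "u \<in> \<F>" "v \<in> \<F>" for u v
    using D'[THEN conjunct2, THEN conjunct2, THEN conjunct1] that by blast
  have Fscale: "(\<lambda>x. a * u x) \<in> \<F>" if "u \<in> \<F>" for a u
    using D'[THEN conjunct2, THEN conjunct2, THEN conjunct2, THEN conjunct1] that by blast
  have Esym: "\<E> u v = \<E> v u" if "u \<in> \<F>" "v \<in> \<F>" for u v
    using D'[THEN conjunct2, THEN conjunct2, THEN conjunct2, THEN conjunct2, THEN conjunct2, THEN conjunct2, THEN conjunct1] that by blast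
  have Eadd: "\<E> (\<lambda>x. u x + v x) w = \<E> u w + \<E> v w" if "u \<in> \<F>" "v \<in> \<F>" "w \<in> \<F>" for u v w
    using D'[THEN conjunct2, THEN conjunct2, THEN conjunct2, THEN conjunct2, THEN conjunct2, THEN conjunct2, THEN conjunct2, THEN conjunct1] that by blast
  have Escale: "\<E> (\<lambda>x. a * u x) v = a * \<E> u v" if "u \<in> \<F>" "v \<in> \<F>" for a u v
    using D'[THEN conjunct2, THEN conjunct2, THEN conjunct2, THEN conjunct2, THEN conjunct2, THEN conjunct2, THEN conjunct2, THEN conjunct2, THEN conjunct1] that by blast
  have Epos: "0 \<le> \<E> u u" if "u \<in> \<F>" for u
    using D'[THEN conjunct2, THEN conjunct2, THEN conjunct2, THEN conjunct2, THEN conjunct2, THEN conjunct2, THEN conjunct2, THEN conjunct2, THEN conjunct2, THEN conjunct1] that by blast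
  \<comment> \<open>The resolvent parameter. The error of the resolvent satisfies c |u - f|^2 \<le>
    E(f,f), and this choice makes E(f,f) < c e^2.\<close>
  define c where "c = 1 + \<E> f f / e\<^sup>2"
  have c1: "1 \<le> c" using Epos[OF f] by (simp add: c_def)
  define B where "B u v = \<E> u v + c * L2_inner \<mu> u v" for u v
  have Bge: "\<E> u u + (L2_norm \<mu> u)\<^sup>2 \<le> B u u" for u
    using mult_right_mono[OF c1 L2_inner_self_nonneg[of \<mu> u]] by (simp add: B_def L2_norm_square)
  have Ble: "B u u \<le> c * (\<E> u u + (L2_norm \<mu> u)\<^sup>2)" if "u \<in> \<F>" for u
    using mult_right_mono[OF c1 Epos[OF that]] by (simp add: B_def L2_norm_square algebra_simps)
  have Bpos: "0 \<le> B u u" if "u \<in> \<F>" for u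
    using Bge[of u] Epos[OF that] by (smt (verit) zero_le_power2)
  have "\<exists>w\<in>\<F>. \<forall>v\<in>\<F>. B w v = c * L2_inner \<mu> f v"
  proof (rule psd_form_riesz[where V=\<F> and B=B and l="\<lambda>v. c * L2_inner \<mu> f v" and K="c * (L2_norm \<mu> f)\<^sup>2"])
    show "\<F> \<noteq> {}" using F0 by blast
    show "B u v = B v u" if "u \<in> \<F>" "v \<in> \<F>" for u v
      using Esym[OF that] by (simp add: B_def L2_inner_sym)
    show "B (\<lambda>x. u x + v x) w = B u w + B v w" if "u \<in> \<F>" "v \<in> \<F>" "w \<in> \<F>" for u v w
      using Eadd[OF that] L2_inner_add[OF that[THEN mem]] by (simp add: B_def algebra_simps)
    show "B (\<lambda>x. a * u x) v = a * B u v" if "u \<in> \<F>" "v \<in> \<F>" for a u v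
      using Escale[OF that] by (simp add: B_def L2_inner_scale algebra_simps)
    show "c * L2_inner \<mu> f (\<lambda>x. u x + v x) = c * L2_inner \<mu> f u + c * L2_inner \<mu> f v"
      if "u \<in> \<F>" "v \<in> \<F>" for u v
      using L2_inner_add[OF that[THEN mem] mem[OF f]] by (simp add: L2_inner_sym[of \<mu> f] algebra_simps)
    show "c * L2_inner \<mu> f (\<lambda>x. a * u x) = a * (c * L2_inner \<mu> f u)" for a u
      by (simp add: L2_inner_sym[of \<mu> f] L2_inner_scale)
    show "(c * L2_inner \<mu> f v)\<^sup>2 \<le> c * (L2_norm \<mu> f)\<^sup>2 * B v v" if v: "v \<in> \<F>" for v
    proof -
      have "\<bar>L2_inner \<mu> f v\<bar>\<^sup>2 \<le> (L2_norm \<mu> f * L2_norm \<mu> v)\<^sup>2"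
        by (rule power_mono[OF L2_Cauchy_Schwarz[OF mem[OF f] mem[OF v]]]) simp
      then have "(c * L2_inner \<mu> f v)\<^sup>2 \<le> c * (L2_norm \<mu> f)\<^sup>2 * (c * (L2_norm \<mu> v)\<^sup>2)"
        using mult_left_mono[of _ _ "c\<^sup>2"] by (simp add: power_mult_distrib power2_eq_square mult.assoc mult.left_commute)
      also have "\<dots> \<le> c * (L2_norm \<mu> f)\<^sup>2 * B v v"
        using c1 Epos[OF v] by (intro mult_left_mono) (auto simp: B_def L2_norm_square L2_inner_self_nonneg)
      finally show ?thesis .
    qed
    show "0 \<le> c * (L2_norm \<mu> f)\<^sup>2" using c1 by simp
  next
    fix u :: "nat \<Rightarrow> 'a \<Rightarrow> real"
    assume u: "\<And>n. u n \<in> \<F>"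
      and C: "\<forall>e>0. \<exists>N. \<forall>m\<ge>N. \<forall>n\<ge>N. B (\<lambda>x. u m x - u n x) (\<lambda>x. u m x - u n x) < e"
    have "\<forall>e>0. \<exists>N. \<forall>m\<ge>N. \<forall>n\<ge>N.
           \<E> (\<lambda>x. u m x - u n x) (\<lambda>x. u m x - u n x) + (L2_norm \<mu> (\<lambda>x. u m x - u n x))\<^sup>2 < e"
      using C Bge by (meson le_less_trans)
    from D'[THEN conjunct2, THEN conjunct2, THEN conjunct2, THEN conjunct2, THEN conjunct2, THEN conjunct2, THEN conjunct2, THEN conjunct2, THEN conjunct2, THEN conjunct2, THEN conjunct1, THEN spec, THEN mp, THEN mp, of u, OF _ this] u obtain w where w: "w \<in> \<F>"
      and lim: "(\<lambda>n. \<E> (\<lambda>x. u n x - w x) (\<lambda>x. u n x - w x) + (L2_norm \<mu> (\<lambda>x. u n x - w x))\<^sup>2) \<longlonglongrightarrow> 0"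
      by auto
    have d: "(\<lambda>x. u n x - w x) \<in> \<F>" for n using dirichlet_form_diff[OF D u w] .
    have "(\<lambda>n. B (\<lambda>x. u n x - w x) (\<lambda>x. u n x - w x)) \<longlonglongrightarrow> 0"
      by (rule tendsto_0_squeeze[OF _ _ tendsto_mult_right_zero[OF lim, of c]]) (use Bpos[OF d] Ble[OF d] in auto)
    with w show "\<exists>w\<in>\<F>. (\<lambda>n. B (\<lambda>x. u n x - w x) (\<lambda>x. u n x - w x)) \<longlonglongrightarrow> 0" by blast
  qed (use Fadd Fscale Bpos in auto)
  then obtain u where u: "u \<in> \<F>" and eq: "\<And>v. v \<in> \<F> \<Longrightarrow> B u v = c * L2_inner \<mu> f v" by blast
  define w where "w x = c * (u x - f x)" for x
  have d: "(\<lambda>x. u x - f x) \<in> \<F>" using dirichlet_form_diff[OF D u f] .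
  have w: "w \<in> L2 \<mu>" unfolding w_def using L2_scale[OF mem[OF d]] .
  have Ew: "\<E> u v = - L2_inner \<mu> w v" if v: "v \<in> \<F>" for v
  proof -
    have "L2_inner \<mu> w v = c * (L2_inner \<mu> u v - L2_inner \<mu> f v)"
      unfolding w_def L2_inner_scale L2_inner_diff[OF mem[OF u] mem[OF f] mem[OF v]] ..
    with eq[OF v] show ?thesis by (simp add: B_def right_diff_distrib)
  qed
  \<comment> \<open>The resolvent equation tested with u - f gives c |u - f|^2 = E(u,f) - E(u,u);
    Cauchy-Schwarz for E bounds the right-hand side by E(f,f).\<close>
  have E2: "\<E> u (\<lambda>x. u x - f x) = - c * (L2_norm \<mu> (\<lambda>x. u x - f x))\<^sup>2"
    using Ew[OF d] by (simp only: w_def[abs_def] L2_inner_scale L2_norm_square)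
  have dd: "\<E> u (\<lambda>x. u x - f x) = \<E> u u - \<E> u f"
    using Esym[OF u d] Eadd[OF u Fscale[OF f, of "-1"] u] Escale[OF f u, of "-1"] Esym[OF f u] by simp
  have CS: "(\<E> u f)\<^sup>2 \<le> \<E> u u * \<E> f f"
    by (rule psd_form_Cauchy_Schwarz[OF Fadd Fscale Esym Eadd Escale Epos u f])
  have "\<E> u f - \<E> u u \<le> \<E> f f"
  proof (rule ccontr)
    assume "\<not> \<E> u f - \<E> u u \<le> \<E> f f"
    then have "\<E> u u + \<E> f f < \<E> u f" by simp
    then have "(\<E> u u + \<E> f f)\<^sup>2 < (\<E> u f)\<^sup>2" using Epos[OF u] Epos[OF f] by (intro power_strict_mono) auto
    with CS have "(\<E> u u)\<^sup>2 + (\<E> f f)\<^sup>2 + \<E> u u * \<E> f f < 0" by (simp add: power2_eq_square algebra_simps)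
    moreover have "0 \<le> (\<E> u u)\<^sup>2 + (\<E> f f)\<^sup>2 + \<E> u u * \<E> f f" using Epos[OF u] Epos[OF f] by simp
    ultimately show False by simp
  qed
  then have "c * (L2_norm \<mu> (\<lambda>x. u x - f x))\<^sup>2 \<le> \<E> f f" using E2 dd by simp
  also have "\<dots> < c * e\<^sup>2" using e Epos[OF f] by (simp add: c_def algebra_simps)
  finally have "(L2_norm \<mu> (\<lambda>x. u x - f x))\<^sup>2 < e\<^sup>2" using c1 by simp
  then have "L2_norm \<mu> (\<lambda>x. u x - f x) < e" by (rule power2_less_imp_less) (use e in simp)
  then have "L2_norm \<mu> (\<lambda>x. f x - u x) < e" by (subst L2_norm_minus_commute)
  with u w Ew show ?thesis by blast
qed


text \<open>Continuity and additivity carry the zero from the approximating set to the limit. It is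
  applied twice in a row, from the generator domain to \<open>\<F>\<close> in the L2 norm and from
  \<open>\<F>\<close> to all of L2, so \<open>S\<close> is kept arbitrary.\<close>

lemma L2_inner_approx_zero:
  assumes bound: "\<And>u. u \<in> L2 \<mu> \<Longrightarrow> \<bar>D u\<bar> \<le> K * L2_norm \<mu> u"
    and diff: "\<And>u u'. u \<in> L2 \<mu> \<Longrightarrow> u' \<in> L2 \<mu> \<Longrightarrow> D (\<lambda>x. u x - u' x) = D u - D u'"
    and S: "S \<subseteq> L2 \<mu>" "\<And>u. u \<in> S \<Longrightarrow> D u = (0::real)"
    and u: "u \<in> L2 \<mu>" and approx: "\<And>e. 0 < e \<Longrightarrow> \<exists>u'\<in>S. L2_norm \<mu> (\<lambda>x. u x - u' x) < e"
  shows "D u = 0"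
proof (rule ccontr)
  assume "D u \<noteq> 0"
  then have pos: "0 < \<bar>D u\<bar> / (\<bar>K\<bar> + 1)" by simp
  from approx[OF this] obtain u' where u': "u' \<in> S" and lt: "L2_norm \<mu> (\<lambda>x. u x - u' x) < \<bar>D u\<bar> / (\<bar>K\<bar> + 1)"
    by blast
  have u'L: "u' \<in> L2 \<mu>" using u' S by blast
  have "\<bar>D u\<bar> = \<bar>D (\<lambda>x. u x - u' x)\<bar>" using diff[OF u u'L] S(2)[OF u'] by simp
  also have "\<dots> \<le> K * L2_norm \<mu> (\<lambda>x. u x - u' x)" by (rule bound[OF L2_diff[OF u u'L]])
  also have "\<dots> \<le> (\<bar>K\<bar> + 1) * L2_norm \<mu> (\<lambda>x. u x - u' x)"
    by (rule mult_right_mono) (auto simp: L2_norm_nonneg)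
  also have "\<dots> < \<bar>D u\<bar>" using lt by (simp add: field_simps)
  finally show False by simp
qed

text \<open>For \<open>u, v\<close> in the domain of the generator the increments of \<open>s \<mapsto> \<langle>P\<^sub>t\<^sub>-\<^sub>s u, P\<^sub>s v\<rangle>\<close> over a partition
  of mesh \<open>h\<close> are \<open>o(h)\<close>, because the generator is symmetric.\<close>

lemma heat_semigroup_symmetric:
  assumes D: "dirichlet_form \<mu> \<E> \<F>" and H: "heat_semigroup \<mu> \<E> \<F> P"
    and t: "0 < t" and u: "u \<in> L2 \<mu>" and v: "v \<in> L2 \<mu>"
  shows "L2_inner \<mu> (P t u) v = L2_inner \<mu> u (P t v)"
proof -
  note H' = H[unfolded heat_semigroup_def]
  have PL: "P s a \<in> L2 \<mu>" and Pc: "L2_norm \<mu> (P s a) \<le> L2_norm \<mu> a" if "0 < s" "a \<in> L2 \<mu>" for s a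
    using H'[THEN conjunct1] that by auto
  have Padd: "AE x in \<mu>. P s (\<lambda>y. a y + b y) x = P s a x + P s b x" if "0 < s" "a \<in> L2 \<mu>" "b \<in> L2 \<mu>" for s a b
    using H'[THEN conjunct2, THEN conjunct1] that by blast
  have Pscale: "AE x in \<mu>. P s (\<lambda>y. c * a y) x = c * P s a x" if "0 < s" "a \<in> L2 \<mu>" for s c a
    using H'[THEN conjunct2, THEN conjunct2, THEN conjunct1] that by blast
  have Psg: "AE x in \<mu>. P (s + r) a x = P s (P r a) x" if "0 < s" "0 < r" "a \<in> L2 \<mu>" for s r a
    using H'[THEN conjunct2, THEN conjunct2, THEN conjunct2, THEN conjunct1] that by blast
  have gen: "((\<lambda>t. L2_norm \<mu> (\<lambda>x. (P t u x - u x) / t - w x)) \<longlongrightarrow> 0) (at_right 0) \<longleftrightarrow>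
        u \<in> \<F> \<and> (\<forall>v\<in>\<F>. \<E> u v = - L2_inner \<mu> w v)" if "u \<in> L2 \<mu>" "w \<in> L2 \<mu>" for u w
    using H'[THEN conjunct2, THEN conjunct2, THEN conjunct2, THEN conjunct2, THEN conjunct2] that by blast
  note D' = D[unfolded dirichlet_form_def]
  have FL: "\<F> \<subseteq> L2 \<mu>" using D'[THEN conjunct1] .
  have dense: "\<exists>u\<in>\<F>. L2_norm \<mu> (\<lambda>x. f x - u x) < e" if "f \<in> L2 \<mu>" "0 < e" for f e
    using D'[THEN conjunct2, THEN conjunct2, THEN conjunct2, THEN conjunct2, THEN conjunct1] that by blast
  have Esym: "\<E> u v = \<E> v u" if "u \<in> \<F>" "v \<in> \<F>" for u v
    using D'[THEN conjunct2, THEN conjunct2, THEN conjunct2, THEN conjunct2, THEN conjunct2, THEN conjunct2, THEN conjunct1] that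
    by blast
  \<comment> \<open>The graph of the generator. It is kept as a relation because a function
    represents its class only up to null sets.\<close>
  define G where "G = {(a, a'). a \<in> L2 \<mu> \<and> a' \<in> L2 \<mu> \<and> a \<in> \<F> \<and> (\<forall>v\<in>\<F>. \<E> a v = - L2_inner \<mu> a' v)}"
  define q where "q h a a' = L2_norm \<mu> (\<lambda>x. (P h a x - a x) / h - a' x)" for h a a'
  have Pdiff: "AE x in \<mu>. P s (\<lambda>y. a y - b y) x = P s a x - P s b x"
    if s: "0 < s" and a: "a \<in> L2 \<mu>" and b: "b \<in> L2 \<mu>" for s a b
  proof -
    have "(\<lambda>y. a y - b y) = (\<lambda>y. a y + -1 * b y)" by simp
    then show ?thesis using Padd[OF s a L2_scale[OF b, of "-1"]] Pscale[OF s b, of "-1"]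
      by (auto elim: eventually_elim2)
  qed
  have qL: "(\<lambda>x. (P h a x - a x) / h - a' x) \<in> L2 \<mu>" if "0 < h" "a \<in> L2 \<mu>" "a' \<in> L2 \<mu>" for h a a'
    using L2_diff[OF L2_scale[OF L2_diff[OF PL[OF that(1,2)] that(2)], of "1/h"] that(3)] by simp
  \<comment> \<open>\<open>P s\<close> commutes with the difference quotient and is a contraction,
    so the error of the quotient at \<open>a\<close> controls it along the whole orbit; this gives
    one bound for all partition points.\<close>
  have qP: "q h (P s a) (P s a') \<le> q h a a'"
    if h: "0 < h" and s: "0 < s" and a: "a \<in> L2 \<mu>" and a': "a' \<in> L2 \<mu>" for h s a a'
  proof -
    note Ph = PL[OF h a]
    note d = L2_diff[OF Ph a]
    have sd: "(\<lambda>x. (P h a x - a x) / h) \<in> L2 \<mu>" using L2_scale[OF d, of "1/h"] by simp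
    have "AE x in \<mu>. (P h (P s a) x - P s a x) / h - P s a' x = P s (\<lambda>x. (P h a x - a x) / h - a' x) x"
      using Pdiff[OF s sd a'] Pscale[OF s d, of "1/h"] Pdiff[OF s Ph a] Psg[OF s h a] Psg[OF h s a]
      by eventually_elim (simp add: add.commute)
    then have "q h (P s a) (P s a') = L2_norm \<mu> (P s (\<lambda>x. (P h a x - a x) / h - a' x))"
      unfolding q_def
      by (rule L2_norm_cong_AE)
        (use qL[OF h PL[OF s a] PL[OF s a']] PL[OF s qL[OF h a a']] in \<open>auto dest: L2_measurable\<close>)
    also have "\<dots> \<le> q h a a'" unfolding q_def by (rule Pc[OF s qL[OF h a a']])
    finally show ?thesis .
  qed
  have q0: "((\<lambda>h. q h a a') \<longlongrightarrow> 0) (at_right 0)" if "(a, a') \<in> G" for a a'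
    using that gen[of a a'] by (simp add: G_def q_def)
  have qnn: "0 \<le> q h a a'" for h a a' by (simp add: q_def L2_norm_nonneg)
  have GP: "(P s a, P s a') \<in> G" if "(a, a') \<in> G" "0 < s" for a a' s
  proof -
    have a: "a \<in> L2 \<mu>" "a' \<in> L2 \<mu>" using that by (auto simp: G_def)
    have "((\<lambda>h. q h (P s a) (P s a')) \<longlongrightarrow> 0) (at_right 0)"
    proof (rule tendsto_sandwich[OF _ _ tendsto_const q0[OF that(1)]])
      show "\<forall>\<^sub>F h in at_right 0. q h (P s a) (P s a') \<le> q h a a'"
        unfolding eventually_at_right_field using qP[OF _ that(2) a] by (intro exI[of _ 1]) auto
    qed (simp add: qnn)
    then show ?thesis using gen[OF PL[OF that(2) a(1)] PL[OF that(2) a(2)]] PL[OF that(2)] a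
      by (simp add: G_def q_def)
  qed
  have Gsym: "L2_inner \<mu> a' b = L2_inner \<mu> a b'" if "(a, a') \<in> G" "(b, b') \<in> G" for a a' b b'
    using that Esym[of a b] by (auto simp: G_def L2_inner_sym[of \<mu> a b'])
  \<comment> \<open>Both pairings are expanded to first order in h; the linear terms cancel because
    the generator is symmetric, and only the errors \<open>q\<close> remain.\<close>
  have step: "\<bar>L2_inner \<mu> a (P h b) - L2_inner \<mu> (P h a) b\<bar> \<le> h * (L2_norm \<mu> a * q h b b' + q h a a' * L2_norm \<mu> b)"
    if ga: "(a, a') \<in> G" and gb: "(b, b') \<in> G" and h: "0 < h" for a a' b b' h
  proof -
    have L: "a \<in> L2 \<mu>" "a' \<in> L2 \<mu>" "b \<in> L2 \<mu>" "b' \<in> L2 \<mu>" using ga gb by (auto simp: G_def)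
    have id: "L2_inner \<mu> (\<lambda>x. (P h c x - c x) / h - c' x) d
        = (L2_inner \<mu> (P h c) d - L2_inner \<mu> c d) / h - L2_inner \<mu> c' d"
      if "c \<in> L2 \<mu>" "c' \<in> L2 \<mu>" "d \<in> L2 \<mu>" for c c' d
    proof -
      note e = L2_diff[OF PL[OF h that(1)] that(1)]
      have "(\<lambda>x. (1/h) * (P h c x - c x)) \<in> L2 \<mu>" by (rule L2_scale[OF e])
      then have "L2_inner \<mu> (\<lambda>x. (1/h) * (P h c x - c x) - c' x) d
          = L2_inner \<mu> (\<lambda>x. (1/h) * (P h c x - c x)) d - L2_inner \<mu> c' d"
        by (rule L2_inner_diff) (rule that)+
      then show ?thesis unfolding L2_inner_scale L2_inner_diff[OF PL[OF h that(1)] that(1,3)] by simp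
    qed
    have "\<bar>L2_inner \<mu> a (P h b) - L2_inner \<mu> (P h a) b\<bar>
      = \<bar>h * (L2_inner \<mu> (\<lambda>x. (P h b x - b x) / h - b' x) a - L2_inner \<mu> (\<lambda>x. (P h a x - a x) / h - a' x) b)\<bar>"
      using id[OF L(3,4,1)] id[OF L(1,2,3)] Gsym[OF ga gb] h
      by (simp add: L2_inner_sym[of \<mu> _ a] L2_inner_sym[of \<mu> b'] field_simps)
    also have "\<dots> \<le> h * (\<bar>L2_inner \<mu> (\<lambda>x. (P h b x - b x) / h - b' x) a\<bar> + \<bar>L2_inner \<mu> (\<lambda>x. (P h a x - a x) / h - a' x) b\<bar>)"
      unfolding abs_mult using h by (intro mult_mono) auto
    also have "\<dots> \<le> h * (q h b b' * L2_norm \<mu> a + q h a a' * L2_norm \<mu> b)"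
      unfolding q_def using h by (intro mult_left_mono add_mono L2_Cauchy_Schwarz qL L) auto
    finally show ?thesis by (simp add: mult.commute)
  qed
  have dom: "L2_inner \<mu> (P t a) b = L2_inner \<mu> a (P t b)" if ga: "(a, a') \<in> G" and gb: "(b, b') \<in> G" for a a' b b'
  proof -
    have L: "a \<in> L2 \<mu>" "a' \<in> L2 \<mu>" "b \<in> L2 \<mu>" "b' \<in> L2 \<mu>" using ga gb by (auto simp: G_def)
    \<comment> \<open>The semigroup is specified for positive times only, so the endpoint s = 0 of
      the partition is filled in by the identity.\<close>
    define Q where "Q s c = (if s = 0 then c else P s c)" for s c
    have QG: "(Q s c, Q s c') \<in> G" if "(c, c') \<in> G" "0 \<le> s" for c c' s
      using GP[OF that(1), of s] that by (auto simp: Q_def)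
    have Qc: "L2_norm \<mu> (Q s c) \<le> L2_norm \<mu> c" if "c \<in> L2 \<mu>" "0 \<le> s" for c s
      using Pc[of s c] that by (auto simp: Q_def)
    have Qq: "q h (Q s c) (Q s c') \<le> q h c c'" if "0 < h" "c \<in> L2 \<mu>" "c' \<in> L2 \<mu>" "0 \<le> s" for h c c' s
      using qP[of h s c c'] that by (auto simp: Q_def)
    have Qs: "AE x in \<mu>. P h (Q s c) x = Q (s + h) c x" if "0 < h" "c \<in> L2 \<mu>" "0 \<le> s" for h s c
      using Psg[of h s c] that by (auto simp: Q_def add.commute)
    have QL: "Q s c \<in> L2 \<mu>" if "c \<in> L2 \<mu>" "0 \<le> s" for s c using PL[of s c] that by (auto simp: Q_def)
    define Bd where "Bd h = t * (L2_norm \<mu> a * q h b b' + q h a a' * L2_norm \<mu> b)" for h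
    have est: "\<bar>L2_inner \<mu> a (P t b) - L2_inner \<mu> (P t a) b\<bar> \<le> Bd (t / real (Suc m))" for m
    proof -
      define h where "h = t / real (Suc m)"
      have h: "0 < h" using t by (simp add: h_def)
      define F where "F j = L2_inner \<mu> (Q (real (Suc m - j) * h) a) (Q (real j * h) b)" for j
      have "\<bar>F (Suc j) - F j\<bar> \<le> Bd h / real (Suc m)" if j: "j < Suc m" for j
      proof -
        define a1 a1' where "a1 = Q (real (m - j) * h) a" and "a1' = Q (real (m - j) * h) a'"
        define b1 b1' where "b1 = Q (real j * h) b" and "b1' = Q (real j * h) b'"
        have G1: "(a1, a1') \<in> G" "(b1, b1') \<in> G"
          unfolding a1_def a1'_def b1_def b1'_def using h by (auto intro!: QG ga gb)
        have L1: "a1 \<in> L2 \<mu>" "b1 \<in> L2 \<mu>" using G1 by (auto simp: G_def)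
        have e1: "real (m - j) * h + h = real (Suc m - j) * h" "real j * h + h = real (Suc j) * h"
          using j by (simp_all add: Suc_diff_le algebra_simps)
        have "F j = L2_inner \<mu> (P h a1) b1"
          unfolding F_def b1_def[symmetric]
          by (rule L2_inner_cong_AE[symmetric])
            (use Qs[OF h L(1), of "real (m - j) * h"] h PL[OF h L1(1)] L1 QL[OF L(1), of "real (Suc m - j) * h"] in
              \<open>auto simp: a1_def e1 dest: L2_measurable\<close>)
        moreover have "F (Suc j) = L2_inner \<mu> a1 (P h b1)"
          unfolding F_def diff_Suc_Suc a1_def[symmetric] L2_inner_sym[of \<mu> a1]
          by (rule L2_inner_cong_AE[symmetric])
            (use Qs[OF h L(3), of "real j * h"] h PL[OF h L1(2)] L1 QL[OF L(3), of "real (Suc j) * h"] in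
              \<open>auto simp: b1_def e1 dest: L2_measurable simp del: of_nat_Suc\<close>)
        ultimately have "\<bar>F (Suc j) - F j\<bar> \<le> h * (L2_norm \<mu> a1 * q h b1 b1' + q h a1 a1' * L2_norm \<mu> b1)"
          using step[OF G1 h] by simp
        also have "\<dots> \<le> h * (L2_norm \<mu> a * q h b b' + q h a a' * L2_norm \<mu> b)"
          unfolding a1_def a1'_def b1_def b1'_def using h
          by (intro mult_left_mono add_mono mult_mono Qc Qq L) (auto simp: L2_norm_nonneg qnn)
        also have "\<dots> = Bd h / real (Suc m)" by (simp add: Bd_def h_def)
        finally show ?thesis .
      qed
      then have "(\<Sum>j<Suc m. \<bar>F (Suc j) - F j\<bar>) \<le> (\<Sum>j<Suc m. Bd h / real (Suc m))"
        by (intro sum_mono) auto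
      also have "\<dots> = Bd h" by simp
      finally have "\<bar>\<Sum>j<Suc m. F (Suc j) - F j\<bar> \<le> Bd h" using sum_abs order_trans by metis
      then have "\<bar>F (Suc m) - F 0\<bar> \<le> Bd h" by (simp only: sum_lessThan_telescope)
      moreover have "real (Suc m) * h = t" by (simp add: h_def)
      ultimately show ?thesis unfolding F_def using t h by (simp add: Q_def h_def)
    qed
    have "filterlim (\<lambda>m. t / real (Suc m)) (at_right 0) sequentially"
      unfolding filterlim_at using t LIMSEQ_Suc[OF lim_const_over_n[of t]] by auto
    then have "(\<lambda>m. Bd (t / real (Suc m))) \<longlonglongrightarrow> t * (L2_norm \<mu> a * 0 + 0 * L2_norm \<mu> b)"
      unfolding Bd_def using q0[OF ga] q0[OF gb] by (intro tendsto_intros) (auto intro: filterlim_compose)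
    then have "(\<lambda>m. Bd (t / real (Suc m))) \<longlonglongrightarrow> 0" by simp
    then have "\<bar>L2_inner \<mu> a (P t b) - L2_inner \<mu> (P t a) b\<bar> \<le> 0"
      by (rule LIMSEQ_le_const) (use est in auto)
    then show ?thesis by simp
  qed
  define Df where "Df c b = L2_inner \<mu> (P t c) b - L2_inner \<mu> c (P t b)" for c b
  have Dfb: "\<bar>Df c b\<bar> \<le> (2 * L2_norm \<mu> b) * L2_norm \<mu> c" if c: "c \<in> L2 \<mu>" and b: "b \<in> L2 \<mu>" for c b
  proof -
    have "\<bar>L2_inner \<mu> (P t c) b\<bar> \<le> L2_norm \<mu> c * L2_norm \<mu> b"
      by (rule order_trans[OF L2_Cauchy_Schwarz[OF PL[OF t c] b]])
        (intro mult_right_mono Pc t c L2_norm_nonneg)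
    moreover have "\<bar>L2_inner \<mu> c (P t b)\<bar> \<le> L2_norm \<mu> c * L2_norm \<mu> b"
      by (rule order_trans[OF L2_Cauchy_Schwarz[OF c PL[OF t b]]])
        (intro mult_left_mono Pc t b L2_norm_nonneg)
    ultimately show ?thesis unfolding Df_def
      using mult.commute[of "L2_norm \<mu> c" "L2_norm \<mu> b"] by linarith
  qed
  have Dfd: "Df (\<lambda>x. c x - c' x) b = Df c b - Df c' b"
    if c: "c \<in> L2 \<mu>" "c' \<in> L2 \<mu>" and b: "b \<in> L2 \<mu>" for c c' b
  proof -
    have "L2_inner \<mu> (P t (\<lambda>x. c x - c' x)) b = L2_inner \<mu> (\<lambda>x. P t c x - P t c' x) b"
      by (rule L2_inner_cong_AE[OF Pdiff[OF t c]])
        (use PL[OF t L2_diff[OF c]] PL[OF t c(1)] PL[OF t c(2)] b in \<open>auto dest: L2_measurable\<close>)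
    then show ?thesis unfolding Df_def
      using L2_inner_diff[OF PL[OF t c(1)] PL[OF t c(2)] b] L2_inner_diff[OF c PL[OF t b]] by simp
  qed
  \<comment> \<open>Antisymmetry of the defect allows the density argument, stated for the first
    slot, to be used in the second slot as well.\<close>
  have Dfs: "Df c b = - Df b c" for b c by (simp add: Df_def L2_inner_sym)
  define Dom where "Dom = fst ` G"
  have DomL: "Dom \<subseteq> L2 \<mu>" by (auto simp: Dom_def G_def)
  have domF: "\<exists>a'\<in>Dom. L2_norm \<mu> (\<lambda>x. c x - a' x) < e" if "c \<in> \<F>" "0 < e" for c e
    using generator_domain_dense[OF D that] FL unfolding Dom_def G_def by (force simp: image_iff)
  have ext: "Df c b = 0" if c: "c \<in> L2 \<mu>" and b: "b \<in> L2 \<mu>" and D0: "\<And>c'. c' \<in> Dom \<Longrightarrow> Df c' b = 0" for b c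
  proof -
    have F0: "Df c' b = 0" if c': "c' \<in> \<F>" for c'
      by (rule L2_inner_approx_zero[where D="\<lambda>c. Df c b" and S=Dom, OF Dfb[OF _ b] Dfd[OF _ _ b] DomL])
        (use D0 FL domF[OF c'] c' in blast)+
    show ?thesis
      by (rule L2_inner_approx_zero[where D="\<lambda>c. Df c b" and S=\<F>, OF Dfb[OF _ b] Dfd[OF _ _ b] FL F0 c dense[OF c]])
  qed
  have domdom: "Df c b = 0" if c: "c \<in> Dom" and b: "b \<in> Dom" for c b
  proof -
    obtain c' b' where "(c, c') \<in> G" "(b, b') \<in> G" using c b by (auto simp: Dom_def)
    then show ?thesis by (simp add: Df_def dom)
  qed
  have "Df c v = 0" if c: "c \<in> Dom" for c
    using ext[OF v subsetD[OF DomL c]] domdom c Dfs[of c v] by simp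
  with ext[OF u v] have "Df u v = 0" by blast
  then show ?thesis by (simp add: Df_def)
qed

section \<open>The kernel everywhere\<close>


text \<open>The standing assumptions in the form used below: the constants are named, and the kernel bounds
  hold everywhere instead of almost everywhere, by continuity and full support.\<close>

locale heat_kernel_wBE =
  fixes \<mu> :: "'a::metric_space measure"
    and p :: "real \<Rightarrow> 'a \<Rightarrow> 'a \<Rightarrow> real"
    and dH dW \<kappa> c1 c2 c3 c4 c5 c6 cB :: real
  assumes sets_mu: "sets \<mu> = sets borel"
    and open_prod: "\<And>U :: ('a \<times> 'a) set. open U \<Longrightarrow> U \<in> sets (borel \<Otimes>\<^sub>M borel)"
    and full_support: "\<And>U. open U \<Longrightarrow> U \<noteq> {} \<Longrightarrow> emeasure \<mu> U > 0"
    and compact_balls: "\<And>(x::'a) r. 0 < r \<Longrightarrow> compact (closure (ball x r))"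
    and dH_pos: "0 < dH" and dW_gt_2: "2 < dW" and kappa_pos: "0 < \<kappa>" and kappa_less: "\<kappa> < dW"
    and c_pos: "0 < c1" "0 < c2" "0 < c3" "0 < c4" "0 < c5" "0 < c6" "0 < cB"
    and ball_lower: "\<And>x r. 0 \<le> r \<Longrightarrow> ennreal (c1 * r powr dH) \<le> emeasure \<mu> (ball x r)"
    and ball_upper: "\<And>x r. 0 \<le> r \<Longrightarrow> emeasure \<mu> (ball x r) \<le> ennreal (c2 * r powr dH)"
    and p_cont: "\<And>t. 0 < t \<Longrightarrow> continuous_on UNIV (\<lambda>(x, y). p t x y)"
    and p_sym: "\<And>t x y. 0 < t \<Longrightarrow> p t x y = p t y x"
    and p_lower: "\<And>t x y. 0 < t \<Longrightarrow>
      c5 * t powr (- dH / dW) * exp (- c6 * (dist x y powr dW / t) powr (1 / (dW - 1))) \<le> p t x y"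
    and p_upper: "\<And>t x y. 0 < t \<Longrightarrow>
      p t x y \<le> c3 * t powr (- dH / dW) * exp (- c4 * (dist x y powr dW / t) powr (1 / (dW - 1)))"
    and heat_L2: "\<And>t u. 0 < t \<Longrightarrow> u \<in> L2 \<mu> \<Longrightarrow> heat_op \<mu> p t u \<in> L2 \<mu>"
    and heat_semigroup_AE: "\<And>s t u. 0 < s \<Longrightarrow> 0 < t \<Longrightarrow> u \<in> L2 \<mu> \<Longrightarrow>
      AE x in \<mu>. heat_op \<mu> p (s + t) u x = heat_op \<mu> p s (heat_op \<mu> p t u) x"
    and heat_Hoelder_Linf: "\<And>t g x y. 0 < t \<Longrightarrow> g \<in> Linf \<mu> \<Longrightarrow>
      \<bar>heat_op \<mu> p t g x - heat_op \<mu> p t g y\<bar>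
          \<le> cB * (dist x y powr \<kappa> / t powr (\<kappa> / dW)) * Linf_norm \<mu> g"

section \<open>Separability, and kernel properties from almost everywhere to everywhere\<close>

context sub_gaussian_dirichlet_space
begin

lemma sets_mu: "sets \<mu> = sets borel"
  using radon by (simp add: radon_measure_def)

text \<open>Closures of balls are compact, hence totally bounded; finite nets of mesh 1/(m+1) for
  the balls of radius n+1 about one point are collected over all n and m.\<close>

lemma countable_dense: "\<exists>D::'a set. countable D \<and> (\<forall>x. \<forall>e>0. \<exists>d\<in>D. dist d x < e)"
proof -
  fix x0 :: 'a
  have "\<exists>k. finite k \<and> closure (ball x0 (real (Suc n))) \<subseteq> (\<Union>x\<in>k. ball x (1 / real (Suc m)))" for n m
    using compact_balls[of "real (Suc n)" x0] unfolding compact_eq_totally_bounded by simp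
  then obtain k where k: "\<And>n m. finite (k n m)"
    "\<And>n m. closure (ball x0 (real (Suc n))) \<subseteq> (\<Union>x\<in>k n m. ball x (1 / real (Suc m)))"
    by metis
  show ?thesis
  proof (intro exI conjI allI impI)
    show "countable (\<Union>n. \<Union>m. k n m)" by (rule countable_UN[OF countableI_type countable_UN[OF countableI_type countable_finite[OF k(1)]]])
    fix x :: 'a and e :: real assume "0 < e"
    then obtain m where m: "1 / real (Suc m) < e" using nat_approx_posE by metis
    obtain n where n: "dist x0 x < real n" using reals_Archimedean2 by blast
    then have "x \<in> closure (ball x0 (real (Suc n)))" using closure_subset by fastforce
    with k(2)[of n m] obtain d where "d \<in> k n m" "x \<in> ball d (1 / real (Suc m))" by blast
    with m show "\<exists>d\<in>\<Union>n. \<Union>m. k n m. dist d x < e" by force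
  qed
qed

text \<open>The type of points is not an instance of \<open>second_countable_topology\<close>, so the library's
  \<open>borel_prod\<close> is not available.\<close>

lemma open_in_pair_borel:
  fixes U :: "('a \<times> 'a) set"
  assumes U: "open U"
  shows "U \<in> sets (borel \<Otimes>\<^sub>M borel)"
proof -
  obtain D :: "'a set" where D: "countable D" and dense: "\<And>x e. 0 < e \<Longrightarrow> \<exists>d\<in>D. dist d x < e"
    using countable_dense by blast
  \<comment> \<open>Both factors share one radius, so three countable indices suffice: two centres
    in the dense set and n.\<close>
  define \<B> where "\<B> = (\<lambda>(a, b, n). ball a (1 / real (Suc n)) \<times> ball b (1 / real (Suc n)))
    ` {(a, b, n). a \<in> D \<and> b \<in> D \<and> ball a (1 / real (Suc n)) \<times> ball b (1 / real (Suc n)) \<subseteq> U}"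
  have "countable (D \<times> D \<times> (UNIV :: nat set))" using D by (intro countable_SIGMA) auto
  then have "countable {(a, b, n). a \<in> D \<and> b \<in> D \<and> ball a (1 / real (Suc (n::nat))) \<times> ball b (1 / real (Suc n)) \<subseteq> U}"
    by (rule countable_subset[rotated]) auto
  then have cB: "countable \<B>" unfolding \<B>_def by (rule countable_image)
  have "U = \<Union>\<B>"
  proof
    show "\<Union>\<B> \<subseteq> U" by (auto simp: \<B>_def)
    show "U \<subseteq> \<Union>\<B>"
    proof
      fix z assume z: "z \<in> U"
      obtain x y where xy: "z = (x, y)" by (cases z)
      from U z obtain A B where AB: "open A" "open B" "x \<in> A" "y \<in> B" "A \<times> B \<subseteq> U"
        unfolding xy by (elim open_prod_elim) auto
      then obtain e1 e2 where e: "0 < e1" "0 < e2" "ball x e1 \<subseteq> A" "ball y e2 \<subseteq> B"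
        unfolding open_contains_ball by blast
      obtain n where n: "1 / real (Suc n) < min e1 e2 / 2" using e nat_approx_posE[of "min e1 e2 / 2"] by auto
      obtain a b where ab: "a \<in> D" "dist a x < 1 / real (Suc n)" "b \<in> D" "dist b y < 1 / real (Suc n)"
        using dense[of "1 / real (Suc n)" x] dense[of "1 / real (Suc n)" y] by (auto simp del: of_nat_Suc)
      have "ball a (1 / real (Suc n)) \<subseteq> ball x e1"
      proof
        fix w assume "w \<in> ball a (1 / real (Suc n))"
        then have "dist a w < 1 / real (Suc n)" by simp
        then have "dist x w < e1" using dist_triangle[of x w a] ab(2) n by (simp add: dist_commute)
        then show "w \<in> ball x e1" by simp
      qed
      moreover have "ball b (1 / real (Suc n)) \<subseteq> ball y e2"
      proof
        fix w assume "w \<in> ball b (1 / real (Suc n))"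
        then have "dist b w < 1 / real (Suc n)" by simp
        then have "dist y w < e2" using dist_triangle[of y w b] ab(4) n by (simp add: dist_commute)
        then show "w \<in> ball y e2" by simp
      qed
      ultimately have "ball a (1 / real (Suc n)) \<times> ball b (1 / real (Suc n)) \<subseteq> U"
        using AB(5) e(3,4) by blast
      with ab have "(a, b, n) \<in> {(a, b, n). a \<in> D \<and> b \<in> D \<and> ball a (1 / real (Suc n)) \<times> ball b (1 / real (Suc n)) \<subseteq> U}"
        by simp
      moreover have "z \<in> ball a (1 / real (Suc n)) \<times> ball b (1 / real (Suc n))" using ab xy by simp
      ultimately show "z \<in> \<Union>\<B>" unfolding \<B>_def by (intro UnionI[OF image_eqI[where x="(a, b, n)", OF refl]]) (simp_all only: prod.case)
    qed
  qed
  moreover have "B \<in> sets (borel \<Otimes>\<^sub>M borel)" if "B \<in> \<B>" for B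
    using that by (auto simp: \<B>_def)
  ultimately show ?thesis using cB by (auto intro!: sets.countable_Union)
qed

lemma ball_finite: "emeasure \<mu> (ball x r) < \<infinity>"
proof -
  obtain c2 where "emeasure \<mu> (ball x (max r 0)) \<le> ennreal (c2 * max r 0 powr d\<^sub>H)"
    using ahlfors max.cobounded2[of 0 r] by blast
  then have "emeasure \<mu> (ball x (max r 0)) < \<infinity>"
    by (rule order_le_less_trans) simp
  moreover have "emeasure \<mu> (ball x r) \<le> emeasure \<mu> (ball x (max r 0))"
    by (rule emeasure_mono) (auto simp: sets_mu)
  ultimately show ?thesis by (simp add: order_le_less_trans)
qed

lemma sigma_finite: "sigma_finite_measure \<mu>"
proof -
  fix x0 :: 'a
  have "(\<Union>n. ball x0 (real n)) = UNIV"
    using reals_Archimedean2 by (auto simp: set_eq_iff)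
  moreover have "space \<mu> = UNIV" using sets_eq_imp_space_eq[OF sets_mu] by simp
  ultimately show ?thesis
    using ball_finite by unfold_locales
      (auto intro!: exI[of _ "range (\<lambda>n. ball x0 (real n))"] simp: sets_mu less_top[symmetric])
qed

lemma open_pair_pos:
  fixes W :: "('a \<times> 'a) set"
  assumes "open W" "W \<noteq> {}"
  shows "emeasure (\<mu> \<Otimes>\<^sub>M \<mu>) W > 0"
proof -
  interpret sigma_finite_measure \<mu> by (rule sigma_finite)
  obtain x y where xy: "(x, y) \<in> W" using assms(2) by auto
  from assms(1) xy obtain A B where AB: "open A" "open B" "x \<in> A" "y \<in> B" "A \<times> B \<subseteq> W"
    by (elim open_prod_elim) auto
  have "0 < emeasure \<mu> A * emeasure \<mu> B"
    using full_support[of A] full_support[of B] AB by (auto simp: ennreal_zero_less_mult_iff)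
  also have "\<dots> = emeasure (\<mu> \<Otimes>\<^sub>M \<mu>) (A \<times> B)"
    using AB by (intro emeasure_pair_measure_Times[symmetric]) (auto simp: sets_mu)
  also have "\<dots> \<le> emeasure (\<mu> \<Otimes>\<^sub>M \<mu>) W"
    using open_in_pair_borel[OF assms(1)] AB(5) sets_pair_measure_cong[OF sets_mu sets_mu]
    by (intro emeasure_mono) auto
  finally show ?thesis .
qed

text \<open>The complement is open and null, and nonempty open sets of pairs have positive measure.
  This is how almost sure relations between continuous functions become pointwise.\<close>

lemma AE_pair_closed:
  fixes C :: "('a \<times> 'a) set"
  assumes "closed C" "AE z in \<mu> \<Otimes>\<^sub>M \<mu>. z \<in> C"
  shows "z \<in> C"
proof (rule ccontr)
  assume "z \<notin> C"
  then have "emeasure (\<mu> \<Otimes>\<^sub>M \<mu>) (- C) > 0" using assms(1) by (intro open_pair_pos) auto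
  moreover have "- C \<in> sets (\<mu> \<Otimes>\<^sub>M \<mu>)"
    using open_in_pair_borel[of "- C"] assms(1) sets_pair_measure_cong[OF sets_mu sets_mu] by auto
  then have "emeasure (\<mu> \<Otimes>\<^sub>M \<mu>) (- C) = 0"
    using assms(2) by (subst (asm) AE_iff_measurable[where N="- C"])
      (auto simp: space_pair_measure sets_eq_imp_space_eq[OF sets_mu])
  ultimately show False by simp
qed

text \<open>For fixed t both bounding functions and the kernel are continuous, so the set of pairs
  satisfying the two inequalities is closed and of full measure.\<close>

lemma kernel_bounds:
  "\<exists>c3>0. \<exists>c4>0. \<exists>c5>0. \<exists>c6>0.
    (\<forall>t>0. \<forall>x y. c5 * t powr (- d\<^sub>H / d\<^sub>W) * exp (- c6 * (dist x y powr d\<^sub>W / t) powr (1 / (d\<^sub>W - 1))) \<le> p t x y) \<and>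
    (\<forall>t>0. \<forall>x y. p t x y \<le> c3 * t powr (- d\<^sub>H / d\<^sub>W) * exp (- c4 * (dist x y powr d\<^sub>W / t) powr (1 / (d\<^sub>W - 1))))"
proof -
  obtain c3 c4 c5 c6 where c: "0 < c3" "0 < c4" "0 < c5" "0 < c6"
    and ae: "AE (x, y) in \<mu> \<Otimes>\<^sub>M \<mu>. \<forall>t>0.
          c5 * t powr (- d\<^sub>H / d\<^sub>W) * exp (- c6 * (dist x y powr d\<^sub>W / t) powr (1 / (d\<^sub>W - 1))) \<le> p t x y \<and>
          p t x y \<le> c3 * t powr (- d\<^sub>H / d\<^sub>W) * exp (- c4 * (dist x y powr d\<^sub>W / t) powr (1 / (d\<^sub>W - 1)))"
    using heat_kernel_bounds by blast
  have b: "c5 * t powr (- d\<^sub>H / d\<^sub>W) * exp (- c6 * (dist x y powr d\<^sub>W / t) powr (1 / (d\<^sub>W - 1))) \<le> p t x y \<and>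
     p t x y \<le> c3 * t powr (- d\<^sub>H / d\<^sub>W) * exp (- c4 * (dist x y powr d\<^sub>W / t) powr (1 / (d\<^sub>W - 1)))"
    if t: "0 < t" for t x y
  proof -
    have dc: "continuous_on UNIV (\<lambda>z::'a \<times> 'a. c * t powr (- d\<^sub>H / d\<^sub>W) *
        exp (- c' * (dist (fst z) (snd z) powr d\<^sub>W / t) powr (1 / (d\<^sub>W - 1))))" for c c'
      using t dW_gt_2 by (intro continuous_intros continuous_on_powr') auto
    have pc: "continuous_on UNIV (\<lambda>z. p t (fst z) (snd z))"
      using heat_kernel_continuous[OF t] by (simp add: case_prod_beta')
    define C where "C = {z. c5 * t powr (- d\<^sub>H / d\<^sub>W) * exp (- c6 * (dist (fst z) (snd z) powr d\<^sub>W / t) powr (1 / (d\<^sub>W - 1))) \<le> p t (fst z) (snd z)}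
       \<inter> {z. p t (fst z) (snd z) \<le> c3 * t powr (- d\<^sub>H / d\<^sub>W) * exp (- c4 * (dist (fst z) (snd z) powr d\<^sub>W / t) powr (1 / (d\<^sub>W - 1)))}"
    have "closed C" unfolding C_def by (intro closed_Int closed_Collect_le dc pc)
    moreover have "AE z in \<mu> \<Otimes>\<^sub>M \<mu>. z \<in> C"
      using ae by eventually_elim (use t in \<open>auto simp: C_def\<close>)
    ultimately have "(x, y) \<in> C" by (rule AE_pair_closed)
    then show ?thesis by (simp add: C_def)
  qed
  show ?thesis
    by (intro exI[of _ c3] exI[of _ c4] exI[of _ c5] exI[of _ c6] conjI allI impI c b[THEN conjunct1] b[THEN conjunct2])
qed

text \<open>If p(x0,y0) > p(y0,x0), continuity separates the two values by constants m1 > m2 on a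
  product of balls X and Y. Then the pairing of P 1_Y with 1_X is at least m1 |X||Y|, while that of
  1_Y with P 1_X is at most m2 |X||Y|, which contradicts self-adjointness.\<close>

lemma kernel_symmetric:
  assumes t: "0 < t"
  shows "p t x y = p t y x"
proof -
  interpret sigma_finite_measure \<mu> by (rule sigma_finite)
  have meas: "p t x \<in> borel_measurable \<mu>" for x
  proof -
    have "continuous_on UNIV (\<lambda>y. (\<lambda>(x, y). p t x y) (x, y))"
      by (rule continuous_on_compose2[OF heat_kernel_continuous[OF t]]) (auto intro!: continuous_intros)
    then have "p t x \<in> borel_measurable borel" by (intro borel_measurable_continuous_onI) simp
    then show ?thesis by (simp add: measurable_cong_sets[OF sets_mu refl])
  qed
  have "\<not> p t y0 x0 < p t x0 y0" for x0 y0
  proof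
    assume less: "p t y0 x0 < p t x0 y0"
    \<comment> \<open>A third of the gap, so that lowering one value and raising the other by e
      still leaves a gap e between the thresholds.\<close>
    define e where "e = (p t x0 y0 - p t y0 x0) / 3"
    have e: "0 < e" using less by (simp add: e_def)
    define m1 m2 where "m1 = p t x0 y0 - e" and "m2 = p t y0 x0 + e"
    have m: "m2 < m1" using less by (simp add: m1_def m2_def e_def field_simps)
    have c1: "continuous_on UNIV (\<lambda>z. p t (fst z) (snd z))"
      using heat_kernel_continuous[OF t] by (simp add: case_prod_beta')
    have c2: "continuous_on UNIV (\<lambda>z. p t (snd z) (fst z))"
      using continuous_on_compose2[OF c1, of UNIV "\<lambda>z. (snd z, fst z)"] by (simp add: continuous_intros)
    have "open {z. m1 < p t (fst z) (snd z)}" "open {z. p t (snd z) (fst z) < m2}"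
      by (intro open_Collect_less c1 c2 continuous_intros)+
    then have "open ({z. m1 < p t (fst z) (snd z)} \<inter> {z. p t (snd z) (fst z) < m2})" by (rule open_Int)
    moreover have "(x0, y0) \<in> {z. m1 < p t (fst z) (snd z)} \<inter> {z. p t (snd z) (fst z) < m2}"
      using e by (simp add: m1_def m2_def)
    ultimately obtain A B where AB: "open A" "open B" "x0 \<in> A" "y0 \<in> B"
      and sub: "A \<times> B \<subseteq> {z. m1 < p t (fst z) (snd z)} \<inter> {z. p t (snd z) (fst z) < m2}"
      by (elim open_prod_elim) auto
    then obtain r1 r2 where r: "0 < r1" "0 < r2" "ball x0 r1 \<subseteq> A" "ball y0 r2 \<subseteq> B"
      unfolding open_contains_ball by blast
    define X Y where "X = ball x0 r1" and "Y = ball y0 r2"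
    have p1: "m1 \<le> p t x y" "p t y x \<le> m2" if "x \<in> X" "y \<in> Y" for x y
    proof -
      have "(x, y) \<in> A \<times> B" using that r(3,4) by (auto simp: X_def Y_def)
      with sub have "(x, y) \<in> {z. m1 < p t (fst z) (snd z)} \<inter> {z. p t (snd z) (fst z) < m2}" by blast
      then show "m1 \<le> p t x y" "p t y x \<le> m2" by auto
    qed
    have sX[measurable]: "X \<in> sets \<mu>" and sY[measurable]: "Y \<in> sets \<mu>" by (auto simp: X_def Y_def sets_mu)
    have fin: "emeasure \<mu> X < \<infinity>" "emeasure \<mu> Y < \<infinity>" by (simp_all only: X_def Y_def ball_finite)
    have pos: "0 < measure \<mu> X" "0 < measure \<mu> Y"
      using full_support[of X] full_support[of Y] r fin
      by (auto simp: X_def Y_def measure_def enn2real_positive_iff)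
    have iL2: "indicator S \<in> L2 \<mu>" if "S \<in> sets \<mu>" "emeasure \<mu> S < \<infinity>" for S
    proof -
      have "(\<lambda>x. (indicator S x)\<^sup>2) = (indicator S :: 'a \<Rightarrow> real)" by (auto simp: indicator_def)
      then show ?thesis using that by (simp add: L2_def)
    qed
    have LX: "indicator X \<in> L2 \<mu>" and LY: "indicator Y \<in> L2 \<mu>" using iL2 fin by auto
    have HL: "heat_op \<mu> p t u \<in> L2 \<mu>" if "u \<in> L2 \<mu>" for u
      using heat_kernel t that unfolding heat_semigroup_def by blast
    obtain c3 c4 where c34: "0 < c3" "0 < c4" "\<And>t x y. 0 < t \<Longrightarrow>
        p t x y \<le> c3 * t powr (- d\<^sub>H / d\<^sub>W) * exp (- c4 * (dist x y powr d\<^sub>W / t) powr (1 / (d\<^sub>W - 1)))"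
      "\<And>t x y. 0 < t \<Longrightarrow> 0 \<le> p t x y"
    proof -
      obtain c3 c4 c5 c6 where c: "0 < c3" "0 < c4" "0 < c5" "0 < c6"
    and b: "\<forall>t>0. \<forall>x y. c5 * t powr (- d\<^sub>H / d\<^sub>W) * exp (- c6 * (dist x y powr d\<^sub>W / t) powr (1 / (d\<^sub>W - 1))) \<le> p t x y"
      "\<forall>t>0. \<forall>x y. p t x y \<le> c3 * t powr (- d\<^sub>H / d\<^sub>W) * exp (- c4 * (dist x y powr d\<^sub>W / t) powr (1 / (d\<^sub>W - 1)))"
    using kernel_bounds by (elim exE conjE) (rule that; assumption)
      show thesis
      proof (rule that[OF c(1,2) b(2)[rule_format]])
        fix t x y assume "0 < (t::real)"
        from b(1)[rule_format, OF this, of x y] c(3) show "0 \<le> p t x y"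
          by (meson exp_ge_zero less_imp_le mult_nonneg_nonneg order_trans powr_ge_zero)
      qed
    qed
    have int: "integrable \<mu> (\<lambda>y. p t x y * indicator S y)" if "S \<in> sets \<mu>" "emeasure \<mu> S < \<infinity>" for x S
    proof (rule Bochner_Integration.integrable_bound)
      show "integrable \<mu> (\<lambda>y. c3 * t powr (- d\<^sub>H / d\<^sub>W) * indicator S y)" using that by simp
      show "(\<lambda>y. p t x y * indicator S y) \<in> borel_measurable \<mu>" using meas that by simp
      show "AE y in \<mu>. norm (p t x y * indicator S y) \<le> norm (c3 * t powr (- d\<^sub>H / d\<^sub>W) * indicator S y)"
      proof (rule AE_I2)
        fix y
        have "p t x y \<le> c3 * t powr (- d\<^sub>H / d\<^sub>W) * 1"
          by (rule order_trans[OF c34(3)[OF t]], rule mult_left_mono) (use c34 in auto)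
        then show "norm (p t x y * indicator S y) \<le> norm (c3 * t powr (- d\<^sub>H / d\<^sub>W) * indicator S y)"
          using c34(1) c34(4)[OF t, of x y] by (auto simp: indicator_def)
      qed
    qed
    have ii: "integrable \<mu> (\<lambda>y. c * indicator S y)" if "S \<in> sets \<mu>" "emeasure \<mu> S < \<infinity>" for c :: real and S
      using that by simp
    have in1: "m1 * measure \<mu> Y \<le> heat_op \<mu> p t (indicator Y) x" if "x \<in> X" for x
    proof -
      have "(\<integral>y. m1 * indicator Y y \<partial>\<mu>) \<le> (\<integral>y. p t x y * indicator Y y \<partial>\<mu>)"
        by (rule integral_mono[OF ii[OF sY fin(2)] int[OF sY fin(2)]])
          (use p1(1)[OF that] in \<open>auto split: split_indicator\<close>)
      then show ?thesis using fin by (simp add: heat_op_def)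
    qed
    have in2: "heat_op \<mu> p t (indicator X) y \<le> m2 * measure \<mu> X" if "y \<in> Y" for y
    proof -
      have "(\<integral>x. p t y x * indicator X x \<partial>\<mu>) \<le> (\<integral>x. m2 * indicator X x \<partial>\<mu>)"
        by (rule integral_mono[OF int[OF sX fin(1)] ii[OF sX fin(1)]])
          (use p1(2)[OF _ that] in \<open>auto split: split_indicator\<close>)
      then show ?thesis using fin by (simp add: heat_op_def)
    qed
    have "m1 * measure \<mu> Y * measure \<mu> X = (\<integral>x. m1 * measure \<mu> Y * indicator X x \<partial>\<mu>)" using fin by simp
    also have "\<dots> \<le> L2_inner \<mu> (heat_op \<mu> p t (indicator Y)) (indicator X)"
      unfolding L2_inner_def
      by (rule integral_mono[OF ii[OF sX fin(1)] L2_integrable_mult[OF HL[OF LY] LX]])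
        (use in1 in \<open>auto split: split_indicator\<close>)
    also have "\<dots> = L2_inner \<mu> (indicator Y) (heat_op \<mu> p t (indicator X))"
      by (rule heat_semigroup_symmetric[OF dirichlet heat_kernel t LY LX])
    also have "\<dots> \<le> (\<integral>y. m2 * measure \<mu> X * indicator Y y \<partial>\<mu>)"
      unfolding L2_inner_def
      by (rule integral_mono[OF L2_integrable_mult[OF LY HL[OF LX]] ii[OF sY fin(2)]])
        (use in2 in \<open>auto split: split_indicator\<close>)
    also have "\<dots> = m2 * measure \<mu> Y * measure \<mu> X" using fin by simp
    finally show False using m pos by simp
  qed
  then show ?thesis by (meson linorder_less_linear)
qed

lemma heat_kernel_wBE_exists:
  assumes "wBE \<mu> p d\<^sub>W \<kappa>"
  shows "\<exists>c1 c2 c3 c4 c5 c6 cB. heat_kernel_wBE \<mu> p d\<^sub>H d\<^sub>W \<kappa> c1 c2 c3 c4 c5 c6 cB"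
proof -
  obtain c1 c2 where c12: "0 < c1" "0 < c2"
    "\<And>x r. 0 \<le> r \<Longrightarrow> ennreal (c1 * r powr d\<^sub>H) \<le> emeasure \<mu> (ball x r)"
    "\<And>x r. 0 \<le> r \<Longrightarrow> emeasure \<mu> (ball x r) \<le> ennreal (c2 * r powr d\<^sub>H)"
    using ahlfors by blast
  obtain c3 c4 c5 c6 where c: "0 < c3" "0 < c4" "0 < c5" "0 < c6"
    and b: "\<forall>t>0. \<forall>x y. c5 * t powr (- d\<^sub>H / d\<^sub>W) * exp (- c6 * (dist x y powr d\<^sub>W / t) powr (1 / (d\<^sub>W - 1))) \<le> p t x y"
      "\<forall>t>0. \<forall>x y. p t x y \<le> c3 * t powr (- d\<^sub>H / d\<^sub>W) * exp (- c4 * (dist x y powr d\<^sub>W / t) powr (1 / (d\<^sub>W - 1)))"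
    using kernel_bounds by (elim exE conjE) (rule that; assumption)
  obtain cB where cB: "0 < cB" "\<And>t g x y. 0 < t \<Longrightarrow> g \<in> Linf \<mu> \<Longrightarrow>
      \<bar>heat_op \<mu> p t g x - heat_op \<mu> p t g y\<bar>
          \<le> cB * (dist x y powr \<kappa> / t powr (\<kappa> / d\<^sub>W)) * Linf_norm \<mu> g"
    using assms unfolding wBE_def by blast
  have k: "0 < \<kappa>" "\<kappa> < d\<^sub>W" using assms by (auto simp: wBE_def)
  have "heat_kernel_wBE \<mu> p d\<^sub>H d\<^sub>W \<kappa> c1 c2 c3 c4 c5 c6 cB"
  proof
    fix t u assume "0 < (t::real)" "u \<in> L2 \<mu>"
    then show "heat_op \<mu> p t u \<in> L2 \<mu>" using heat_kernel unfolding heat_semigroup_def by blast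
  next
    fix s t u assume "0 < (s::real)" "0 < (t::real)" "u \<in> L2 \<mu>"
    then show "AE x in \<mu>. heat_op \<mu> p (s + t) u x = heat_op \<mu> p s (heat_op \<mu> p t u) x"
      using heat_kernel unfolding heat_semigroup_def by blast
  next
    show "\<And>U :: ('a \<times> 'a) set. open U \<Longrightarrow> U \<in> sets (borel \<Otimes>\<^sub>M borel)" by (rule open_in_pair_borel)
  next
    fix t x y assume t: "0 < (t::real)"
    show "c5 * t powr (- d\<^sub>H / d\<^sub>W) * exp (- c6 * (dist x y powr d\<^sub>W / t) powr (1 / (d\<^sub>W - 1))) \<le> p t x y"
      by (rule b(1)[rule_format, OF t])
    show "p t x y \<le> c3 * t powr (- d\<^sub>H / d\<^sub>W) * exp (- c4 * (dist x y powr d\<^sub>W / t) powr (1 / (d\<^sub>W - 1)))"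
      by (rule b(2)[rule_format, OF t])
    show "p t x y = p t y x" by (rule kernel_symmetric[OF t])
  qed (rule c12 c cB k sets_mu full_support compact_balls dH_pos dW_gt_2 heat_kernel_continuous; assumption)+
  then show ?thesis by blast
qed

end

section \<open>Kernel estimates and localized Hoelder continuity\<close>


text \<open>Since q is at least 1, D^q is at least D - 1, which reduces the claim to a pure
  exponential. The second factor of the constant is the maximum of exp(-c D) (1+D)^m, attained at 1
  + D = m/c; it is obtained from ln z \<le> z - 1 at z = (c/m)(1+D). The factor exp c pays for the
  -1.\<close>

lemma exp_powr_bound:
  fixes c m q :: real
  assumes c: "0 < c" and m: "0 < m" and q: "1 \<le> q"
  shows "\<exists>C>0. \<forall>D\<ge>0. exp (- c * D powr q) * (1 + D) powr m \<le> C"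
proof (intro exI[of _ "exp c * exp (c - m - m * ln (c / m))"] conjI allI impI)
  fix D :: real assume D: "0 \<le> D"
  have "D - 1 \<le> D powr q"
  proof (cases "1 \<le> D")
    case True
    then show ?thesis using powr_mono[OF q, of D] by simp
  next
    case False
    then show ?thesis by (smt (verit) powr_ge_zero)
  qed
  then have "c * (D - 1) \<le> c * D powr q" using c by (intro mult_left_mono) auto
  then have 1: "exp (- c * D powr q) \<le> exp (c - c * D)" by (simp add: algebra_simps)
  have "ln (c / m * (1 + D)) \<le> c / m * (1 + D) - 1" using c m D by (intro ln_le_minus_one) auto
  then have "ln (1 + D) \<le> c / m * (1 + D) - 1 - ln (c / m)" using c m D by (simp add: ln_mult ln_div)
  then have "m * ln (1 + D) \<le> m * (c / m * (1 + D) - 1 - ln (c / m))" using m by (intro mult_left_mono) auto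
  also have "\<dots> = c * (1 + D) - m - m * ln (c / m)" using m by (simp add: field_simps)
  finally have "(1 + D) powr m \<le> exp (c * (1 + D) - m - m * ln (c / m))" using D by (simp add: powr_def)
  with 1 have "exp (- c * D powr q) * (1 + D) powr m \<le> exp (c - c * D) * exp (c * (1 + D) - m - m * ln (c / m))"
    by (intro mult_mono) auto
  also have "\<dots> = exp c * exp (c - m - m * ln (c / m))"
    by (simp add: exp_add[symmetric] algebra_simps)
  finally show "exp (- c * D powr q) * (1 + D) powr m \<le> exp c * exp (c - m - m * ln (c / m))" .
qed simp

lemma uniformly_continuous_Hoelder:
  fixes f :: "'a::metric_space \<Rightarrow> real"
  assumes k: "0 < k" and H: "\<And>x y. \<bar>f x - f y\<bar> \<le> L * dist x y powr k"
  shows "uniformly_continuous_on UNIV f"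
  unfolding uniformly_continuous_on_def
proof (intro allI impI)
  fix e :: real assume e: "0 < e"
  define d where "d = (e / (\<bar>L\<bar> + 1)) powr (1 / k)"
  have d: "0 < d" using e by (simp add: d_def)
  have "dist (f x') (f x) < e" if "dist x' x < d" for x x'
  proof -
    have "dist x' x powr k < d powr k" using that k by (intro powr_less_mono2) auto
    also have "d powr k = e / (\<bar>L\<bar> + 1)" using k e by (simp add: d_def powr_powr)
    finally have lt: "dist x' x powr k < e / (\<bar>L\<bar> + 1)" .
    have "\<bar>f x' - f x\<bar> \<le> (\<bar>L\<bar> + 1) * dist x' x powr k"
      by (rule order_trans[OF H]) (intro mult_right_mono, auto)
    also have "\<dots> < e" using lt by (simp add: field_simps)
    finally show ?thesis by (simp add: dist_real_def)
  qed
  with d show "\<exists>d>0. \<forall>x\<in>UNIV. \<forall>x'\<in>UNIV. dist x' x < d \<longrightarrow> dist (f x') (f x) < e" by blast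
qed

lemma ennreal_le_suminf: "f k \<le> (\<Sum>i. f i)" for f :: "nat \<Rightarrow> ennreal"
  using sum_le_suminf[of f "{k}"] by simp

context heat_kernel_wBE
begin

section \<open>Space-time scaling and comparison of kernels\<close>

abbreviation P :: "real \<Rightarrow> ('a \<Rightarrow> real) \<Rightarrow> 'a \<Rightarrow> real" where "P \<equiv> heat_op \<mu> p"

text \<open>The distance reached by the diffusion in time t. In units of \<open>sc t\<close> the
  kernel bounds become self-similar, so estimates below are phrased through
  \<open>dist x y / sc t\<close>.\<close>

definition sc :: "real \<Rightarrow> real" where "sc t = t powr (1 / dW)"

declare sets_mu [measurable_cong]

lemma dW_pos: "0 < dW" and dW_minus_1: "0 < dW - 1" using dW_gt_2 by auto

lemma space_mu: "space \<mu> = UNIV"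
  using sets_eq_imp_space_eq[OF sets_mu] by simp

lemma sc_pos: "0 < t \<Longrightarrow> 0 < sc t"
  by (simp add: sc_def)

lemma sc_powr: "0 < t \<Longrightarrow> sc t powr a = t powr (a / dW)"
  by (simp add: sc_def powr_powr)

lemma sc_powr_dW: "0 < t \<Longrightarrow> sc t powr dW = t"
  using dW_pos by (simp add: sc_powr)

lemma sc_mult: "0 < s \<Longrightarrow> 0 < t \<Longrightarrow> sc (s * t) = sc s * sc t"
  by (simp add: sc_def powr_mult)

lemma sc_of_powr: "0 < r \<Longrightarrow> sc (r powr dW) = r"
  using dW_pos by (simp add: sc_def powr_powr)

lemma sc_mono: "0 < s \<Longrightarrow> s \<le> t \<Longrightarrow> sc s \<le> sc t"
  unfolding sc_def using dW_pos by (intro powr_mono2) auto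

lemma kernel_exponent:
  assumes "0 < t"
  shows "(dist x y powr dW / t) powr (1 / (dW - 1)) = (dist x y / sc t) powr (dW / (dW - 1))"
proof -
  have "dist x y powr dW / t = (dist x y / sc t) powr dW"
    using assms by (simp add: powr_divide sc_pos less_imp_le sc_powr_dW)
  then show ?thesis by (simp add: powr_powr)
qed

lemma p_upper': "0 < t \<Longrightarrow> p t x y \<le> c3 * sc t powr (- dH) * exp (- c4 * (dist x y / sc t) powr (dW / (dW - 1)))"
  using p_upper[of t x y] kernel_exponent[of t x y] by (simp add: sc_powr)

lemma p_lower': "0 < t \<Longrightarrow> c5 * sc t powr (- dH) * exp (- c6 * (dist x y / sc t) powr (dW / (dW - 1))) \<le> p t x y"
  using p_lower[of t x y] kernel_exponent[of t x y] by (simp add: sc_powr)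

lemma p_pos:
  assumes "0 < t" shows "0 < p t x y"
proof (rule less_le_trans[OF _ p_lower'[OF assms]])
  show "0 < c5 * sc t powr (- dH) * exp (- c6 * (dist x y / sc t) powr (dW / (dW - 1)))"
    using c_pos(5) sc_pos[OF assms] by simp
qed

lemma p_nonneg: "0 < t \<Longrightarrow> 0 \<le> p t x y"
  using p_pos less_imp_le by blast

lemma exponent_ge_1: "1 \<le> dW / (dW - 1)"
  using dW_minus_1 by (simp add: field_simps)

definition tB :: real where "tB = (2 * c6 / c4) powr (dW - 1)"

lemma tB_pos: "0 < tB" using c_pos by (simp add: tB_def)

text \<open>\<open>tB\<close> is chosen so that the exponential rate of the lower bound at time \<open>tB * t\<close> is half of
  that of the upper bound at time \<open>t\<close>; the remaining half absorbs every polynomial weight.\<close>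

lemma p_compare:
  assumes m: "0 < m"
  shows "\<exists>C>0. \<forall>t>0. \<forall>x y. p t x y * (1 + dist x y / sc t) powr m \<le> C * p (tB * t) x y"
proof -
  define q where "q = dW / (dW - 1)"
  have q: "1 \<le> q" using exponent_ge_1 by (simp add: q_def)
  have "0 < c4 / 2" using c_pos by simp
  from exp_powr_bound[OF this m q] obtain C where C: "0 < C"
    and bd: "\<And>D. 0 \<le> D \<Longrightarrow> exp (- (c4 / 2) * D powr q) * (1 + D) powr m \<le> C" by blast
  define K where "K = c3 * C * sc tB powr dH / c5"
  have K: "0 < K" using c_pos C sc_pos[OF tB_pos] by (simp add: K_def)
  have "p t x y * (1 + dist x y / sc t) powr m \<le> K * p (tB * t) x y" if t: "0 < t" for t x y
  proof -
    define D where "D = dist x y / sc t"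
    have D: "0 \<le> D" using sc_pos[OF t] by (simp add: D_def)
    have "sc tB powr q = 2 * c6 / c4"
      using c_pos dW_minus_1 dW_pos by (simp add: tB_def sc_def powr_powr q_def)
    then have rate: "c6 * (D / sc tB) powr q = c4 / 2 * D powr q"
      using D sc_pos[OF tB_pos] c_pos by (simp add: powr_divide)
    have "c5 * sc (tB * t) powr (- dH) * exp (- c6 * (dist x y / sc (tB * t)) powr q) \<le> p (tB * t) x y"
      unfolding q_def by (rule p_lower') (use t tB_pos in simp)
    moreover have "dist x y / sc (tB * t) = D / sc tB" using t tB_pos by (simp add: D_def sc_mult)
    moreover have "sc (tB * t) powr (- dH) = sc tB powr (- dH) * sc t powr (- dH)"
      using t tB_pos sc_pos by (simp add: sc_mult powr_mult less_imp_le)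
    ultimately have low: "c5 * (sc tB powr (- dH) * sc t powr (- dH)) * exp (- (c4 / 2) * D powr q) \<le> p (tB * t) x y"
      using rate by simp
    have "p t x y * (1 + D) powr m \<le> c3 * sc t powr (- dH) * exp (- c4 * D powr q) * (1 + D) powr m"
      using p_upper'[OF t, of x y] by (intro mult_right_mono) (auto simp: D_def q_def)
    also have "exp (- c4 * D powr q) = exp (- (c4 / 2) * D powr q) * exp (- (c4 / 2) * D powr q)"
      by (simp add: exp_add[symmetric])
    also have "c3 * sc t powr (- dH) * (exp (- (c4 / 2) * D powr q) * exp (- (c4 / 2) * D powr q)) * (1 + D) powr m
        = c3 * sc t powr (- dH) * exp (- (c4 / 2) * D powr q) * (exp (- (c4 / 2) * D powr q) * (1 + D) powr m)"
      by (simp only: mult.assoc)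
    also have "\<dots> \<le> c3 * sc t powr (- dH) * exp (- (c4 / 2) * D powr q) * C"
      using bd[OF D] c_pos by (intro mult_left_mono) auto
    also have "\<dots> = K * (c5 * (sc tB powr (- dH) * sc t powr (- dH)) * exp (- (c4 / 2) * D powr q))"
      using c_pos sc_pos[OF tB_pos] by (simp add: K_def powr_minus field_simps)
    also have "\<dots> \<le> K * p (tB * t) x y" using low K by (intro mult_left_mono) auto
    finally show ?thesis by (simp add: D_def)
  qed
  with K show ?thesis by blast
qed

text \<open>A single term of the series suffices: that of the smallest dyadic ball of radius 2^k
  \<open>sc t\<close> containing the pair. The decay (2^k)^(-a) is meant to cancel the growth of a
  quantity on balls, volume for a = \<open>dH\<close> and energy for a = \<open>lam + dH\<close>,
  and the spare factor (1/2)^k makes the series summable.\<close>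

lemma p_dyadic:
  assumes a: "0 \<le> a"
  shows "\<exists>C>0. \<forall>t>0. \<forall>x y. ennreal (p t x y) \<le>
    (\<Sum>k. ennreal (C * sc t powr (- dH) * ((1/2)^k / (2^k) powr a)) * indicator {..<2^k * sc t} (dist x y))"
proof -
  define q where "q = dW / (dW - 1)"
  have q: "1 \<le> q" using exponent_ge_1 by (simp add: q_def)
  have "0 < a + 1" using a by simp
  from exp_powr_bound[OF c_pos(4) this q] obtain C0 where C0: "0 < C0"
    and bd: "\<And>D. 0 \<le> D \<Longrightarrow> exp (- c4 * D powr q) * (1 + D) powr (a + 1) \<le> C0" by blast
  define C where "C = c3 * C0 * 2 powr (a + 1)"
  have C: "0 < C" using c_pos C0 by (simp add: C_def)
  have "ennreal (p t x y) \<le>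
    (\<Sum>k. ennreal (C * sc t powr (- dH) * ((1/2)^k / (2^k) powr a)) * indicator {..<2^k * sc t} (dist x y))"
    if t: "0 < t" for t x y
  proof -
    define D where "D = dist x y / sc t"
    have D: "0 \<le> D" using sc_pos[OF t] by (simp add: D_def)
    obtain k0 where "D < 2 ^ k0" using real_arch_pow[of 2 D] by auto
    \<comment> \<open>Minimality gives 2^k \<le> 2 (1 + D), so a power of 1 + D dominates the
      corresponding power of 2^k.\<close>
    define k where "k = (LEAST k. D < 2 ^ k)"
    have k: "D < 2 ^ k" unfolding k_def using \<open>D < 2 ^ k0\<close> by (rule LeastI)
    have kD: "(2::real) ^ k \<le> 2 * (1 + D)"
    proof (cases k)
      case 0
      then show ?thesis using D by simp
    next
      case (Suc j)
      then have "\<not> D < 2 ^ j" unfolding k_def using not_less_Least by (metis lessI k_def Suc)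
      then show ?thesis using Suc by simp
    qed
    have pw: "(2::real) ^ k * (2 ^ k) powr a = (2 ^ k) powr (a + 1)"
      by (simp add: powr_add mult.commute)
    have "(2 ^ k) powr (a + 1) \<le> (2 * (1 + D)) powr (a + 1)"
      using kD a by (intro powr_mono2) auto
    also have "\<dots> = 2 powr (a + 1) * (1 + D) powr (a + 1)" using D by (subst powr_mult) auto
    finally have 1: "2 ^ k * (2 ^ k) powr a \<le> 2 powr (a + 1) * (1 + D) powr (a + 1)" unfolding pw .
    have "exp (- c4 * D powr q) \<le> C0 * 2 powr (a + 1) / (2 ^ k * (2 ^ k) powr a)"
    proof -
      have "exp (- c4 * D powr q) * (2 ^ k * (2 ^ k) powr a) \<le> exp (- c4 * D powr q) * (2 powr (a + 1) * (1 + D) powr (a + 1))"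
        by (intro mult_left_mono 1) auto
      also have "\<dots> = 2 powr (a + 1) * (exp (- c4 * D powr q) * (1 + D) powr (a + 1))" by simp
      also have "\<dots> \<le> 2 powr (a + 1) * C0" by (intro mult_left_mono bd D) auto
      finally show ?thesis by (simp add: pos_le_divide_eq mult.commute)
    qed
    then have "c3 * sc t powr (- dH) * exp (- c4 * D powr q) \<le> c3 * sc t powr (- dH) * (C0 * 2 powr (a + 1) / (2 ^ k * (2 ^ k) powr a))"
      using c_pos by (intro mult_left_mono) auto
    also have "\<dots> = C * sc t powr (- dH) * ((1/2)^k / (2^k) powr a)"
      by (simp add: C_def power_one_over field_simps)
    finally have "p t x y \<le> C * sc t powr (- dH) * ((1/2)^k / (2^k) powr a)"
      using p_upper'[OF t, of x y] by (simp add: D_def q_def)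
    moreover have "dist x y < 2 ^ k * sc t" using k sc_pos[OF t] by (simp add: D_def field_simps)
    ultimately have "ennreal (p t x y) \<le> ennreal (C * sc t powr (- dH) * ((1/2)^k / (2^k) powr a)) * indicator {..<2^k * sc t} (dist x y)"
      by (simp add: ennreal_leI)
    also have "\<dots> \<le> (\<Sum>k. ennreal (C * sc t powr (- dH) * ((1/2)^k / (2^k) powr a)) * indicator {..<2^k * sc t} (dist x y))"
      by (rule ennreal_le_suminf)
    finally show ?thesis .
  qed
  with C show ?thesis by blast
qed

lemma suminf_half_ennreal: "(\<Sum>k. ennreal (c * (1/2)^k)) = ennreal (2 * c)" if "0 \<le> c"
proof -
  have "(\<lambda>k. c * (1/2)^k) sums (c * 2)"
    using sums_mult[OF geometric_sums[of "1/2::real"], of c] by simp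
  then have "(\<lambda>k. ennreal (c * (1/2)^k)) sums ennreal (c * 2)"
    using that by (subst sums_ennreal) auto
  then show ?thesis by (simp add: sums_iff mult.commute)
qed

section \<open>Measurability and integrability of the kernel\<close>

lemma borel_pair_measurable:
  fixes f :: "'a \<times> 'a \<Rightarrow> real"
  assumes "continuous_on UNIV f"
  shows "f \<in> borel_measurable (borel \<Otimes>\<^sub>M borel)"
proof (rule borel_measurableI)
  fix S :: "real set" assume "open S"
  then have "open (f -` S)" using assms by (simp add: continuous_on_open_vimage)
  then show "f -` S \<inter> space (borel \<Otimes>\<^sub>M borel) \<in> sets (borel \<Otimes>\<^sub>M borel)"
    by (simp add: open_prod space_pair_measure)
qed

lemma dist_measurable_pair [measurable]: "(\<lambda>z. dist (fst z) (snd z :: 'a)) \<in> borel_measurable (borel \<Otimes>\<^sub>M borel)"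
  by (intro borel_pair_measurable continuous_intros)

lemma dist_measurable [measurable (raw)]:
  assumes "f \<in> measurable M borel" "g \<in> measurable M (borel :: 'a measure)"
  shows "(\<lambda>z. dist (f z) (g z)) \<in> borel_measurable M"
  using measurable_compose[OF measurable_Pair[OF assms] dist_measurable_pair] by simp

lemma p_measurable_pair: "0 < t \<Longrightarrow> (\<lambda>z. p t (fst z) (snd z)) \<in> borel_measurable (borel \<Otimes>\<^sub>M borel)"
  using p_cont[of t] by (intro borel_pair_measurable) (simp add: case_prod_beta')

lemma p_measurable:
  assumes "0 < t" "f \<in> measurable M borel" "g \<in> measurable M borel"
  shows "(\<lambda>z. p t (f z) (g z)) \<in> borel_measurable M"
  using measurable_compose[OF measurable_Pair[OF assms(2,3)] p_measurable_pair[OF assms(1)]] by simp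

lemma ball_finite: "emeasure \<mu> (ball x r) < \<infinity>"
proof -
  have "emeasure \<mu> (ball x r) \<le> emeasure \<mu> (ball x (max r 0))"
    by (rule emeasure_mono) (auto simp: sets_mu)
  also have "\<dots> \<le> ennreal (c2 * max r 0 powr dH)" by (rule ball_upper) simp
  finally show ?thesis by (rule order_le_less_trans) simp
qed

sublocale sigma_finite_measure \<mu>
proof
  fix x0 :: 'a
  have "(\<Union>n. ball x0 (real n)) = UNIV"
    using reals_Archimedean2 by (auto simp: set_eq_iff)
  then show "\<exists>A. countable A \<and> A \<subseteq> sets \<mu> \<and> \<Union>A = space \<mu> \<and> (\<forall>a\<in>A. emeasure \<mu> a \<noteq> \<infinity>)"
    using ball_finite
    by (intro exI[of _ "range (\<lambda>n. ball x0 (real n))"]) (auto simp: sets_mu space_mu less_top[symmetric])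
qed

text \<open>With a = \<open>dH\<close> the dyadic weight cancels the volume growth of the balls, and
  a geometric series independent of t and x is left.\<close>

lemma p_mass_upper: "\<exists>b>0. \<forall>t>0. \<forall>x. (\<integral>\<^sup>+y. ennreal (p t x y) \<partial>\<mu>) \<le> ennreal b"
proof -
  obtain C where C: "0 < C" and dy: "\<And>t x y. 0 < t \<Longrightarrow> ennreal (p t x y) \<le>
    (\<Sum>k. ennreal (C * sc t powr (- dH) * ((1/2)^k / (2^k) powr dH)) * indicator {..<2^k * sc t} (dist x y))"
    using p_dyadic[of dH] dH_pos by (auto simp: less_imp_le)
  have "(\<integral>\<^sup>+y. ennreal (p t x y) \<partial>\<mu>) \<le> ennreal (2 * (C * c2))" if t: "0 < t" for t x
  proof -
    have eq: "indicator {..<2^k * sc t} (dist x y) = (indicator (ball x (2^k * sc t)) y :: ennreal)" for y k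
      by (auto simp: indicator_def)
    have "(\<integral>\<^sup>+y. ennreal (p t x y) \<partial>\<mu>) \<le> (\<integral>\<^sup>+y. (\<Sum>k. ennreal (C * sc t powr (- dH) * ((1/2)^k / (2^k) powr dH)) * indicator (ball x (2^k * sc t)) y) \<partial>\<mu>)"
      unfolding eq[symmetric] by (rule nn_integral_mono) (rule dy[OF t])
    also have "\<dots> = (\<Sum>k. \<integral>\<^sup>+y. ennreal (C * sc t powr (- dH) * ((1/2)^k / (2^k) powr dH)) * indicator (ball x (2^k * sc t)) y \<partial>\<mu>)"
      by (intro nn_integral_suminf borel_measurable_times_ennreal borel_measurable_const borel_measurable_indicator)
        (simp add: sets_mu)
    also have "\<dots> \<le> (\<Sum>k. ennreal (C * c2 * (1/2)^k))"
    proof (intro suminf_le summableI)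
      fix k
      have "(\<integral>\<^sup>+y. ennreal (C * sc t powr (- dH) * ((1/2)^k / (2^k) powr dH)) * indicator (ball x (2^k * sc t)) y \<partial>\<mu>)
         = ennreal (C * sc t powr (- dH) * ((1/2)^k / (2^k) powr dH)) * emeasure \<mu> (ball x (2^k * sc t))"
        by (subst nn_integral_cmult_indicator) (auto simp: sets_mu)
      also have "\<dots> \<le> ennreal (C * sc t powr (- dH) * ((1/2)^k / (2^k) powr dH)) * ennreal (c2 * (2^k * sc t) powr dH)"
        using sc_pos[OF t] by (intro mult_left_mono ball_upper) auto
      also have "\<dots> = ennreal (C * sc t powr (- dH) * ((1/2)^k / (2^k) powr dH) * (c2 * (2^k * sc t) powr dH))"
        using C c_pos by (subst ennreal_mult) auto
      also have "C * sc t powr (- dH) * ((1/2)^k / (2^k) powr dH) * (c2 * (2^k * sc t) powr dH) = C * c2 * (1/2)^k"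
        using sc_pos[OF t] by (simp add: powr_mult powr_minus field_simps)
      finally show "(\<integral>\<^sup>+y. ennreal (C * sc t powr (- dH) * ((1/2)^k / (2^k) powr dH)) * indicator (ball x (2^k * sc t)) y \<partial>\<mu>)
        \<le> ennreal (C * c2 * (1/2)^k)" .
    qed
    also have "\<dots> = ennreal (2 * (C * c2))" using C c_pos by (intro suminf_half_ennreal) auto
    finally show ?thesis .
  qed
  then show ?thesis using C c_pos by (intro exI[of _ "2 * (C * c2)"]) auto
qed

lemma p_integrable: "0 < t \<Longrightarrow> integrable \<mu> (p t x)"
proof -
  assume t: "0 < t"
  obtain b where "(\<integral>\<^sup>+y. ennreal (p t x y) \<partial>\<mu>) \<le> ennreal b" using p_mass_upper t by blast
  then have "(\<integral>\<^sup>+y. ennreal (p t x y) \<partial>\<mu>) < \<infinity>" by (rule order_le_less_trans) simp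
  then show ?thesis
    using t by (intro integrableI_nonneg) (auto intro!: p_measurable p_nonneg)
qed

lemma p_integrable_mult:
  assumes t: "0 < t" and u: "u \<in> borel_measurable borel" "\<And>y. \<bar>u y\<bar> \<le> M"
  shows "integrable \<mu> (\<lambda>y. p t x y * u y)"
proof (rule Bochner_Integration.integrable_bound)
  show "integrable \<mu> (\<lambda>y. M * p t x y)" by (intro integrable_mult_right p_integrable t)
  show "(\<lambda>y. p t x y * u y) \<in> borel_measurable \<mu>" using t u by (auto intro!: borel_measurable_times p_measurable)
  show "AE y in \<mu>. norm (p t x y * u y) \<le> norm (M * p t x y)"
  proof (rule AE_I2)
    fix y
    have "\<bar>u y\<bar> \<le> \<bar>M\<bar>" using u(2)[of y] by simp
    then show "norm (p t x y * u y) \<le> norm (M * p t x y)"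
      using mult_right_mono[of "\<bar>u y\<bar>" "\<bar>M\<bar>" "\<bar>p t x y\<bar>"] by (simp add: abs_mult mult.commute)
  qed
qed

section \<open>The semigroup on bounded functions and its conservativeness\<close>

lemma heat_nn_integral: "0 < t \<Longrightarrow> (\<integral>\<^sup>+y. ennreal (p t x y) \<partial>\<mu>) = ennreal (P t (\<lambda>_. 1) x)"
  by (simp add: heat_op_def nn_integral_eq_integral p_integrable p_nonneg)

lemma heat_abs_le:
  assumes t: "0 < t" and u: "u \<in> borel_measurable borel" "\<And>y. \<bar>u y\<bar> \<le> M"
  shows "\<bar>P t u x\<bar> \<le> M * P t (\<lambda>_. 1) x"
proof -
  have "\<bar>P t u x\<bar> \<le> (\<integral>y. \<bar>p t x y * u y\<bar> \<partial>\<mu>)" unfolding heat_op_def by (rule integral_abs_bound)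
  also have "\<dots> \<le> (\<integral>y. M * p t x y \<partial>\<mu>)"
  proof (intro integral_mono integrable_abs integrable_mult_right p_integrable_mult[OF t u] p_integrable[OF t])
    fix y
    show "\<bar>p t x y * u y\<bar> \<le> M * p t x y"
      using mult_right_mono[OF u(2)[of y] p_nonneg[OF t, of x y]] p_nonneg[OF t, of x y]
      by (simp add: abs_mult mult.commute)
  qed
  finally show ?thesis by (simp add: heat_op_def)
qed

lemma heat_add:
  assumes t: "0 < t" and u: "u \<in> borel_measurable borel" "\<And>y. \<bar>u y\<bar> \<le> M"
    and v: "v \<in> borel_measurable borel" "\<And>y. \<bar>v y\<bar> \<le> N"
  shows "P t (\<lambda>y. u y + v y) x = P t u x + P t v x"
  unfolding heat_op_def using p_integrable_mult[OF t u] p_integrable_mult[OF t v]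
  by (simp add: distrib_left)

lemma heat_cmult: "P t (\<lambda>y. c * u y) x = c * P t u x"
  by (simp add: heat_op_def mult.left_commute)

text \<open>The lower bound comes from the ball of radius \<open>sc t\<close> alone, where the
  exponential is at least exp(-\<open>c6\<close>) and the volume compensates the prefactor.
  Uniformity in t is the point: it confines the mass of P_t 1 as t grows.\<close>

lemma heat_mass_bounds: "\<exists>a>0. \<exists>b>0. \<forall>t>0. \<forall>x. a \<le> P t (\<lambda>_. 1) x \<and> P t (\<lambda>_. 1) x \<le> b"
proof -
  obtain b where b: "0 < b" "\<And>t x. 0 < t \<Longrightarrow> (\<integral>\<^sup>+y. ennreal (p t x y) \<partial>\<mu>) \<le> ennreal b"
    using p_mass_upper by blast
  define a where "a = c5 * exp (- c6) * c1"
  have a: "0 < a" using c_pos by (simp add: a_def)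
  have "P t (\<lambda>_. 1) x \<le> b" if t: "0 < t" for t x
    using b(2)[OF t, of x] b(1) unfolding heat_nn_integral[OF t] by (simp add: ennreal_le_iff)
  moreover have "a \<le> P t (\<lambda>_. 1) x" if t: "0 < t" for t x
  proof -
    have "ennreal a = ennreal (c5 * sc t powr (- dH) * exp (- c6)) * ennreal (c1 * sc t powr dH)"
      using c_pos sc_pos[OF t] by (subst ennreal_mult[symmetric]) (auto simp: a_def powr_minus field_simps)
    also have "\<dots> \<le> ennreal (c5 * sc t powr (- dH) * exp (- c6)) * emeasure \<mu> (ball x (sc t))"
      using sc_pos[OF t] by (intro mult_left_mono ball_lower) auto
    also have "\<dots> = (\<integral>\<^sup>+y. ennreal (c5 * sc t powr (- dH) * exp (- c6)) * indicator (ball x (sc t)) y \<partial>\<mu>)"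
      by (subst nn_integral_cmult_indicator) (auto simp: sets_mu)
    also have "\<dots> \<le> (\<integral>\<^sup>+y. ennreal (p t x y) \<partial>\<mu>)"
    proof (rule nn_integral_mono)
      fix y
      show "ennreal (c5 * sc t powr (- dH) * exp (- c6)) * indicator (ball x (sc t)) y \<le> ennreal (p t x y)"
      proof (cases "dist x y < sc t")
        case True
        then have "(dist x y / sc t) powr (dW / (dW - 1)) \<le> 1"
          using sc_pos[OF t] exponent_ge_1 by (intro powr_le1) auto
        then have "exp (- c6) \<le> exp (- c6 * (dist x y / sc t) powr (dW / (dW - 1)))"
          using c_pos by (simp add: mult_left_le)
        then have "c5 * sc t powr (- dH) * exp (- c6) \<le> c5 * sc t powr (- dH) * exp (- c6 * (dist x y / sc t) powr (dW / (dW - 1)))"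
          using c_pos by (intro mult_left_mono) auto
        also have "\<dots> \<le> p t x y" by (rule p_lower'[OF t])
        finally show ?thesis using True by (simp add: ennreal_leI)
      qed simp
    qed
    finally have "ennreal a \<le> ennreal (P t (\<lambda>_. 1) x)" unfolding heat_nn_integral[OF t] .
    then show ?thesis using a by (smt (verit) ennreal_le_iff2 )
  qed
  ultimately show ?thesis using a b(1) by blast
qed

text \<open>The estimate wBE in scaled form; a pointwise bound replaces the essential supremum norm,
  so that it applies directly to truncated functions.\<close>

lemma heat_Hoelder:
  assumes t: "0 < t" and u: "u \<in> borel_measurable borel" "\<And>y. \<bar>u y\<bar> \<le> M"
  shows "\<bar>P t u x - P t u y\<bar> \<le> cB * M * (dist x y / sc t) powr \<kappa>"
proof -
  have M: "0 \<le> M" using u(2)[of undefined] by (rule order_trans[rotated]) simp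
  have le: "esssup \<mu> (\<lambda>x. ereal \<bar>u x\<bar>) \<le> ereal M" using u by (intro esssup_I) auto
  then have Linf: "u \<in> Linf \<mu>" unfolding Linf_def using u(1) by (auto intro: le_less_trans)
  have "Linf_norm \<mu> u \<le> M" unfolding Linf_norm_def using le M
    by (cases "esssup \<mu> (\<lambda>x. ereal \<bar>u x\<bar>)") auto
  then have "cB * (dist x y powr \<kappa> / t powr (\<kappa> / dW)) * Linf_norm \<mu> u \<le> cB * (dist x y powr \<kappa> / t powr (\<kappa> / dW)) * M"
    using c_pos by (intro mult_left_mono) auto
  moreover have "dist x y powr \<kappa> / t powr (\<kappa> / dW) = (dist x y / sc t) powr \<kappa>"
    using t sc_pos[OF t] by (simp add: powr_divide less_imp_le sc_powr)
  ultimately show ?thesis using heat_Hoelder_Linf[OF t Linf, of x y] by (simp add: mult.commute mult.left_commute)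
qed

lemma heat_uniformly_continuous:
  assumes t: "0 < t" and u: "u \<in> borel_measurable borel" "\<And>y. \<bar>u y\<bar> \<le> M"
  shows "uniformly_continuous_on UNIV (P t u)"
proof (rule uniformly_continuous_Hoelder[OF kappa_pos])
  fix x y
  show "\<bar>P t u x - P t u y\<bar> \<le> cB * M / sc t powr \<kappa> * dist x y powr \<kappa>"
    using heat_Hoelder[OF t u, of x y] sc_pos[OF t] by (simp add: powr_divide less_imp_le)
qed

lemma heat_continuous:
  assumes t: "0 < t" and u: "u \<in> borel_measurable borel" "\<And>y. \<bar>u y\<bar> \<le> M"
  shows "continuous_on UNIV (P t u)"
  using heat_uniformly_continuous[OF assms] by (rule uniformly_continuous_imp_continuous)

lemma heat_measurable:
  assumes t: "0 < t" and u: "u \<in> borel_measurable borel" "\<And>y. \<bar>u y\<bar> \<le> M"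
  shows "P t u \<in> borel_measurable borel"
  using heat_continuous[OF assms] by (intro borel_measurable_continuous_onI)

lemma AE_closed:
  assumes "closed C" "AE x in \<mu>. x \<in> C"
  shows "x \<in> C"
proof (rule ccontr)
  assume "x \<notin> C"
  then have "emeasure \<mu> (- C) > 0" using assms(1) by (intro full_support) auto
  moreover have "emeasure \<mu> (- C) = 0"
    using assms by (subst (asm) AE_iff_measurable[where N="- C"]) (auto simp: sets_mu space_mu)
  ultimately show False by simp
qed

text \<open>The semigroup law is given almost everywhere on L2. Truncations of u to balls lie in L2,
  both sides are continuous by wBE, so the law holds at every point for them; dominated convergence
  then removes the truncation, in the inner operator and afterwards in the outer one.\<close>

lemma heat_semigroup_bounded:
  assumes s: "0 < s" and t: "0 < t" and u: "u \<in> borel_measurable borel" "\<And>y. \<bar>u y\<bar> \<le> M"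
  shows "P (s + t) u x = P s (P t u) x"
proof -
  obtain b where b: "\<And>t x. 0 < t \<Longrightarrow> P t (\<lambda>_. 1) x \<le> b" using heat_mass_bounds by blast
  have M: "0 \<le> M" using u(2)[of undefined] by (rule order_trans[rotated]) simp
  have Pb: "\<bar>P t v y\<bar> \<le> M * b" if "v \<in> borel_measurable borel" "\<And>y. \<bar>v y\<bar> \<le> M" for v y
    using heat_abs_le[OF t that, of y] mult_left_mono[OF b[OF t, of y] M] by linarith
  define un where "un n y = u y * indicator (ball x (real n)) y" for n y
  have un: "un n \<in> borel_measurable borel" "\<bar>un n y\<bar> \<le> M" for n y
    using u(1) u(2)[of y] M by (auto simp: un_def[abs_def] indicator_def abs_mult)
  have L2: "un n \<in> L2 \<mu>" for n
  proof -
    have "integrable \<mu> (\<lambda>y. M\<^sup>2 * indicator (ball x (real n)) y)"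
      using ball_finite by (intro integrable_mult_right integrable_real_indicator) (auto simp: sets_mu)
    then have "integrable \<mu> (\<lambda>y. (un n y)\<^sup>2)"
    proof (rule Bochner_Integration.integrable_bound)
      show "AE y in \<mu>. norm ((un n y)\<^sup>2) \<le> norm (M\<^sup>2 * indicator (ball x (real n)) y)"
        using u(2) by (auto simp: un_def power_mult_distrib abs_le_square_iff[symmetric] M split: split_indicator)
    qed (use un in auto)
    then show ?thesis using un by (simp add: L2_def)
  qed
  have eqn: "P (s + t) (un n) x = P s (P t (un n)) x" for n
  proof -
    have "closed {y. P (s + t) (un n) y = P s (P t (un n)) y}"
      using s t un Pb[OF un] by (intro closed_Collect_eq heat_continuous heat_measurable) auto
    moreover have "AE y in \<mu>. y \<in> {y. P (s + t) (un n) y = P s (P t (un n)) y}"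
      using heat_semigroup_AE[OF s t L2] by simp
    ultimately have "x \<in> {y. P (s + t) (un n) y = P s (P t (un n)) y}" by (rule AE_closed)
    then show ?thesis by simp
  qed
  have unlim: "(\<lambda>n. un n y) \<longlonglongrightarrow> u y" for y
  proof -
    obtain N where N: "dist x y < real N" using reals_Archimedean2 by blast
    have "\<forall>\<^sub>F n in sequentially. un n y = u y"
      using eventually_ge_at_top[of N] by eventually_elim (use N in \<open>auto simp: un_def\<close>)
    then show ?thesis by (rule tendsto_eventually)
  qed
  have lim1: "(\<lambda>n. P r (un n) y) \<longlonglongrightarrow> P r u y" if r: "0 < r" for r y
    unfolding heat_op_def
  proof (rule integral_dominated_convergence)
    show "integrable \<mu> (\<lambda>z. M * p r y z)" by (intro integrable_mult_right p_integrable r)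
    show "AE z in \<mu>. (\<lambda>n. p r y z * un n z) \<longlonglongrightarrow> p r y z * u z" by (intro AE_I2 tendsto_mult_left unlim)
    show "AE z in \<mu>. norm (p r y z * un n z) \<le> M * p r y z" for n
    proof (rule AE_I2)
      fix z
      show "norm (p r y z * un n z) \<le> M * p r y z"
        using mult_right_mono[OF un(2)[of n z] p_nonneg[OF r, of y z]] p_nonneg[OF r, of y z]
        by (simp add: abs_mult mult.commute)
    qed
  qed (use u un r in \<open>auto intro!: borel_measurable_times p_measurable\<close>)
  have lim2: "(\<lambda>n. P s (P t (un n)) x) \<longlonglongrightarrow> P s (P t u) x"
    unfolding heat_op_def[of _ _ s]
  proof (rule integral_dominated_convergence)
    show "integrable \<mu> (\<lambda>z. M * b * p s x z)" by (intro integrable_mult_right p_integrable s)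
    show "AE z in \<mu>. (\<lambda>n. p s x z * P t (un n) z) \<longlonglongrightarrow> p s x z * P t u z"
      by (intro AE_I2 tendsto_mult_left lim1 t)
    show "AE z in \<mu>. norm (p s x z * P t (un n) z) \<le> M * b * p s x z" for n
    proof (rule AE_I2)
      fix z
      have "p s x z * \<bar>P t (un n) z\<bar> \<le> p s x z * (M * b)"
        by (intro mult_left_mono Pb un p_nonneg s)
      then show "norm (p s x z * P t (un n) z) \<le> M * b * p s x z"
        using p_nonneg[OF s] by (simp add: abs_mult mult.commute)
    qed
  qed (use u un s t heat_measurable[OF t un] heat_measurable[OF t u] in \<open>auto intro!: borel_measurable_times p_measurable\<close>)
  show ?thesis
    by (rule LIMSEQ_unique[OF lim1[of "s + t" x] ]) (use s t lim2 in \<open>auto simp: eqn\<close>)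
qed

text \<open>With \<open>w\<^sub>t = P\<^sub>t 1\<close>, (wBE) makes \<open>w\<^sub>T\<close> almost constant on the scale of \<open>p\<^sub>s\<close> as \<open>T \<rightarrow> \<infinity>\<close>, so
  \<open>w\<^sub>T\<^sub>+\<^sub>s \<approx> w\<^sub>T w\<^sub>s\<close>; since \<open>w\<close> is bounded above and away from zero, \<open>w\<^sub>s = 1\<close>.\<close>

lemma heat_conservative:
  assumes s: "0 < s"
  shows "P s (\<lambda>_. 1) x = 1"
proof -
  define w where "w t y = P t (\<lambda>_. 1) y" for t y
  obtain a b where a: "0 < a" and b: "0 < b" and ab: "\<And>t x. 0 < t \<Longrightarrow> a \<le> w t x" "\<And>t x. 0 < t \<Longrightarrow> w t x \<le> b"
    using heat_mass_bounds unfolding w_def by blast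
  \<comment> \<open>The weight is the Hoelder modulus of w_T. Absorbing it turns the variation of
    w_T seen by \<open>p s\<close> into a mass at time \<open>tB * s\<close>, which is at most
    b.\<close>
  obtain C where C: "0 < C" and cmp: "\<And>t x y. 0 < t \<Longrightarrow> p t x y * (1 + dist x y / sc t) powr \<kappa> \<le> C * p (tB * t) x y"
    using p_compare[OF kappa_pos] by blast
  have one: "(\<lambda>_. 1) \<in> borel_measurable borel" "\<And>y. \<bar>1::real\<bar> \<le> 1" by auto
  have wm: "w t \<in> borel_measurable borel" if "0 < t" for t
    using heat_measurable[OF that one] unfolding w_def[abs_def] by simp
  have wb: "\<bar>w t y\<bar> \<le> b" if "0 < t" for t y
    using ab[OF that, of y] a by simp
  define E where "E T = cB * (sc s / sc T) powr \<kappa> * (C * b)" for T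
  have est: "\<bar>w (s + T) x - w T x * w s x\<bar> \<le> E T" if T: "0 < T" for T
  proof -
    have wT: "w (s + T) x = (\<integral>y. p s x y * w T y \<partial>\<mu>)"
      using heat_semigroup_bounded[OF s T one(1), of 1 x] by (simp add: w_def heat_op_def[of _ _ s])
    have int1: "integrable \<mu> (\<lambda>y. p s x y * w T y)" by (rule p_integrable_mult[OF s wm[OF T] wb[OF T]])
    have "w (s + T) x - w T x * w s x = (\<integral>y. p s x y * (w T y - w T x) \<partial>\<mu>)"
      unfolding wT right_diff_distrib using int1 p_integrable[OF s] by (simp add: w_def heat_op_def mult.commute)
    also have "\<bar>\<dots>\<bar> \<le> (\<integral>y. \<bar>p s x y * (w T y - w T x)\<bar> \<partial>\<mu>)" by (rule integral_abs_bound)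
    also have "\<dots> \<le> (\<integral>y. cB * (sc s / sc T) powr \<kappa> * (C * p (tB * s) x y) \<partial>\<mu>)"
    proof (intro integral_mono integrable_abs integrable_mult_right p_integrable)
      show "integrable \<mu> (\<lambda>y. p s x y * (w T y - w T x))"
        unfolding right_diff_distrib using int1 p_integrable[OF s] by simp
      show "0 < tB * s" using tB_pos s by simp
      fix y
      have "\<bar>w T y - w T x\<bar> \<le> cB * 1 * (dist y x / sc T) powr \<kappa>"
        unfolding w_def by (rule heat_Hoelder[OF T one])
      also have "(dist y x / sc T) powr \<kappa> = (sc s / sc T) powr \<kappa> * (dist x y / sc s) powr \<kappa>"
        using sc_pos[OF s] sc_pos[OF T] by (simp add: powr_mult[symmetric] dist_commute)
      finally have 1: "\<bar>w T y - w T x\<bar> \<le> cB * (sc s / sc T) powr \<kappa> * (dist x y / sc s) powr \<kappa>" by (simp add: mult.assoc)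
      have "(dist x y / sc s) powr \<kappa> \<le> (1 + dist x y / sc s) powr \<kappa>"
        using sc_pos[OF s] kappa_pos by (intro powr_mono2) auto
      then have "p s x y * (dist x y / sc s) powr \<kappa> \<le> C * p (tB * s) x y"
        using cmp[OF s, of x y] mult_left_mono[OF _ p_nonneg[OF s, of x y]] by (meson order_trans)
      then have 2: "cB * (sc s / sc T) powr \<kappa> * (p s x y * (dist x y / sc s) powr \<kappa>) \<le> cB * (sc s / sc T) powr \<kappa> * (C * p (tB * s) x y)"
        using c_pos by (intro mult_left_mono) auto
      have "\<bar>p s x y * (w T y - w T x)\<bar> = p s x y * \<bar>w T y - w T x\<bar>"
        using p_nonneg[OF s] by (simp add: abs_mult)
      also have "\<dots> \<le> p s x y * (cB * (sc s / sc T) powr \<kappa> * (dist x y / sc s) powr \<kappa>)"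
        by (intro mult_left_mono 1 p_nonneg s)
      also have "\<dots> \<le> cB * (sc s / sc T) powr \<kappa> * (C * p (tB * s) x y)" using 2 by (simp add: mult_ac)
      finally show "\<bar>p s x y * (w T y - w T x)\<bar> \<le> cB * (sc s / sc T) powr \<kappa> * (C * p (tB * s) x y)" .
    qed
    also have "\<dots> = cB * (sc s / sc T) powr \<kappa> * (C * w (tB * s) x)" by (simp add: w_def heat_op_def)
    also have "\<dots> \<le> E T" unfolding E_def using c_pos C ab(2)[of "tB * s" x] tB_pos s
      by (intro mult_left_mono) auto
    finally show ?thesis .
  qed
  \<comment> \<open>\<open>E T\<close> decays like (sc s / sc T)^\<kappa>; T0 is the time at which
    this ratio of scales has dropped to the r for which E equals e.\<close>
  have Esmall: "\<exists>T0>0. \<forall>T\<ge>T0. E T \<le> e" if e: "0 < e" for e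
  proof -
    define r where "r = (e / (cB * (C * b))) powr (1 / \<kappa>)"
    have r: "0 < r" using e c_pos C b by (simp add: r_def)
    have rk: "r powr \<kappa> = e / (cB * (C * b))" using e c_pos C b kappa_pos by (simp add: r_def powr_powr)
    define T0 where "T0 = (sc s / r) powr dW"
    have T0: "0 < T0" using sc_pos[OF s] r by (simp add: T0_def)
    have "E T \<le> e" if T: "T \<ge> T0" for T
    proof -
      have "sc s / r \<le> sc T"
        using sc_mono[OF T0 T] sc_of_powr[of "sc s / r"] sc_pos[OF s] r by (simp add: T0_def)
      then have "sc s / sc T \<le> r" using r sc_pos[of T] T T0 by (simp add: field_simps)
      then have "(sc s / sc T) powr \<kappa> \<le> r powr \<kappa>"
        using sc_pos[OF s] sc_pos[of T] T T0 kappa_pos by (intro powr_mono2) auto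
      then have "E T \<le> cB * (r powr \<kappa>) * (C * b)"
        unfolding E_def using c_pos C b by (intro mult_right_mono mult_left_mono) auto
      then show ?thesis unfolding rk using c_pos C b by simp
    qed
    with T0 show ?thesis by blast
  qed
  define \<eta> where "\<eta> = w s x - 1"
  have "\<not> 0 < \<bar>\<eta>\<bar>"
  proof
    assume "0 < \<bar>\<eta>\<bar>"
    then have "0 < \<bar>\<eta>\<bar> * a / 2" using a by simp
    from Esmall[OF this] obtain T0 where T0: "0 < T0" and E: "\<And>T. T \<ge> T0 \<Longrightarrow> E T \<le> \<bar>\<eta>\<bar> * a / 2" by blast
    \<comment> \<open>If w_s(x) differed from 1 by \<eta>, each further time step s would move w(x)
      in the direction of \<eta> by at least |\<eta>| a minus the error, hence by at least |\<eta>|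
      a / 2. Infinitely many such steps leave every bounded interval.\<close>
    define W where "W n = sgn \<eta> * w (T0 + real n * s) x" for n
    have step: "W n + \<bar>\<eta>\<bar> * a / 2 \<le> W (Suc n)" for n
    proof -
      define T where "T = T0 + real n * s"
      have T: "T0 \<le> T" "0 < T" using T0 s by (auto simp: T_def add_pos_nonneg)
      have f1: "\<bar>w (s + T) x - w T x * (1 + \<eta>)\<bar> \<le> \<bar>\<eta>\<bar> * a / 2"
        using est[OF T(2)] E[OF T(1)] by (simp add: \<eta>_def)
      have f2: "\<bar>\<eta>\<bar> * a \<le> \<bar>\<eta>\<bar> * w T x" using ab(1)[OF T(2)] by (intro mult_left_mono) auto
      have f3: "T0 + real (Suc n) * s = s + T" by (simp add: T_def algebra_simps)
      have f4: "w T x * (1 + \<eta>) = w T x + sgn \<eta> * (\<bar>\<eta>\<bar> * w T x)"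
        unfolding mult.assoc[symmetric] sgn_mult_abs by (simp add: algebra_simps)
      show ?thesis
      proof (cases "\<eta> > 0")
        case True
        then have sg: "sgn \<eta> = 1" by simp
        from f1 f2 show ?thesis unfolding W_def f3 f4 T_def[symmetric] sg by linarith
      next
        case False
        with \<open>0 < \<bar>\<eta>\<bar>\<close> have sg: "sgn \<eta> = - 1" by (simp add: sgn_if)
        from f1 f2 show ?thesis unfolding W_def f3 f4 T_def[symmetric] sg by linarith
      qed
    qed
    have "W 0 + real n * (\<bar>\<eta>\<bar> * a / 2) \<le> W n" for n
    proof (induction n)
      case (Suc n)
      then show ?case using step[of n] unfolding of_nat_Suc distrib_right mult_1_left by linarith
    qed simp
    moreover have "\<bar>W n\<bar> \<le> b" for n
      using wb[of "T0 + real n * s" x] T0 s by (auto simp: W_def abs_mult sgn_if add_pos_nonneg)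
    ultimately have "real n * (\<bar>\<eta>\<bar> * a / 2) \<le> 2 * b" for n
      by (smt (verit))
    moreover obtain n where "2 * b / (\<bar>\<eta>\<bar> * a / 2) < real n" using reals_Archimedean2 by blast
    ultimately show False using \<open>0 < \<bar>\<eta>\<bar> * a / 2\<close> by (smt (verit) pos_divide_less_eq)
  qed
  then show ?thesis by (simp add: \<eta>_def w_def)
qed

section \<open>Contraction, tails and localized Hoelder continuity\<close>

lemma heat_abs_le_bound:
  assumes t: "0 < t" and u: "u \<in> borel_measurable borel" "\<And>y. \<bar>u y\<bar> \<le> M"
  shows "\<bar>P t u x\<bar> \<le> M"
  using heat_abs_le[OF assms] heat_conservative[OF t] by simp

text \<open>Where u does not vanish, dist / sc s is at least \<delta> / sc s, so the polynomial
  weight absorbed in the kernel comparison yields the factor (sc s / \<delta>)^m; what remains is a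
  kernel of total mass 1. The power m is free.\<close>

lemma heat_tail:
  assumes m: "0 < m"
  shows "\<exists>C>0. \<forall>s>0. \<forall>\<delta>>0. \<forall>u x. u \<in> borel_measurable borel \<longrightarrow> (\<forall>y. \<bar>u y\<bar> \<le> 1) \<longrightarrow>
    (\<forall>y\<in>ball x \<delta>. u y = 0) \<longrightarrow> \<bar>P s u x\<bar> \<le> C * (sc s / \<delta>) powr m"
proof -
  obtain C where C: "0 < C" and cmp: "\<And>t x y. 0 < t \<Longrightarrow> p t x y * (1 + dist x y / sc t) powr m \<le> C * p (tB * t) x y"
    using p_compare[OF m] by blast
  have "\<bar>P s u x\<bar> \<le> C * (sc s / \<delta>) powr m"
    if s: "0 < s" and d: "0 < \<delta>" and u: "u \<in> borel_measurable borel" "\<And>y. \<bar>u y\<bar> \<le> 1"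
      and u0: "\<And>y. y \<in> ball x \<delta> \<Longrightarrow> u y = 0" for s \<delta> u x
  proof -
    have tBs: "0 < tB * s" using tB_pos s by simp
    have "\<bar>P s u x\<bar> \<le> (\<integral>y. \<bar>p s x y * u y\<bar> \<partial>\<mu>)" unfolding heat_op_def by (rule integral_abs_bound)
    also have "\<dots> \<le> (\<integral>y. (sc s / \<delta>) powr m * (C * p (tB * s) x y) \<partial>\<mu>)"
    proof (intro integral_mono integrable_abs integrable_mult_right p_integrable tBs p_integrable_mult[OF s u])
      fix y
      show "\<bar>p s x y * u y\<bar> \<le> (sc s / \<delta>) powr m * (C * p (tB * s) x y)"
      proof (cases "y \<in> ball x \<delta>")
        case True
        then show ?thesis using u0 C p_nonneg[OF tBs] by simp
      next
        case False
        then have dd: "\<delta> \<le> dist x y" by simp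
        have "(\<delta> / sc s) powr m \<le> (1 + dist x y / sc s) powr m"
        proof (rule powr_mono2)
          have "\<delta> / sc s \<le> dist x y / sc s" using dd sc_pos[OF s] by (simp add: divide_right_mono)
          then show "\<delta> / sc s \<le> 1 + dist x y / sc s" by simp
        qed (use m d sc_pos[OF s] in auto)
        then have "p s x y * (\<delta> / sc s) powr m \<le> C * p (tB * s) x y"
          using cmp[OF s, of x y] mult_left_mono[OF _ p_nonneg[OF s, of x y]] by (meson order_trans)
        then have "p s x y \<le> (sc s / \<delta>) powr m * (C * p (tB * s) x y)"
          using d sc_pos[OF s] by (simp add: powr_divide field_simps)
        moreover have "\<bar>p s x y * u y\<bar> \<le> p s x y"
          using mult_left_mono[OF u(2)[of y] p_nonneg[OF s, of x y]] p_nonneg[OF s, of x y] by (simp add: abs_mult)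
        ultimately show ?thesis by linarith
      qed
    qed
    also have "\<dots> = (sc s / \<delta>) powr m * C * P (tB * s) (\<lambda>_. 1) x" by (simp add: heat_op_def)
    also have "\<dots> = C * (sc s / \<delta>) powr m" by (simp add: heat_conservative[OF tBs])
    finally show ?thesis .
  qed
  with C show ?thesis by blast
qed

text \<open>The semigroup is iterated along the times \<open>s 4\<^sup>-\<^sup>d\<^sup>W\<^sup>n\<close>, removing at the \<open>n\<close>-th stage what has
  reached the ball of radius \<open>\<delta>/2 (1 + 2\<^sup>-\<^sup>n\<^sup>-\<^sup>1)\<close>; (wBE) is applied to the removed part only, whose size is
  controlled by the tail of the kernel.\<close>

lemma heat_Hoelder_off_ball:
  "\<exists>C>0. \<forall>s>0. \<forall>\<delta>>0. \<forall>k x y. k \<in> borel_measurable borel \<longrightarrow> (\<forall>z. \<bar>k z\<bar> \<le> 1) \<longrightarrow>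
    (\<forall>z\<in>ball x \<delta>. k z = 0) \<longrightarrow> \<bar>P s k x - P s k y\<bar> \<le> C * (dist x y / \<delta>) powr \<kappa>"
proof -
  \<comment> \<open>The tail power must beat the deterioration of the Hoelder constant. At stage n
    the scale is 4^(-n) and the gap 2^(-n), so the tail contributes 2^(-3 n \<kappa>) and wBE loses
    4^(n \<kappa>); the product is \<rho>^n with \<rho> = 2^(-\<kappa>).\<close>
  have k3: "0 < 3 * \<kappa>" using kappa_pos by simp
  obtain CT where CT: "0 < CT"
    and tail0: "\<forall>s>0. \<forall>\<delta>>0. \<forall>u x. u \<in> borel_measurable borel \<longrightarrow> (\<forall>y. \<bar>u y\<bar> \<le> 1) \<longrightarrow>
      (\<forall>y\<in>ball x \<delta>. u y = 0) \<longrightarrow> \<bar>P s u x\<bar> \<le> CT * (sc s / \<delta>) powr (3 * \<kappa>)"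
    using heat_tail[OF k3] by (elim exE conjE) (rule that; assumption)
  note tail = tail0[rule_format]
  define \<rho> where "\<rho> = (1/2::real) powr \<kappa>"
  have \<rho>: "0 < \<rho>" "\<rho> < 1" using kappa_pos powr_less_mono2[of \<kappa> "1/2" 1] by (auto simp: \<rho>_def)
  \<comment> \<open>Three of the powers 4^\<kappa> come from the gap being a quarter of \<delta>
    2^(-n), the fourth from applying wBE at the next time, whose scale is smaller by 4.\<close>
  define A where "A = cB * CT * 4 powr (4 * \<kappa>)"
  have A: "0 < A" using c_pos CT by (simp add: A_def)
  define C where "C = 2 * 4 powr \<kappa> + cB + A / (1 - \<rho>)"
  have C: "0 < C" using c_pos A \<rho> by (simp add: C_def add_pos_pos)
  have "\<bar>P s k x - P s k y\<bar> \<le> C * (dist x y / \<delta>) powr \<kappa>"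
    if s: "0 < s" and d: "0 < \<delta>" and k: "k \<in> borel_measurable borel" "\<And>z. \<bar>k z\<bar> \<le> 1"
      and k0: "\<And>z. z \<in> ball x \<delta> \<Longrightarrow> k z = 0" for s \<delta> k x y
  proof -
    define R where "R = (dist x y / \<delta>) powr \<kappa>"
    have R: "0 \<le> R" by (simp add: R_def)
    \<comment> \<open>Distant points are settled by the sup bound, large times by plain wBE. The
      iteration is needed only when the scale is below \<delta> and the points are close.\<close>
    consider "\<delta> / 4 \<le> dist x y" | "\<delta> \<le> sc s" | "dist x y < \<delta> / 4" "sc s < \<delta>" by linarith
    then show ?thesis
    proof cases
      case 1
      have "1 \<le> (4 * (dist x y / \<delta>)) powr \<kappa>"
        using 1 d kappa_pos by (intro ge_one_powr_ge_zero) (auto simp: field_simps)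
      also have "\<dots> = 4 powr \<kappa> * R" unfolding R_def using d by (subst powr_mult) auto
      finally have "2 \<le> 2 * 4 powr \<kappa> * R" by simp
      moreover have "\<bar>P s k x - P s k y\<bar> \<le> 2"
        using heat_abs_le_bound[OF s k, of x] heat_abs_le_bound[OF s k, of y] by linarith
      moreover have "2 * 4 powr \<kappa> * R \<le> C * R"
        using c_pos A \<rho> R by (intro mult_right_mono) (auto simp: C_def)
      ultimately show ?thesis unfolding R_def by linarith
    next
      case 2
      have "\<bar>P s k x - P s k y\<bar> \<le> cB * 1 * (dist x y / sc s) powr \<kappa>" by (rule heat_Hoelder[OF s k])
      also have "\<dots> \<le> cB * R" unfolding R_def using 2 d c_pos kappa_pos
        by (auto intro!: mult_left_mono powr_mono2 divide_left_mono)
      also have "\<dots> \<le> C * R" using A \<rho> R by (intro mult_right_mono) (auto simp: C_def)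
      finally show ?thesis by (simp add: R_def)
    next
      case 3
      define S where "S n = s / (4 powr dW) ^ n" for n :: nat
      define dl where "dl n = \<delta> / 2 * (1 + (1/2)^n)" for n :: nat
      have S: "0 < S n" for n using s by (simp add: S_def)
      have scS: "sc (S n) = sc s / 4 ^ n" for n
      proof -
        have "(4 powr dW) ^ n = (4 ^ n) powr dW"
          by (simp add: powr_realpow[symmetric] powr_powr mult.commute)
        then have "S n = s * (1 / 4 ^ n) powr dW" by (simp add: S_def powr_divide)
        then show ?thesis using s by (simp add: sc_mult sc_of_powr)
      qed
      have Sless: "S (Suc n) < S n" for n
      proof -
        have "1 < 4 powr dW" using dW_pos powr_less_mono[of 0 dW "4::real"] by simp
        then show ?thesis using s by (simp add: S_def field_simps)
      qed
      have dl: "\<delta> / 2 \<le> dl n" "dl n - dl (Suc n) = \<delta> * (1/2)^n / 4" for n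
        using d by (auto simp: dl_def field_simps)
      \<comment> \<open>Each stage pays one term of a geometric series for the part discarded inside
        the smaller ball and passes the rest to the next, shorter time. After N stages the rest is
        estimated by the tail at both points; since y is within \<delta>/4 of x, the ball of radius
        \<delta>/4 about y still lies in the zero set.\<close>
      have claim: "\<bar>P (S n) v x - P (S n) v y\<bar> \<le> (\<Sum>i<N. A * R * \<rho> ^ (n + i)) + 2 * CT * (sc (S (n + N)) / (\<delta>/4)) powr (3 * \<kappa>)"
        if "v \<in> borel_measurable borel" "\<And>z. \<bar>v z\<bar> \<le> 1" "\<And>z. z \<in> ball x (dl n) \<Longrightarrow> v z = 0" for N n v
        using that
      proof (induction N arbitrary: n v)
        case 0
        have v0: "v z = 0" if "dist x z < \<delta> / 2" for z using 0(3)[of z] dl(1)[of n] that by simp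
        have "\<bar>P (S n) v x\<bar> \<le> CT * (sc (S n) / (\<delta>/4)) powr (3 * \<kappa>)"
          by (rule tail[OF S _ 0(1,2)]) (use d v0 in auto)
        moreover have "\<bar>P (S n) v y\<bar> \<le> CT * (sc (S n) / (\<delta>/4)) powr (3 * \<kappa>)"
        proof (rule tail[OF S _ 0(1,2)])
          fix z assume "z \<in> ball y (\<delta>/4)"
          then have "dist x z < \<delta> / 2" using 3(1) dist_triangle[of x z y] by simp
          then show "v z = 0" by (rule v0)
        qed (use d in auto)
        ultimately show ?case by simp
      next
        case (Suc N)
        note v = Suc.prems(1,2)
        define r where "r = S n - S (Suc n)"
        have r: "0 < r" using Sless[of n] by (simp add: r_def)
        have rS: "S (Suc n) + r = S n" by (simp add: r_def)
        define u where "u = P r v"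
        have u: "u \<in> borel_measurable borel" "\<And>z. \<bar>u z\<bar> \<le> 1"
          unfolding u_def using heat_measurable[OF r v] heat_abs_le_bound[OF r v] by auto
        define a where "a = CT * (sc (S n) / (\<delta> * (1/2)^n / 4)) powr (3 * \<kappa>)"
        define w where "w z = u z * indicator (ball x (dl (Suc n))) z" for z
        define v' where "v' z = u z * indicator (- ball x (dl (Suc n))) z" for z
        have v': "v' \<in> borel_measurable borel" "\<And>z. \<bar>v' z\<bar> \<le> 1" "\<And>z. z \<in> ball x (dl (Suc n)) \<Longrightarrow> v' z = 0"
          using u by (auto simp: v'_def[abs_def] abs_mult split: split_indicator)
        have ub: "\<bar>u z\<bar> \<le> a" if z: "dist x z < dl (Suc n)" for z
        proof -
          have "\<bar>u z\<bar> \<le> CT * (sc r / (\<delta> * (1/2)^n / 4)) powr (3 * \<kappa>)"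
            unfolding u_def
          proof (rule tail[OF r _ v])
            fix z' assume "z' \<in> ball z (\<delta> * (1/2)^n / 4)"
            then have "dist x z' < dl n" using z dist_triangle[of x z' z] dl(2)[of n] by simp
            then show "v z' = 0" using Suc.prems(3) by simp
          qed (use d in auto)
          also have "\<dots> \<le> a" unfolding a_def
          proof (intro mult_left_mono powr_mono2 divide_right_mono)
            show "sc r \<le> sc (S n)" using r S[of "Suc n"] by (intro sc_mono) (auto simp: r_def)
          qed (use d CT kappa_pos sc_pos[OF r] in auto)
          finally show ?thesis .
        qed
        have a0: "0 \<le> a" using CT by (simp add: a_def)
        have w: "w \<in> borel_measurable borel" "\<And>z. \<bar>w z\<bar> \<le> a"
        proof -
          show "w \<in> borel_measurable borel" unfolding w_def[abs_def]
            using u(1) by (intro borel_measurable_times borel_measurable_indicator) auto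
          show "\<bar>w z\<bar> \<le> a" for z
            using ub[of z] a0 by (auto simp: w_def split: split_indicator)
        qed
        have split: "P (S n) v z = P (S (Suc n)) w z + P (S (Suc n)) v' z" for z
        proof -
          have "P (S n) v z = P (S (Suc n)) u z"
            using heat_semigroup_bounded[OF S r v, of "Suc n" z] by (simp add: rS u_def)
          also have "u = (\<lambda>z. w z + v' z)" by (auto simp: w_def v'_def fun_eq_iff split: split_indicator)
          finally show ?thesis using heat_add[OF S w v'(1,2), of "Suc n" z] by simp
        qed
        have "\<bar>P (S (Suc n)) w x - P (S (Suc n)) w y\<bar> \<le> cB * a * (dist x y / sc (S (Suc n))) powr \<kappa>"
          by (rule heat_Hoelder[OF S w])
        also have "\<dots> \<le> A * R * \<rho> ^ n"
        proof -
          have sp: "0 < sc s" by (rule sc_pos[OF s])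
          have e1: "sc (S n) / (\<delta> * (1/2)^n / 4) = (4 * (sc s / \<delta>)) * (1/2) ^ n"
            unfolding scS using d by (simp add: field_simps power_mult_distrib[symmetric])
          have e2: "dist x y / sc (S (Suc n)) = dist x y / \<delta> * (\<delta> / sc s) * (4 * 4 ^ n)"
            unfolding scS using d sp by (simp add: field_simps)
          have "cB * a * (dist x y / sc (S (Suc n))) powr \<kappa>
              = cB * CT * ((4 powr (3 * \<kappa>) * (sc s / \<delta>) powr (3 * \<kappa>)) * ((1/2) ^ n) powr (3 * \<kappa>)) * (R * (\<delta> / sc s) powr \<kappa> * (4 powr \<kappa> * (4 ^ n) powr \<kappa>))"
          proof -
            have q: "(a * b * c) powr e = a powr e * b powr e * c powr e"
              if "0 \<le> a" "0 \<le> b" "0 \<le> c" for a b c e :: real using that by (simp add: powr_mult)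
            have "((4 * (sc s / \<delta>)) * (1/2) ^ n) powr (3 * \<kappa>) = (4 powr (3 * \<kappa>) * (sc s / \<delta>) powr (3 * \<kappa>)) * ((1/2) ^ n) powr (3 * \<kappa>)"
              by (rule q) (use d sp in auto)
            moreover have "(dist x y / \<delta> * (\<delta> / sc s) * (4 * 4 ^ n)) powr \<kappa> = R * (\<delta> / sc s) powr \<kappa> * (4 * 4 ^ n) powr \<kappa>"
              unfolding R_def by (rule q) (use d sp in auto)
            moreover have "(4 * 4 ^ n :: real) powr \<kappa> = 4 powr \<kappa> * (4 ^ n) powr \<kappa>" by (simp add: powr_mult)
            ultimately show ?thesis unfolding a_def e1 e2 by (simp only: mult.assoc)
          qed
          also have "\<dots> = cB * CT * (4 powr (3 * \<kappa>) * 4 powr \<kappa>) * R * (((1/2) ^ n) powr (3 * \<kappa>) * (4 ^ n) powr \<kappa>) * ((sc s / \<delta>) powr (3 * \<kappa>) * (\<delta> / sc s) powr \<kappa>)"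
            by (simp only: mult_ac)
          also have "4 powr (3 * \<kappa>) * 4 powr \<kappa> = (4::real) powr (4 * \<kappa>)"
            by (simp add: powr_add[symmetric])
          also have "((1/2) ^ n) powr (3 * \<kappa>) * (4 ^ n) powr \<kappa> = \<rho> ^ n"
          proof -
            have "((1/2::real) ^ n) powr (3 * \<kappa>) * (4 ^ n) powr \<kappa> = (((1/2) ^ n) powr 3) powr \<kappa> * (4 ^ n) powr \<kappa>"
              by (simp only: powr_powr)
            also have "\<dots> = (((1/2) ^ n) powr 3 * 4 ^ n) powr \<kappa>" by (simp add: powr_mult)
            also have "((1/2::real) ^ n) powr 3 * 4 ^ n = (1/2) ^ n"
            proof -
              have "((1/2::real) ^ n) powr 3 = ((1/2) ^ n) ^ 3" by (simp add: powr_numeral)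
              then show ?thesis by (simp add: power_mult[symmetric] power_mult_distrib[symmetric] power3_eq_cube)
            qed
            also have "((1/2::real) ^ n) powr \<kappa> = \<rho> ^ n"
              by (simp add: \<rho>_def powr_realpow[symmetric] powr_powr mult.commute)
            finally show ?thesis .
          qed
          also have "(sc s / \<delta>) powr (3 * \<kappa>) * (\<delta> / sc s) powr \<kappa> = (sc s / \<delta>) powr (2 * \<kappa>)"
          proof -
            have "(\<delta> / sc s) powr \<kappa> = (sc s / \<delta>) powr (- \<kappa>)"
              using d sp by (simp add: powr_minus powr_divide)
            then show ?thesis by (simp add: powr_add[symmetric])
          qed
          also have "cB * CT * 4 powr (4 * \<kappa>) * R * \<rho> ^ n * (sc s / \<delta>) powr (2 * \<kappa>) \<le> cB * CT * 4 powr (4 * \<kappa>) * R * \<rho> ^ n * 1"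
            using c_pos CT R \<rho> 3(2) sp d kappa_pos by (intro mult_left_mono powr_le1) auto
          also have "\<dots> = A * R * \<rho> ^ n" by (simp add: A_def)
          finally show ?thesis .
        qed
        finally have 1: "\<bar>P (S (Suc n)) w x - P (S (Suc n)) w y\<bar> \<le> A * R * \<rho> ^ n" .
        have 2: "\<bar>P (S (Suc n)) v' x - P (S (Suc n)) v' y\<bar> \<le> (\<Sum>i<N. A * R * \<rho> ^ (Suc n + i)) + 2 * CT * (sc (S (Suc n + N)) / (\<delta>/4)) powr (3 * \<kappa>)"
          by (rule Suc.IH[OF v'])
        have "(\<Sum>i<Suc N. A * R * \<rho> ^ (n + i)) = A * R * \<rho> ^ n + (\<Sum>i<N. A * R * \<rho> ^ (Suc n + i))"
          by (subst sum.lessThan_Suc_shift) simp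
        with 1 2 split[of x] split[of y] show ?case by simp
      qed
      have "\<bar>P s k x - P s k y\<bar> \<le> A * R / (1 - \<rho>) + 2 * CT * ((4 * sc s / \<delta>) * (1/4) ^ N) powr (3 * \<kappa>)" for N
      proof -
        have 1: "\<bar>P (S 0) k x - P (S 0) k y\<bar> \<le> (\<Sum>i<N. A * R * \<rho> ^ (0 + i)) + 2 * CT * (sc (S (0 + N)) / (\<delta>/4)) powr (3 * \<kappa>)"
          by (rule claim[OF k]) (use k0 in \<open>simp add: dl_def\<close>)
        have 2: "(\<Sum>i<N. A * R * \<rho> ^ (0 + i)) \<le> A * R / (1 - \<rho>)"
        proof -
          have "(\<Sum>i<N. A * R * \<rho> ^ (0 + i)) = A * R * (\<Sum>i<N. \<rho> ^ i)" by (simp add: sum_distrib_left)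
          also have "\<dots> \<le> A * R * (\<Sum>i. \<rho> ^ i)"
            using A R \<rho> by (intro mult_left_mono sum_le_suminf summable_geometric) auto
          also have "\<dots> = A * R / (1 - \<rho>)" using \<rho> by (simp add: suminf_geometric)
          finally show ?thesis .
        qed
        have 3: "sc (S (0 + N)) / (\<delta>/4) = (4 * sc s / \<delta>) * (1/4) ^ N"
          unfolding scS by (simp add: power_one_over field_simps)
        have "S 0 = s" by (simp add: S_def)
        with 1[unfolded 3] 2 show ?thesis by simp
      qed
      \<comment> \<open>The tail remainder vanishes as N grows; its limit is written with
        \<open>0 powr (3 * \<kappa>)\<close>, which is 0.\<close>
      moreover have "(\<lambda>N. A * R / (1 - \<rho>) + 2 * CT * ((4 * sc s / \<delta>) * (1/4) ^ N) powr (3 * \<kappa>)) \<longlonglongrightarrow> A * R / (1 - \<rho>) + 2 * CT * ((4 * sc s / \<delta>) * 0) powr (3 * \<kappa>)"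
        using d sc_pos[OF s] kappa_pos
        by (intro tendsto_intros tendsto_powr' LIMSEQ_power_zero) auto
      ultimately have "\<bar>P s k x - P s k y\<bar> \<le> A * R / (1 - \<rho>) + 2 * CT * ((4 * sc s / \<delta>) * 0) powr (3 * \<kappa>)"
        by (intro LIMSEQ_le_const) auto
      then have "\<bar>P s k x - P s k y\<bar> \<le> A / (1 - \<rho>) * R" by simp
      also have "\<dots> \<le> C * R" using c_pos R by (intro mult_right_mono) (auto simp: C_def)
      finally show ?thesis by (simp add: R_def)
    qed
  qed
  with C show ?thesis by blast
qed

text \<open>k is cut at the ball of radius \<delta> about x. The inner part is bounded by g(x) +
  \<omega>, so global wBE applies with that constant. The outer part vanishes near x and has Hoelder
  constant of order \<delta>^(-\<kappa>) instead of (sc s)^(-\<kappa>), which is the factor (sc s /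
  \<delta>)^\<kappa>. Only x carries the value of g; y is arbitrary.\<close>

lemma heat_Hoelder_local:
  "\<exists>C>0. \<forall>s>0. \<forall>\<delta>>0. \<forall>M \<omega> g k x y. g \<in> borel_measurable borel \<longrightarrow> k \<in> borel_measurable borel \<longrightarrow>
    (\<forall>z. \<bar>k z\<bar> \<le> g z \<and> g z \<le> M) \<longrightarrow> (\<forall>z. dist x z < \<delta> \<longrightarrow> \<bar>g z - g x\<bar> \<le> \<omega>) \<longrightarrow>
    \<bar>P s k x - P s k y\<bar> \<le> C * (dist x y / sc s) powr \<kappa> * (g x + \<omega> + M * (sc s / \<delta>) powr \<kappa>)"
proof -
  obtain C0 where C0: "0 < C0"
    and off0: "\<forall>s>0. \<forall>\<delta>>0. \<forall>k x y. k \<in> borel_measurable borel \<longrightarrow> (\<forall>z. \<bar>k z\<bar> \<le> 1) \<longrightarrow>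
      (\<forall>z\<in>ball x \<delta>. k z = 0) \<longrightarrow> \<bar>P s k x - P s k y\<bar> \<le> C0 * (dist x y / \<delta>) powr \<kappa>"
    using heat_Hoelder_off_ball by (elim exE conjE) (rule that; assumption)
  note off = off0[rule_format]
  define C where "C = cB + C0"
  have C: "0 < C" "cB \<le> C" "C0 \<le> C" using c_pos C0 by (auto simp: C_def)
  have main: "\<bar>P s k x - P s k y\<bar> \<le> C * (dist x y / sc s) powr \<kappa> * (g x + \<omega> + M * (sc s / \<delta>) powr \<kappa>)"
    if s: "0 < s" and d: "0 < \<delta>" and k: "k \<in> borel_measurable borel"
      and kg: "\<And>z. \<bar>k z\<bar> \<le> g z" "\<And>z. g z \<le> M" and om: "\<And>z. dist x z < \<delta> \<Longrightarrow> \<bar>g z - g x\<bar> \<le> \<omega>" for s \<delta> M \<omega> g k x y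
  proof -
    have g0: "0 \<le> g z" for z using kg(1)[of z] by simp
    have M: "0 \<le> M" using g0 kg(2) order_trans by blast
    have om0: "0 \<le> \<omega>" using om[of x] d by simp
    define D where "D = (dist x y / sc s) powr \<kappa>"
    define k1 where "k1 z = k z * indicator (ball x \<delta>) z" for z
    define k2 where "k2 z = k z * indicator (- ball x \<delta>) z" for z
    have k1: "k1 \<in> borel_measurable borel" "\<And>z. \<bar>k1 z\<bar> \<le> g x + \<omega>"
    proof -
      show "k1 \<in> borel_measurable borel" unfolding k1_def[abs_def]
        using k by (intro borel_measurable_times borel_measurable_indicator) auto
      show "\<bar>k1 z\<bar> \<le> g x + \<omega>" for z
        using kg(1)[of z] om[of z] g0[of x] om0 by (auto simp: k1_def split: split_indicator)
    qed
    have k2: "k2 \<in> borel_measurable borel" "\<And>z. \<bar>k2 z\<bar> \<le> M" "\<And>z. z \<in> ball x \<delta> \<Longrightarrow> k2 z = 0"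
    proof -
      show "k2 \<in> borel_measurable borel" using k by (simp add: k2_def[abs_def])
      show "\<bar>k2 z\<bar> \<le> M" for z
        using kg(1)[of z] kg(2)[of z] M by (auto simp: k2_def split: split_indicator)
    qed (simp add: k2_def)
    have "k = (\<lambda>z. k1 z + k2 z)" by (auto simp: k1_def k2_def fun_eq_iff split: split_indicator)
    then have split: "P s k z = P s k1 z + P s k2 z" for z using heat_add[OF s k1 k2(1,2), of z] by simp
    have 1: "\<bar>P s k1 x - P s k1 y\<bar> \<le> cB * (g x + \<omega>) * D" unfolding D_def by (rule heat_Hoelder[OF s k1])
    have 2: "\<bar>P s k2 x - P s k2 y\<bar> \<le> C0 * D * (M * (sc s / \<delta>) powr \<kappa>)"
    \<comment> \<open>The outer part is normalized by dividing by M, so M = 0 is treated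
      apart.\<close>
    proof (cases "M = 0")
      case True
      then have "k2 = (\<lambda>_. 0)" using k2(2) by (auto simp: fun_eq_iff)
      then show ?thesis using True by (simp add: heat_op_def)
    next
      case False
      with M have Mp: "0 < M" by simp
      have "\<bar>P s (\<lambda>z. k2 z / M) x - P s (\<lambda>z. k2 z / M) y\<bar> \<le> C0 * (dist x y / \<delta>) powr \<kappa>"
        by (rule off[OF s d]) (use k2 Mp in \<open>auto simp: field_simps\<close>)
      moreover have "P s (\<lambda>z. k2 z / M) z = P s k2 z / M" for z using heat_cmult[of s "1/M" k2 z] by simp
      ultimately have "\<bar>P s k2 x - P s k2 y\<bar> \<le> M * (C0 * (dist x y / \<delta>) powr \<kappa>)"
        using Mp by (simp add: diff_divide_distrib[symmetric] field_simps)
      moreover have "(dist x y / \<delta>) powr \<kappa> = D * (sc s / \<delta>) powr \<kappa>"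
        unfolding D_def using sc_pos[OF s] d by (simp add: powr_mult[symmetric])
      ultimately show ?thesis by (simp add: mult_ac)
    qed
    have D: "0 \<le> D" by (simp add: D_def)
    have "cB * (g x + \<omega>) * D \<le> C * (g x + \<omega>) * D"
      using C D g0[of x] om0 by (intro mult_right_mono) auto
    moreover have "C0 * D * (M * (sc s / \<delta>) powr \<kappa>) \<le> C * D * (M * (sc s / \<delta>) powr \<kappa>)"
      using C D M by (intro mult_right_mono) auto
    ultimately show ?thesis using 1 2 split[of x] split[of y] unfolding D_def[symmetric] by (simp add: algebra_simps)
  qed
  show ?thesis
  proof (intro exI[of _ C] conjI allI impI C(1))
    fix s \<delta> M \<omega> :: real and g k :: "'a \<Rightarrow> real" and x y :: 'a
    assume "0 < (s::real)" "0 < (\<delta>::real)" "k \<in> borel_measurable borel"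
      and *: "\<forall>z. \<bar>k z\<bar> \<le> g z \<and> g z \<le> M" "\<forall>z. dist x z < \<delta> \<longrightarrow> \<bar>g z - g x\<bar> \<le> \<omega>"
    then show "\<bar>P s k x - P s k y\<bar> \<le> C * (dist x y / sc s) powr \<kappa> * (g x + \<omega> + M * (sc s / \<delta>) powr \<kappa>)"
      by (intro main) auto
  qed
qed

end

section \<open>Kernel energies and the coarea formula\<close>


text \<open>The sum is dominated by the integral of x^(-a), realized as a telescoping bound in the
  induction step, so no integral occurs.\<close>

lemma sum_powr_le:
  fixes a :: real
  assumes a: "0 < a" "a < 1"
  shows "(\<Sum>j=1..n. real j powr (- a)) \<le> real n powr (1 - a) / (1 - a)"
proof (induction n)
  case 0
  then show ?case by simp
next
  case (Suc n)
  define N where "N = real (Suc n)"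
  have N: "0 < N" "real n = N - 1" by (auto simp: N_def)
  have "(1 - a) * N powr (- a) \<le> N powr (1 - a) - (N - 1) powr (1 - a)"
  proof (cases "n = 0")
    case True
    then show ?thesis using a by (simp add: N_def)
  next
    case False
    then have N1: "0 < N - 1" by (simp add: N_def)
    \<comment> \<open>Young's inequality for (N-1)/N and 1 expresses the concavity of x^(1-a) at x =
      1.\<close>
    have "((N - 1) / N) powr (1 - a) * 1 powr a \<le> (1 - a) * ((N - 1) / N) + a * 1"
      using a N1 N by (intro Youngs_inequality_0) auto
    also have "\<dots> = 1 - (1 - a) / N" using N by (simp add: field_simps)
    finally have "(N - 1) powr (1 - a) / N powr (1 - a) \<le> 1 - (1 - a) / N"
      using N1 N by (simp add: powr_divide)
    then have "(N - 1) powr (1 - a) \<le> (1 - (1 - a) / N) * N powr (1 - a)"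
      using N by (simp add: pos_divide_le_eq)
    also have "\<dots> = N powr (1 - a) - (1 - a) * (N powr (1 - a) / N)" by (simp add: algebra_simps)
    also have "N powr (1 - a) / N = N powr (- a)" using N by (simp add: powr_diff powr_minus field_simps)
    finally show ?thesis by simp
  qed
  then have "N powr (- a) \<le> (N powr (1 - a) - (N - 1) powr (1 - a)) / (1 - a)"
    using a by (simp add: pos_le_divide_eq mult.commute)
  moreover have "(\<Sum>j=1..Suc n. real j powr (- a)) = (\<Sum>j=1..n. real j powr (- a)) + N powr (- a)"
    by (simp add: N_def)
  ultimately show ?case using Suc.IH unfolding N(2) N_def[symmetric] by (simp add: diff_divide_distrib)
qed

context heat_kernel_wBE
begin

section \<open>Integrals over pairs, duality and symmetrization\<close>

sublocale pair: pair_sigma_finite \<mu> \<mu> ..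

abbreviation M2 :: "('a \<times> 'a) measure" where "M2 \<equiv> \<mu> \<Otimes>\<^sub>M \<mu>"

text \<open>Valued in \<open>ennreal\<close> so that additivity, monotonicity and the coarea formula
  need no integrability; negative values of \<open>W\<close> count as 0.\<close>

definition osc :: "('a \<times> 'a \<Rightarrow> real) \<Rightarrow> ('a \<Rightarrow> real) \<Rightarrow> ennreal" where
  "osc W f = (\<integral>\<^sup>+z. ennreal (W z) * ennreal \<bar>f (fst z) - f (snd z)\<bar> \<partial>M2)"

abbreviation pp :: "real \<Rightarrow> 'a \<times> 'a \<Rightarrow> real" where "pp t z \<equiv> p t (fst z) (snd z)"

abbreviation dd :: "'a \<times> 'a \<Rightarrow> real" where "dd z \<equiv> dist (fst z) (snd z)"

lemma pp_measurable [measurable]: "0 < t \<Longrightarrow> pp t \<in> borel_measurable M2"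
  by (rule p_measurable) (auto simp: measurable_cong_sets[OF sets_mu refl])

lemma fst_measurable' [measurable]: "fst \<in> measurable M2 borel"
  using measurable_fst[of \<mu> \<mu>] measurable_cong_sets[OF refl sets_mu] by blast

lemma snd_measurable' [measurable]: "snd \<in> measurable M2 borel"
  using measurable_snd[of \<mu> \<mu>] measurable_cong_sets[OF refl sets_mu] by blast

lemma dd_measurable [measurable]: "dd \<in> borel_measurable M2"
  by (rule dist_measurable) measurable

lemma on_fst_measurable [measurable (raw)]: "f \<in> borel_measurable borel \<Longrightarrow> (\<lambda>z. f (fst z)) \<in> borel_measurable M2"
  by (rule measurable_compose[OF fst_measurable'])

lemma on_snd_measurable [measurable (raw)]: "f \<in> borel_measurable borel \<Longrightarrow> (\<lambda>z. f (snd z)) \<in> borel_measurable M2"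
  by (rule measurable_compose[OF snd_measurable'])

text \<open>Integrating first in the variable of \<open>a\<close> leaves, by symmetry and
  conservativeness, kernel mass 1, so the integral is at most M times the L1 norm of
  \<open>b\<close>.\<close>

lemma kernel_pair_integrable:
  assumes s: "0 < s" and a: "a \<in> borel_measurable borel" "\<And>x. \<bar>a x\<bar> \<le> M"
    and b: "b \<in> borel_measurable borel" "integrable \<mu> b"
  shows "integrable M2 (\<lambda>z. a (fst z) * pp s z * b (snd z))"
proof (rule integrableI_bounded)
  have M: "0 \<le> M" using a(2)[of undefined] by (rule order_trans[rotated]) simp
  have [measurable]: "(\<lambda>z. a (fst z) * pp s z * b (snd z)) \<in> borel_measurable M2"
    using s a(1) b(1) by measurable
  then show "(\<lambda>z. a (fst z) * pp s z * b (snd z)) \<in> borel_measurable M2" .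
  have "(\<integral>\<^sup>+z. ennreal (norm (a (fst z) * pp s z * b (snd z))) \<partial>M2)
      = (\<integral>\<^sup>+y. \<integral>\<^sup>+x. ennreal (norm (a (fst (x, y)) * pp s (x, y) * b (snd (x, y)))) \<partial>\<mu> \<partial>\<mu>)"
    by (rule pair.nn_integral_snd[symmetric]) measurable
  also have "\<dots> \<le> (\<integral>\<^sup>+y. \<integral>\<^sup>+x. ennreal (M * \<bar>b y\<bar>) * ennreal (p s y x) \<partial>\<mu> \<partial>\<mu>)"
  proof (intro nn_integral_mono)
    fix x y
    have "\<bar>a x\<bar> * (p s x y * \<bar>b y\<bar>) \<le> M * (p s x y * \<bar>b y\<bar>)"
      using a(2) p_nonneg[OF s] by (intro mult_right_mono) auto
    then have "norm (a (fst (x, y)) * pp s (x, y) * b (snd (x, y))) \<le> M * \<bar>b y\<bar> * p s y x"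
      using p_nonneg[OF s, of y x] by (simp add: abs_mult p_sym[OF s, of x y] mult_ac)
    then show "ennreal (norm (a (fst (x, y)) * pp s (x, y) * b (snd (x, y)))) \<le> ennreal (M * \<bar>b y\<bar>) * ennreal (p s y x)"
      using M p_nonneg[OF s] by (simp add: ennreal_mult[symmetric] ennreal_leI)
  qed
  also have "\<dots> = (\<integral>\<^sup>+y. ennreal (M * \<bar>b y\<bar>) \<partial>\<mu>)"
  proof (intro nn_integral_cong)
    fix y
    have "(\<integral>\<^sup>+x. ennreal (M * \<bar>b y\<bar>) * ennreal (p s y x) \<partial>\<mu>) = ennreal (M * \<bar>b y\<bar>) * (\<integral>\<^sup>+x. ennreal (p s y x) \<partial>\<mu>)"
      using p_integrable[OF s, of y] by (intro nn_integral_cmult) auto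
    then show "(\<integral>\<^sup>+x. ennreal (M * \<bar>b y\<bar>) * ennreal (p s y x) \<partial>\<mu>) = ennreal (M * \<bar>b y\<bar>)"
      by (simp add: heat_nn_integral[OF s] heat_conservative[OF s])
  qed
  also have "\<dots> < \<infinity>"
    using integrable_mult_right[OF integrable_abs[OF b(2)], of M] M
    by (subst nn_integral_eq_integral) auto
  finally show "(\<integral>\<^sup>+z. ennreal (norm (a (fst z) * pp s z * b (snd z))) \<partial>M2) < \<infinity>" .
qed

lemma pair_swap_integrable:
  fixes F :: "'a \<times> 'a \<Rightarrow> real"
  assumes "integrable M2 F"
  shows "integrable M2 (\<lambda>z. F (snd z, fst z))"
  using pair.integrable_product_swap[OF assms] by (simp add: case_prod_beta')

lemma pair_swap_integral:
  fixes F :: "'a \<times> 'a \<Rightarrow> real"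
  assumes "integrable M2 F"
  shows "(\<integral>z. F (snd z, fst z) \<partial>M2) = (\<integral>z. F z \<partial>M2)"
  using pair.integral_product_swap[OF borel_measurable_integrable[OF assms]] by (simp add: case_prod_beta')

lemma kernel_pair_integrable':
  assumes s: "0 < s" and a: "a \<in> borel_measurable borel" "\<And>x. \<bar>a x\<bar> \<le> M"
    and b: "b \<in> borel_measurable borel" "integrable \<mu> b"
  shows "integrable M2 (\<lambda>z. b (fst z) * pp s z * a (snd z))"
  using pair_swap_integrable[OF kernel_pair_integrable[OF assms]]
  by (simp add: p_sym[OF s] mult_ac)

lemma heat_L1_integrable:
  assumes s: "0 < s" and b: "b \<in> borel_measurable borel" "integrable \<mu> b"
  shows "integrable \<mu> (P s b)"
  using pair.integrable_fst'[OF kernel_pair_integrable[OF s _ _ b, of "\<lambda>_. 1" 1]] by (simp add: heat_op_def[abs_def])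

lemma heat_duality:
  assumes s: "0 < s" and a: "a \<in> borel_measurable borel" "\<And>x. \<bar>a x\<bar> \<le> M"
    and b: "b \<in> borel_measurable borel" "integrable \<mu> b"
  shows "(\<integral>x. a x * P s b x \<partial>\<mu>) = (\<integral>x. P s a x * b x \<partial>\<mu>)"
proof -
  note int = kernel_pair_integrable[OF s a b]
  have "(\<integral>x. a x * P s b x \<partial>\<mu>) = (\<integral>x. \<integral>y. a (fst (x, y)) * pp s (x, y) * b (snd (x, y)) \<partial>\<mu> \<partial>\<mu>)"
    by (simp add: heat_op_def mult.assoc)
  also have "\<dots> = (\<integral>z. a (fst z) * pp s z * b (snd z) \<partial>M2)" by (rule pair.integral_fst'[OF int])
  also have "\<dots> = (\<integral>z. a (snd z) * p s (snd z) (fst z) * b (fst z) \<partial>M2)"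
    using pair_swap_integral[OF int] by simp
  also have "\<dots> = (\<integral>x. \<integral>y. a (snd (x, y)) * p s (snd (x, y)) (fst (x, y)) * b (fst (x, y)) \<partial>\<mu> \<partial>\<mu>)"
    using pair.integral_fst'[OF pair_swap_integrable[OF int]] by simp
  also have "\<dots> = (\<integral>x. P s a x * b x \<partial>\<mu>)"
    unfolding heat_op_def by (simp add: p_sym[OF s, of _ x for x] mult.commute)
  finally show ?thesis .
qed

text \<open>By conservativeness the left-hand side is the double integral of v(x) p_s(x,y) (h(y) -
  h(x)). Averaging it with its reflection, using the symmetry of p_s, replaces v(x) by half of v(x)
  - v(y), so that only increments of v matter.\<close>

lemma heat_increment_bound:
  assumes s: "0 < s" and v: "v \<in> borel_measurable borel" "\<And>x. \<bar>v x\<bar> \<le> M"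
    and h: "h \<in> borel_measurable borel" "\<And>x. \<bar>h x\<bar> \<le> M'" "integrable \<mu> h"
  shows "ennreal \<bar>\<integral>x. v x * (P s h x - h x) \<partial>\<mu>\<bar> \<le> osc (\<lambda>z. pp s z * \<bar>v (fst z) - v (snd z)\<bar>) h"
proof -
  have M: "0 \<le> M" using v(2)[of undefined] by (rule order_trans[rotated]) simp
  define F where "F z = v (fst z) * pp s z * (h (snd z) - h (fst z))" for z
  have vh: "integrable \<mu> (\<lambda>x. v x * h x)"
  proof (rule Bochner_Integration.integrable_bound)
    show "integrable \<mu> (\<lambda>x. M * h x)" using h by simp
    show "AE x in \<mu>. norm (v x * h x) \<le> norm (M * h x)"
      using v(2) M by (auto simp: abs_mult intro!: mult_right_mono)
  qed (use v h in simp)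
  have "integrable M2 (\<lambda>z. v (fst z) * pp s z * h (snd z) - (v (fst z) * h (fst z)) * pp s z * 1)"
    by (intro Bochner_Integration.integrable_diff kernel_pair_integrable[OF s v h(1,3)]
        kernel_pair_integrable'[OF s, of "\<lambda>_. 1" 1]) (use v h vh in auto)
  then have F: "integrable M2 F"
    by (rule Bochner_Integration.integrable_cong[THEN iffD1, rotated 2]) (auto simp: F_def algebra_simps)
  have "(\<integral>z. F z \<partial>M2) = (\<integral>x. \<integral>y. F (x, y) \<partial>\<mu> \<partial>\<mu>)" by (rule pair.integral_fst'[OF F, symmetric])
  also have "\<dots> = (\<integral>x. v x * (P s h x - h x) \<partial>\<mu>)"
  proof (intro Bochner_Integration.integral_cong refl)
    fix x
    have "(\<integral>y. F (x, y) \<partial>\<mu>) = (\<integral>y. v x * (p s x y * h y) - v x * h x * p s x y \<partial>\<mu>)"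
      by (intro Bochner_Integration.integral_cong) (auto simp: F_def algebra_simps)
    also have "\<dots> = (\<integral>y. v x * (p s x y * h y) \<partial>\<mu>) - (\<integral>y. v x * h x * p s x y \<partial>\<mu>)"
      by (intro Bochner_Integration.integral_diff integrable_mult_right p_integrable[OF s] p_integrable_mult[OF s h(1,2)])
    also have "\<dots> = v x * P s h x - v x * h x * P s (\<lambda>_. 1) x" by (simp add: heat_op_def)
    finally show "(\<integral>y. F (x, y) \<partial>\<mu>) = v x * (P s h x - h x)"
      by (simp add: heat_conservative[OF s] algebra_simps)
  qed
  finally have I: "(\<integral>z. F z \<partial>M2) = (\<integral>x. v x * (P s h x - h x) \<partial>\<mu>)" .
  have sw: "integrable M2 (\<lambda>z. F (snd z, fst z))" by (rule pair_swap_integrable[OF F])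
  have "2 * (\<integral>z. F z \<partial>M2) = (\<integral>z. F z + F (snd z, fst z) \<partial>M2)"
    using F sw pair_swap_integral[OF F] by simp
  then have "ennreal \<bar>2 * (\<integral>z. F z \<partial>M2)\<bar> \<le> (\<integral>\<^sup>+z. ennreal (norm (F z + F (snd z, fst z))) \<partial>M2)"
    using integral_norm_bound_ennreal[OF Bochner_Integration.integrable_add[OF F sw]] by simp
  also have "\<dots> = osc (\<lambda>z. pp s z * \<bar>v (fst z) - v (snd z)\<bar>) h"
    unfolding osc_def
  proof (intro nn_integral_cong)
    fix z :: "'a \<times> 'a"
    have "F z + F (snd z, fst z) = pp s z * ((v (fst z) - v (snd z)) * (h (snd z) - h (fst z)))"
      unfolding F_def using p_sym[OF s, of "snd z" "fst z"] by (simp add: algebra_simps)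
    then show "ennreal (norm (F z + F (snd z, fst z))) = ennreal (pp s z * \<bar>v (fst z) - v (snd z)\<bar>) * ennreal \<bar>h (fst z) - h (snd z)\<bar>"
      using p_nonneg[OF s] by (simp add: abs_mult ennreal_mult[symmetric] abs_minus_commute mult_ac)
  qed
  finally have "ennreal \<bar>2 * (\<integral>z. F z \<partial>M2)\<bar> \<le> osc (\<lambda>z. pp s z * \<bar>v (fst z) - v (snd z)\<bar>) h" .
  \<comment> \<open>The factor 1/2 gained by symmetrizing is given away.\<close>
  moreover have "ennreal \<bar>\<integral>z. F z \<partial>M2\<bar> \<le> ennreal \<bar>2 * (\<integral>z. F z \<partial>M2)\<bar>" by (intro ennreal_leI) simp
  ultimately show ?thesis unfolding I by (rule order_trans[rotated])
qed

section \<open>Oscillation functionals: telescoping and coarea\<close>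

lemma osc_mono:
  assumes "\<And>z. W z \<le> W' z"
  shows "osc W f \<le> osc W' f"
  unfolding osc_def by (intro nn_integral_mono mult_right_mono ennreal_leI assms) auto

lemma osc_measurable_integrand:
  assumes "W \<in> borel_measurable M2" "f \<in> borel_measurable borel"
  shows "(\<lambda>z. ennreal (W z) * ennreal \<bar>f (fst z) - f (snd z)\<bar>) \<in> borel_measurable M2"
  using assms by measurable

lemma osc_cmult:
  assumes "W \<in> borel_measurable M2" "f \<in> borel_measurable borel" "0 \<le> c" "\<And>z. 0 \<le> W z"
  shows "osc (\<lambda>z. c * W z) f = ennreal c * osc W f"
  unfolding osc_def using assms
  by (subst nn_integral_cmult[symmetric])
    (auto intro!: osc_measurable_integrand nn_integral_cong simp: ennreal_mult mult.assoc)

lemma osc_add: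
  assumes "W \<in> borel_measurable M2" "W' \<in> borel_measurable M2" "f \<in> borel_measurable borel"
    "\<And>z. 0 \<le> W z" "\<And>z. 0 \<le> W' z"
  shows "osc (\<lambda>z. W z + W' z) f = osc W f + osc W' f"
  unfolding osc_def using assms
  by (subst nn_integral_add[symmetric])
    (auto intro!: osc_measurable_integrand nn_integral_cong simp: distrib_right)

text \<open>With \<open>k = g (1 - 2h)\<close> the left-hand side is \<open>\<integral> k (P\<^sub>t h - h)\<close>. It is telescoped along the times
  \<open>j \<tau>\<close>, and in every increment but the first the semigroup is moved to \<open>k\<close>, where the Hoelder bound applies.\<close>

lemma osc_indicator_telescope:
  assumes E: "E \<in> sets borel" "emeasure \<mu> E < \<infinity>"
    and g: "g \<in> borel_measurable borel" "\<And>z. 0 \<le> g z" "\<And>z. g z \<le> M"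
    and G: "G \<in> borel_measurable borel" "\<And>z. 0 \<le> G z" and C: "0 \<le> C"
    and t: "0 < t" and n: "0 < n" and tau: "\<tau> = t / real n"
    and Hd: "\<And>s k x y. 0 < s \<Longrightarrow> s \<le> t \<Longrightarrow> k \<in> borel_measurable borel \<Longrightarrow> (\<And>z. \<bar>k z\<bar> \<le> g z) \<Longrightarrow>
      \<bar>P s k x - P s k y\<bar> \<le> C * (dist x y / sc s) powr \<kappa> * G x"
  shows "osc (\<lambda>z. g (fst z) * pp t z) (indicator E)
    \<le> ennreal M * osc (pp \<tau>) (indicator E)
      + ennreal (C * (\<Sum>j=1..<n. sc (real j * \<tau>) powr (- \<kappa>)))
        * osc (\<lambda>z. G (fst z) * pp \<tau> z * dd z powr \<kappa>) (indicator E)"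
proof -
  define h :: "'a \<Rightarrow> real" where "h = indicator E"
  have tp: "0 < \<tau>" using t n by (simp add: tau)
  have M: "0 \<le> M" using g(2,3) order_trans by blast
  have h: "h \<in> borel_measurable borel" "\<And>x. \<bar>h x\<bar> \<le> 1" "integrable \<mu> h"
  proof -
    show "h \<in> borel_measurable borel" using E by (simp add: h_def)
    show "\<bar>h x\<bar> \<le> 1" for x by (simp add: h_def indicator_def)
    show "integrable \<mu> h" using E unfolding h_def by (intro integrable_real_indicator) (auto simp: sets_mu)
  qed
  \<comment> \<open>The factor 1 - 2 h(x) is the sign of h(y) - h(x) whenever the latter is not 0,
    so the absolute value is traded for a factor depending on x only.\<close>
  define k where "k x = g x * (1 - 2 * h x)" for x
  have k: "k \<in> borel_measurable borel" "\<And>x. \<bar>k x\<bar> \<le> g x" "\<And>x. \<bar>k x\<bar> \<le> M"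
  proof -
    show "k \<in> borel_measurable borel" using g(1) h(1) by (simp add: k_def[abs_def])
    show 1: "\<bar>k x\<bar> \<le> g x" for x using g(2)[of x] by (auto simp: k_def h_def split: split_indicator)
    show "\<bar>k x\<bar> \<le> M" for x using 1 g(3) order_trans by blast
  qed
  have kint: "integrable \<mu> (\<lambda>x. k x * w x)" if "integrable \<mu> w" for w
  proof (rule Bochner_Integration.integrable_bound)
    show "integrable \<mu> (\<lambda>x. M * w x)" using that by simp
    show "AE x in \<mu>. norm (k x * w x) \<le> norm (M * w x)"
      using k(3) M by (auto simp: abs_mult intro!: mult_right_mono)
  qed (use k that in auto)
  have Dint: "integrable \<mu> (\<lambda>x. P s h x - h x)" if "0 < s" for s
    using heat_L1_integrable[OF that h(1,3)] h(3) by simp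
  have lhs: "osc (\<lambda>z. g (fst z) * pp t z) h = ennreal (\<integral>x. k x * (P t h x - h x) \<partial>\<mu>)"
  proof -
    have "osc (\<lambda>z. g (fst z) * pp t z) h
      = (\<integral>\<^sup>+x. \<integral>\<^sup>+y. ennreal (g (fst (x, y)) * pp t (x, y)) * ennreal \<bar>h (fst (x, y)) - h (snd (x, y))\<bar> \<partial>\<mu> \<partial>\<mu>)"
      unfolding osc_def
      by (rule nn_integral_fst[symmetric], rule osc_measurable_integrand) (use g(1) t h(1) in measurable)
    also have "\<dots> = (\<integral>\<^sup>+x. ennreal (k x * (P t h x - h x)) \<partial>\<mu>)"
    proof (intro nn_integral_cong)
      fix x
      have i: "integrable \<mu> (\<lambda>y. p t x y * \<bar>h x - h y\<bar>)"
        by (rule p_integrable_mult[OF t, of _ 1]) (use h(1) in \<open>auto simp: h_def split: split_indicator\<close>)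
      have "(\<integral>\<^sup>+y. ennreal (g (fst (x, y)) * pp t (x, y)) * ennreal \<bar>h (fst (x, y)) - h (snd (x, y))\<bar> \<partial>\<mu>)
        = (\<integral>\<^sup>+y. ennreal (g x * (p t x y * \<bar>h x - h y\<bar>)) \<partial>\<mu>)"
        using g(2) p_nonneg[OF t] by (intro nn_integral_cong) (simp add: ennreal_mult[symmetric] mult.assoc)
      also have "\<dots> = ennreal (g x * (\<integral>y. p t x y * \<bar>h x - h y\<bar> \<partial>\<mu>))"
        using i g(2) p_nonneg[OF t] by (subst nn_integral_eq_integral) auto
      also have "g x * (\<integral>y. p t x y * \<bar>h x - h y\<bar> \<partial>\<mu>) = k x * (P t h x - h x)"
      proof (cases "x \<in> E")
        case True
        then have "(\<integral>y. p t x y * \<bar>h x - h y\<bar> \<partial>\<mu>) = (\<integral>y. p t x y - p t x y * h y \<partial>\<mu>)"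
          by (intro Bochner_Integration.integral_cong) (auto simp: h_def split: split_indicator)
        also have "\<dots> = P t (\<lambda>_. 1) x - P t h x"
          using p_integrable[OF t] p_integrable_mult[OF t h(1,2)] by (simp add: heat_op_def)
        finally have "(\<integral>y. p t x y * \<bar>h x - h y\<bar> \<partial>\<mu>) = 1 - P t h x" by (simp only: heat_conservative[OF t])
        moreover have "h x = 1" "k x = - g x" using True by (simp_all add: k_def h_def)
        ultimately show ?thesis by (simp only:) (simp add: algebra_simps)
      next
        case False
        then have "(\<integral>y. p t x y * \<bar>h x - h y\<bar> \<partial>\<mu>) = (\<integral>y. p t x y * h y \<partial>\<mu>)"
          by (intro Bochner_Integration.integral_cong) (auto simp: h_def split: split_indicator)
        then show ?thesis using False by (simp add: k_def h_def heat_op_def)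
      qed
      finally show "(\<integral>\<^sup>+y. ennreal (g (fst (x, y)) * pp t (x, y)) * ennreal \<bar>h (fst (x, y)) - h (snd (x, y))\<bar> \<partial>\<mu>)
        = ennreal (k x * (P t h x - h x))" .
    qed
    also have "\<dots> = ennreal (\<integral>x. k x * (P t h x - h x) \<partial>\<mu>)"
    proof (rule nn_integral_eq_integral[OF kint[OF Dint[OF t]]], rule AE_I2)
      fix x
      have "0 \<le> P t h x" "P t h x \<le> 1"
      proof -
        show "0 \<le> P t h x" unfolding heat_op_def
          by (intro Bochner_Integration.integral_nonneg) (use p_nonneg[OF t] in \<open>auto simp: h_def\<close>)
        show "P t h x \<le> 1" using heat_abs_le_bound[OF t h(1,2), of x] by simp
      qed
      then show "0 \<le> k x * (P t h x - h x)" using g(2)[of x]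
        by (auto simp: k_def h_def mult_nonneg_nonpos split: split_indicator)
    qed
    finally show ?thesis .
  qed
  \<comment> \<open>The case j = 0 is separate because \<open>p\<close> is not specified at time
    0.\<close>
  define I where "I j = (\<integral>x. k x * (P (real (Suc j) * \<tau>) h x - (if j = 0 then h x else P (real j * \<tau>) h x)) \<partial>\<mu>)" for j
  have nt: "real n * \<tau> = t" using n by (simp add: tau)
  have "(\<integral>x. k x * (P t h x - h x) \<partial>\<mu>) = (\<Sum>j<n. I j)"
  proof -
    define Q where "Q j x = (if j = 0 then h x else P (real j * \<tau>) h x)" for j x
    have Qi: "integrable \<mu> (Q j)" for j
      using h(3) heat_L1_integrable[OF _ h(1,3), of "real j * \<tau>"] tp by (cases "j = 0") (auto simp: Q_def[abs_def])
    have "(\<Sum>j<n. I j) = (\<Sum>j<n. (\<integral>x. k x * Q (Suc j) x \<partial>\<mu>) - (\<integral>x. k x * Q j x \<partial>\<mu>))"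
    proof (intro sum.cong refl)
      fix j
      have "I j = (\<integral>x. k x * Q (Suc j) x - k x * Q j x \<partial>\<mu>)"
        unfolding I_def Q_def by (intro Bochner_Integration.integral_cong) (auto simp: algebra_simps)
      then show "I j = (\<integral>x. k x * Q (Suc j) x \<partial>\<mu>) - (\<integral>x. k x * Q j x \<partial>\<mu>)"
        using kint[OF Qi[of "Suc j"]] kint[OF Qi[of j]] by simp
    qed
    also have "\<dots> = (\<integral>x. k x * Q n x \<partial>\<mu>) - (\<integral>x. k x * Q 0 x \<partial>\<mu>)" by (rule sum_lessThan_telescope)
    also have "\<dots> = (\<integral>x. k x * (Q n x - Q 0 x) \<partial>\<mu>)"
      using kint[OF Qi[of n]] kint[OF Qi[of 0]] by (simp add: right_diff_distrib)
    finally show ?thesis using n nt by (simp add: Q_def)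
  qed
  also have "\<dots> = I 0 + (\<Sum>j=1..<n. I j)"
    using n by (simp add: lessThan_atLeast0 sum.atLeast_Suc_lessThan)
  finally have "ennreal (\<integral>x. k x * (P t h x - h x) \<partial>\<mu>) \<le> ennreal (\<bar>I 0\<bar> + (\<Sum>j=1..<n. \<bar>I j\<bar>))"
    by (intro ennreal_leI) (auto intro!: add_mono sum_mono)
  also have "\<dots> = ennreal \<bar>I 0\<bar> + (\<Sum>j=1..<n. ennreal \<bar>I j\<bar>)"
    by (simp add: ennreal_plus sum_nonneg)
  also have "\<dots> \<le> ennreal M * osc (pp \<tau>) h + (\<Sum>j=1..<n. ennreal (C * sc (real j * \<tau>) powr (- \<kappa>))
        * osc (\<lambda>z. G (fst z) * pp \<tau> z * dd z powr \<kappa>) h)"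
  proof (intro add_mono sum_mono)
    \<comment> \<open>No semigroup acts on k here, hence no increment of k is available; the term is
      bounded crudely by M times the energy at time \<tau>.\<close>
    have "ennreal \<bar>I 0\<bar> \<le> (\<integral>\<^sup>+x. ennreal (norm (k x * (P \<tau> h x - h x))) \<partial>\<mu>)"
      using integral_norm_bound_ennreal[OF kint[OF Dint[OF tp]]] by (simp add: I_def)
    also have "\<dots> \<le> (\<integral>\<^sup>+x. \<integral>\<^sup>+y. ennreal (M * pp \<tau> (x, y)) * ennreal \<bar>h (fst (x, y)) - h (snd (x, y))\<bar> \<partial>\<mu> \<partial>\<mu>)"
    proof (intro nn_integral_mono)
      fix x
      have i: "integrable \<mu> (\<lambda>y. p \<tau> x y * (h y - h x))"
        by (rule p_integrable_mult[OF tp, of _ 1]) (use h(1) in \<open>auto simp: h_def split: split_indicator\<close>)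
      have "P \<tau> h x - h x = (\<integral>y. p \<tau> x y * (h y - h x) \<partial>\<mu>)"
      proof -
        have "(\<integral>y. p \<tau> x y * (h y - h x) \<partial>\<mu>) = P \<tau> h x - h x * P \<tau> (\<lambda>_. 1) x"
          unfolding right_diff_distrib
          using p_integrable[OF tp] p_integrable_mult[OF tp h(1,2)] by (simp add: heat_op_def mult.commute)
        then show ?thesis by (simp add: heat_conservative[OF tp])
      qed
      then have "ennreal \<bar>P \<tau> h x - h x\<bar> \<le> (\<integral>\<^sup>+y. ennreal (norm (p \<tau> x y * (h y - h x))) \<partial>\<mu>)"
        using integral_norm_bound_ennreal[OF i] by simp
      then have "ennreal M * ennreal \<bar>P \<tau> h x - h x\<bar> \<le> ennreal M * (\<integral>\<^sup>+y. ennreal (norm (p \<tau> x y * (h y - h x))) \<partial>\<mu>)"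
        by (rule mult_left_mono) simp
      also have "\<dots> = (\<integral>\<^sup>+y. ennreal M * ennreal (norm (p \<tau> x y * (h y - h x))) \<partial>\<mu>)"
        using i by (intro nn_integral_cmult[symmetric]) auto
      also have "\<dots> = (\<integral>\<^sup>+y. ennreal (M * pp \<tau> (x, y)) * ennreal \<bar>h (fst (x, y)) - h (snd (x, y))\<bar> \<partial>\<mu>)"
        using M p_nonneg[OF tp] by (intro nn_integral_cong)
          (simp add: ennreal_mult abs_mult abs_minus_commute mult.assoc)
      finally have le: "ennreal M * ennreal \<bar>P \<tau> h x - h x\<bar> \<le> (\<integral>\<^sup>+y. ennreal (M * pp \<tau> (x, y)) * ennreal \<bar>h (fst (x, y)) - h (snd (x, y))\<bar> \<partial>\<mu>)" .
      have "ennreal (norm (k x * (P \<tau> h x - h x))) \<le> ennreal M * ennreal \<bar>P \<tau> h x - h x\<bar>"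
        using M k(3)[of x] by (simp add: ennreal_mult[symmetric] abs_mult mult_right_mono ennreal_leI)
      with le show "ennreal (norm (k x * (P \<tau> h x - h x))) \<le> (\<integral>\<^sup>+y. ennreal (M * pp \<tau> (x, y)) * ennreal \<bar>h (fst (x, y)) - h (snd (x, y))\<bar> \<partial>\<mu>)"
        by (rule order_trans[rotated])
    qed
    also have "\<dots> = osc (\<lambda>z. M * pp \<tau> z) h"
      unfolding osc_def
      by (rule nn_integral_fst, rule osc_measurable_integrand) (use tp h(1) in measurable)
    also have "\<dots> = ennreal M * osc (pp \<tau>) h"
      by (rule osc_cmult) (use tp h(1) M p_nonneg[OF tp] in auto)
    finally show "ennreal \<bar>I 0\<bar> \<le> ennreal M * osc (pp \<tau>) h" .
  next
    fix j assume "j \<in> {1..<n}"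
    then have j: "1 \<le> j" "j < n" by auto
    define s where "s = real j * \<tau>"
    have s: "0 < s" "s \<le> t" using j tp by (auto simp: s_def nt[symmetric] mult_right_mono)
    define v where "v = P s k"
    have v: "v \<in> borel_measurable borel" "\<And>x. \<bar>v x\<bar> \<le> M"
      unfolding v_def using heat_measurable[OF s(1) k(1,3)] heat_abs_le_bound[OF s(1) k(1,3)] by auto
    define w where "w x = P \<tau> h x - h x" for x
    have Ph: "P \<tau> h \<in> borel_measurable borel" "\<And>x. \<bar>P \<tau> h x\<bar> \<le> 1"
      using heat_measurable[OF tp h(1,2)] heat_abs_le_bound[OF tp h(1,2)] by auto
    have w: "w \<in> borel_measurable borel" "integrable \<mu> w"
      unfolding w_def[abs_def] using Ph h Dint[OF tp] by auto
    \<comment> \<open>The semigroup law isolates one short step \<open>w\<close> behind P_s, which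
      duality then moves to k.\<close>
    have "P (real (Suc j) * \<tau>) h x - P s h x = P s w x" for x
    proof -
      have "real (Suc j) * \<tau> = s + \<tau>" by (simp add: s_def algebra_simps)
      then have "P (real (Suc j) * \<tau>) h x = P s (P \<tau> h) x"
        using heat_semigroup_bounded[OF s(1) tp h(1,2)] by simp
      moreover have "P s w x = P s (P \<tau> h) x - P s h x"
        unfolding heat_op_def[of _ _ s] w_def right_diff_distrib
        using p_integrable_mult[OF s(1) Ph] p_integrable_mult[OF s(1) h(1,2)] by simp
      ultimately show ?thesis by simp
    qed
    then have "I j = (\<integral>x. k x * P s w x \<partial>\<mu>)" using j by (simp add: I_def s_def)
    also have "\<dots> = (\<integral>x. v x * w x \<partial>\<mu>)" unfolding v_def by (rule heat_duality[OF s(1) k(1,3) w])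
    finally have "ennreal \<bar>I j\<bar> \<le> osc (\<lambda>z. pp \<tau> z * \<bar>v (fst z) - v (snd z)\<bar>) h"
      unfolding w_def using heat_increment_bound[OF tp v h] by simp
    also have "\<dots> \<le> osc (\<lambda>z. (C * sc s powr (- \<kappa>)) * (G (fst z) * pp \<tau> z * dd z powr \<kappa>)) h"
    proof (rule osc_mono)
      fix z :: "'a \<times> 'a"
      have "\<bar>v (fst z) - v (snd z)\<bar> \<le> C * (dd z / sc s) powr \<kappa> * G (fst z)"
        unfolding v_def by (rule Hd[OF s k(1,2)])
      also have "(dd z / sc s) powr \<kappa> = dd z powr \<kappa> * sc s powr (- \<kappa>)"
        using sc_pos[OF s(1)] by (simp add: powr_divide powr_minus_divide)
      finally have "pp \<tau> z * \<bar>v (fst z) - v (snd z)\<bar> \<le> pp \<tau> z * (C * (dd z powr \<kappa> * sc s powr (- \<kappa>)) * G (fst z))"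
        by (intro mult_left_mono p_nonneg tp)
      then show "pp \<tau> z * \<bar>v (fst z) - v (snd z)\<bar> \<le> (C * sc s powr (- \<kappa>)) * (G (fst z) * pp \<tau> z * dd z powr \<kappa>)"
        by (simp add: mult_ac)
    qed
    also have "\<dots> = ennreal (C * sc s powr (- \<kappa>)) * osc (\<lambda>z. G (fst z) * pp \<tau> z * dd z powr \<kappa>) h"
      by (rule osc_cmult) (use tp h(1) G C p_nonneg[OF tp] in auto)
    finally show "ennreal \<bar>I j\<bar> \<le> ennreal (C * sc (real j * \<tau>) powr (- \<kappa>)) * osc (\<lambda>z. G (fst z) * pp \<tau> z * dd z powr \<kappa>) h"
      by (simp add: s_def)
  qed
  also have "(\<Sum>j=1..<n. ennreal (C * sc (real j * \<tau>) powr (- \<kappa>)) * osc (\<lambda>z. G (fst z) * pp \<tau> z * dd z powr \<kappa>) h)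
     = ennreal (C * (\<Sum>j=1..<n. sc (real j * \<tau>) powr (- \<kappa>))) * osc (\<lambda>z. G (fst z) * pp \<tau> z * dd z powr \<kappa>) h"
    using C by (simp add: sum_distrib_right[symmetric] sum_distrib_left sum_ennreal)
  finally show ?thesis unfolding lhs[symmetric] by (simp add: h_def)
qed

text \<open>|a - b| is the length of the set of levels s in [min a b, max a b), which are those with
  exactly one of s < a and s < b; Tonelli exchanges levels and pairs. Measurability in the level is
  recorded because inequalities between level energies are added and integrated later.\<close>

lemma osc_coarea:
  assumes W: "W \<in> borel_measurable M2" and f: "f \<in> borel_measurable borel"
  shows "osc W f = (\<integral>\<^sup>+s. osc W (indicator {x. s < f x}) \<partial>lborel)"
    and "(\<lambda>s. osc W (indicator {x. s < f x})) \<in> borel_measurable lborel"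
proof -
  have sf: "sigma_finite_measure M2" by (intro sigma_finite_pair_measure sigma_finite_measure_axioms)
  interpret L: pair_sigma_finite "lborel :: real measure" M2
    by (intro pair_sigma_finite.intro lborel.sigma_finite_measure_axioms sigma_finite_pair_measure
        sigma_finite_measure_axioms)
  define ch :: "real \<Rightarrow> 'a \<times> 'a \<Rightarrow> real" where
    "ch s z = \<bar>indicator {x. s < f x} (fst z) - indicator {x. s < f x} (snd z)\<bar>" for s z
  have chi: "ch s z = (if (s < f (fst z)) = (s < f (snd z)) then 0 else 1)" for s z
    by (auto simp: ch_def indicator_def)
  have meas: "(\<lambda>z. ennreal (W (snd z)) * ennreal (ch (fst z) (snd z))) \<in> borel_measurable (lborel \<Otimes>\<^sub>M M2)"
    unfolding chi using W f by measurable
  have len: "ennreal \<bar>a - b\<bar> = (\<integral>\<^sup>+s. ennreal (if (s < a) = (s < b) then 0 else 1) \<partial>lborel)" for a b :: real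
  proof -
    have "(\<integral>\<^sup>+s. ennreal (if (s < a) = (s < b) then 0 else 1) \<partial>lborel)
      = (\<integral>\<^sup>+s. indicator {min a b..<max a b} s \<partial>lborel)"
      by (intro nn_integral_cong) (auto simp: indicator_def min_def max_def)
    also have "\<dots> = ennreal (max a b - min a b)" by (simp add: emeasure_lborel_Ico)
    finally show ?thesis by (simp add: max_def min_def abs_if split: if_splits)
  qed
  have "osc W f = (\<integral>\<^sup>+z. \<integral>\<^sup>+s. ennreal (W z) * ennreal (ch s z) \<partial>lborel \<partial>M2)"
    unfolding osc_def
  proof (intro nn_integral_cong)
    fix z :: "'a \<times> 'a"
    have "(\<lambda>s. ennreal (ch s z)) \<in> borel_measurable lborel" unfolding chi by measurable
    then have "(\<integral>\<^sup>+s. ennreal (W z) * ennreal (ch s z) \<partial>lborel) = ennreal (W z) * (\<integral>\<^sup>+s. ennreal (ch s z) \<partial>lborel)"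
      by (rule nn_integral_cmult)
    then show "ennreal (W z) * ennreal \<bar>f (fst z) - f (snd z)\<bar> = (\<integral>\<^sup>+s. ennreal (W z) * ennreal (ch s z) \<partial>lborel)"
      unfolding chi len by simp
  qed
  also have "\<dots> = (\<integral>\<^sup>+s. \<integral>\<^sup>+z. ennreal (W z) * ennreal (ch s z) \<partial>M2 \<partial>lborel)"
    using L.Fubini[OF meas] by simp
  finally show "osc W f = (\<integral>\<^sup>+s. osc W (indicator {x. s < f x}) \<partial>lborel)"
    unfolding osc_def ch_def .
  have "(\<lambda>s. \<integral>\<^sup>+z. ennreal (W (snd (s, z))) * ennreal (ch (fst (s, z)) (snd (s, z))) \<partial>M2) \<in> borel_measurable lborel"
    by (rule sigma_finite_measure.borel_measurable_nn_integral_fst[OF sf meas])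
  then show "(\<lambda>s. osc W (indicator {x. s < f x})) \<in> borel_measurable lborel"
    unfolding osc_def ch_def by simp
qed

end

section \<open>Comparison of energies\<close>


text \<open>Taking r with m(r) close to the liminf and s so small that N(s) is at most limsup N plus
  a small error gives L \<le> a l + L/2 up to errors, where L is the limsup of N and l the liminf of
  m. Subtracting L/2 requires L finite, which is the purpose of the bound \<open>KN\<close>. The
  threshold for r may depend on t, and s on both.\<close>

lemma Limsup_absorb:
  fixes N m :: "real \<Rightarrow> real"
  assumes N: "\<And>t. 0 < t \<Longrightarrow> 0 \<le> N t" "\<And>t. 0 < t \<Longrightarrow> N t \<le> KN"
    and m: "\<And>r. 0 < r \<Longrightarrow> 0 \<le> m r" "\<And>r. 0 < r \<Longrightarrow> m r \<le> Km" and a: "0 \<le> a"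
    and H: "\<And>e. 0 < e \<Longrightarrow> \<exists>t0>0. \<forall>t. 0 < t \<longrightarrow> t < t0 \<longrightarrow>
      (\<exists>r0>0. \<forall>r. 0 < r \<longrightarrow> r < r0 \<longrightarrow> (\<exists>s. 0 < s \<and> s < e \<and> N t \<le> e + a * m r + N s / 2))"
  shows "Limsup (at_right 0) (\<lambda>t. ennreal (N t)) \<le> ennreal (2 * a) * Liminf (at_right 0) (\<lambda>r. ennreal (m r))"
proof -
  define L where "L = Limsup (at_right 0) (\<lambda>t. ennreal (N t))"
  define l where "l = Liminf (at_right 0) (\<lambda>r. ennreal (m r))"
  have ev: "\<forall>\<^sub>F t in at_right (0::real). 0 < t" by (simp add: eventually_at_right_less)
  have "L \<le> ennreal KN" unfolding L_def
    by (rule Limsup_bounded) (use ev in \<open>eventually_elim, auto intro: ennreal_leI N\<close>)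
  then obtain Lr where Lr: "L = ennreal Lr" "0 \<le> Lr" by (cases L) (auto simp: top_unique)
  have "l \<le> ennreal Km" unfolding l_def
  proof (rule order_trans[OF Liminf_le_Limsup])
    show "Limsup (at_right 0) (\<lambda>r. ennreal (m r)) \<le> ennreal Km"
      by (rule Limsup_bounded) (use ev in \<open>eventually_elim, auto intro: ennreal_leI m\<close>)
  qed simp
  then obtain lr where lr: "l = ennreal lr" "0 \<le> lr" by (cases l) (auto simp: top_unique)
  have "Lr \<le> 2 * a * lr + c" if c: "0 < c" for c
  proof -
    \<comment> \<open>After L/2 has been absorbed the accumulated error is (3 + 2a) e, which is
      below c.\<close>
    define e where "e = c / (5 + 2 * a)"
    have e: "0 < e" using c a by (simp add: e_def)
    have "L < ennreal (Lr + e)" unfolding Lr(1) using Lr(2) e by (intro ennreal_lessI) auto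
    then have "\<forall>\<^sub>F t in at_right 0. ennreal (N t) < ennreal (Lr + e)" unfolding L_def by (rule Limsup_lessD)
    then obtain s0 where s0: "0 < s0" "\<And>s. 0 < s \<Longrightarrow> s < s0 \<Longrightarrow> ennreal (N s) < ennreal (Lr + e)"
      unfolding eventually_at_right_field by auto
    have s0': "N s \<le> Lr + e" if "0 < s" "s < s0" for s
      using s0(2)[OF that] unfolding ennreal_less_iff[OF N(1)[OF that(1)]] by simp
    \<comment> \<open>The hypothesis is invoked with an e' not above s0, so that the time s it
      returns lies where N is already close to its limsup.\<close>
    define e' where "e' = min e s0"
    have e': "0 < e'" "e' \<le> e" "e' \<le> s0" using e s0 by (auto simp: e'_def)
    obtain t0 where t0: "0 < t0" and T: "\<And>t. 0 < t \<Longrightarrow> t < t0 \<Longrightarrow>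
      \<exists>r0>0. \<forall>r. 0 < r \<longrightarrow> r < r0 \<longrightarrow> (\<exists>s. 0 < s \<and> s < e' \<and> N t \<le> e' + a * m r + N s / 2)"
      using H[OF e'(1)] by blast
    have bound: "N t \<le> e + a * (lr + e) + (Lr + e) / 2" if t: "0 < t" "t < t0" for t
    proof -
      obtain r0 where r0: "0 < r0" and R: "\<And>r. 0 < r \<Longrightarrow> r < r0 \<Longrightarrow> \<exists>s. 0 < s \<and> s < e' \<and> N t \<le> e' + a * m r + N s / 2"
        using T[OF t] by blast
      have "\<exists>r. 0 < r \<and> r < r0 \<and> m r \<le> lr + e"
      proof (rule ccontr)
        assume "\<not> ?thesis"
        then have "\<And>r. 0 < r \<Longrightarrow> r < r0 \<Longrightarrow> lr + e \<le> m r" by (meson le_cases)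
        then have "\<forall>\<^sub>F r in at_right 0. ennreal (lr + e) \<le> ennreal (m r)"
          unfolding eventually_at_right_field using r0 by (auto intro!: exI[of _ r0] ennreal_leI)
        then have "ennreal (lr + e) \<le> l" unfolding l_def by (rule Liminf_bounded)
        then show False using lr e by simp
      qed
      then obtain r where r: "0 < r" "r < r0" "m r \<le> lr + e" by blast
      obtain s where s: "0 < s" "s < e'" "N t \<le> e' + a * m r + N s / 2" using R[OF r(1,2)] by blast
      have am: "a * m r \<le> a * (lr + e)" using r(3) a by (rule mult_left_mono)
      have half: "N s / 2 \<le> (Lr + e) / 2" using s0'[OF s(1) less_le_trans[OF s(2) e'(3)]] by simp
      show ?thesis by (rule order_trans[OF s(3) add_mono[OF add_mono[OF e'(2) am] half]])
    qed
    have "L \<le> ennreal (e + a * (lr + e) + (Lr + e) / 2)" unfolding L_def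
      by (rule Limsup_bounded) (auto simp: eventually_at_right_field intro!: exI[of _ t0] t0 ennreal_leI bound)
    then have "Lr \<le> e + a * (lr + e) + (Lr + e) / 2"
      unfolding Lr(1) using Lr(2) lr(2) e a by (subst (asm) ennreal_le_iff) auto
    moreover define hf where "hf = (Lr + e) / 2"
    moreover have "2 * hf = Lr + e" by (simp add: hf_def)
    moreover have "2 * a * lr + (3 + 2 * a) * e = 2 * (a * (lr + e)) + 3 * e" by (simp add: algebra_simps)
    ultimately have "Lr \<le> 2 * a * lr + (3 + 2 * a) * e" by linarith
    also have "(3 + 2 * a) * e \<le> (5 + 2 * a) * e" using e by (intro mult_right_mono) auto
    also have "(5 + 2 * a) * e = c" using a by (simp add: e_def)
    finally show ?thesis by simp
  qed
  then have "Lr \<le> 2 * a * lr" by (rule field_le_epsilon)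
  then have "ennreal Lr \<le> ennreal (2 * a) * ennreal lr" using a lr(2) by (simp add: ennreal_mult[symmetric] ennreal_leI)
  then show ?thesis unfolding Lr(1)[symmetric] lr(1)[symmetric] L_def l_def .
qed

context heat_kernel_wBE
begin

section \<open>Energies of f and the inequalities between them\<close>

definition lam :: real where "lam = dW - \<kappa>"

definition heat_en :: "('a \<Rightarrow> real) \<Rightarrow> real \<Rightarrow> ('a \<Rightarrow> real) \<Rightarrow> ennreal" where
  "heat_en g t f = osc (\<lambda>z. g (fst z) * pp t z) f"

text \<open>The intermediate energy produced by telescoping; the factor dist^\<kappa> is the Hoelder
  increment of the smoothed test function.\<close>

definition phi_en :: "('a \<Rightarrow> real) \<Rightarrow> real \<Rightarrow> ('a \<Rightarrow> real) \<Rightarrow> ennreal" where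
  "phi_en g t f = osc (\<lambda>z. g (fst z) * pp t z * dd z powr \<kappa>) f"

definition ball_en :: "('a \<Rightarrow> real) \<Rightarrow> real \<Rightarrow> ('a \<Rightarrow> real) \<Rightarrow> ennreal" where
  "ball_en g r f = osc (\<lambda>z. g (fst z) * indicator {..<r} (dd z)) f"

lemma lam_pos: "0 < lam" using kappa_less by (simp add: lam_def)

lemma indicator_dd_measurable [measurable]: "(\<lambda>z. indicator {..<r} (dd z) :: real) \<in> borel_measurable M2"
  by measurable

lemma integrable_borel: "integrable \<mu> f \<Longrightarrow> f \<in> borel_measurable borel" for f :: "'a \<Rightarrow> real"
  using borel_measurable_integrable[of \<mu> f] measurable_cong_sets[OF sets_mu refl] by blast

lemma superlevel_sets:
  fixes f :: "'a \<Rightarrow> real"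
  assumes "f \<in> borel_measurable borel" shows "{x. s < f x} \<in> sets borel"
  using borel_measurable_iff_greater[of f borel] assms by simp

lemma superlevel_finite:
  fixes f :: "'a \<Rightarrow> real"
  assumes f: "integrable \<mu> f" and s: "0 < s"
  shows "emeasure \<mu> {x. s < f x} < \<infinity>"
proof -
  have fm: "f \<in> borel_measurable borel" by (rule integrable_borel[OF f])
  have E: "{x. s < f x} \<in> sets \<mu>" unfolding sets_mu by (rule superlevel_sets[OF fm])
  have "ennreal s * emeasure \<mu> {x. s < f x} = (\<integral>\<^sup>+x. ennreal s * indicator {x. s < f x} x \<partial>\<mu>)"
    using E by (simp add: nn_integral_cmult_indicator)
  also have "\<dots> \<le> (\<integral>\<^sup>+x. ennreal (norm (f x)) \<partial>\<mu>)"
    using s by (intro nn_integral_mono) (auto simp: indicator_def intro!: ennreal_leI)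
  also have "\<dots> < \<infinity>" using f by (simp add: integrable_iff_bounded)
  finally have "ennreal s * emeasure \<mu> {x. s < f x} < \<top>" by simp
  then show ?thesis using s by (auto simp: ennreal_mult_less_top)
qed

lemma osc_indicator_Compl: "osc W (indicator (- E)) = osc W (indicator E)"
  unfolding osc_def by (intro nn_integral_cong) (auto simp: indicator_def)

text \<open>Superlevel sets of an integrable f have finite measure at positive levels. At negative
  levels their complements do, and a set and its complement have the same oscillation. The level 0
  is negligible for Lebesgue measure.\<close>

lemma osc_coarea_le:
  assumes f: "integrable \<mu> f"
    and W: "W \<in> borel_measurable M2" "W1 \<in> borel_measurable M2" "W2 \<in> borel_measurable M2"
    and le: "\<And>E. E \<in> sets borel \<Longrightarrow> emeasure \<mu> E < \<infinity> \<Longrightarrow>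
      osc W (indicator E) \<le> a * osc W1 (indicator E) + b * osc W2 (indicator E)"
  shows "osc W f \<le> a * osc W1 f + b * osc W2 f"
proof -
  have fm: "f \<in> borel_measurable borel" by (rule integrable_borel[OF f])
  have sets: "{x. s < f x} \<in> sets borel" for s by (rule superlevel_sets[OF fm])
  have step: "osc W (indicator {x. s < f x}) \<le> a * osc W1 (indicator {x. s < f x}) + b * osc W2 (indicator {x. s < f x})"
    if "s \<noteq> 0" for s
  proof (cases "0 < s")
    case True
    then show ?thesis by (intro le sets superlevel_finite f)
  next
    case False
    \<comment> \<open>Halving the level turns the weak inequality f \<le> s into a strict one, so
      that the complement lies in a superlevel set of -f at a positive level.\<close>
    then have s: "0 < - s / 2" using that by simp
    have "emeasure \<mu> (- {x. s < f x}) \<le> emeasure \<mu> {x. - s / 2 < - f x}"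
    proof (rule emeasure_mono)
      show "- {x. s < f x} \<subseteq> {x. - s / 2 < - f x}" using False that by auto
      have "(\<lambda>x. - f x) \<in> borel_measurable borel" using fm by simp
      then show "{x. - s / 2 < - f x} \<in> sets \<mu>" unfolding sets_mu by (rule superlevel_sets)
    qed
    also have "\<dots> < \<infinity>" by (rule superlevel_finite[OF _ s]) (use f in simp)
    finally have "osc W (indicator (- {x. s < f x})) \<le> a * osc W1 (indicator (- {x. s < f x})) + b * osc W2 (indicator (- {x. s < f x}))"
      using sets[of s] by (intro le) auto
    then show ?thesis by (simp only: osc_indicator_Compl)
  qed
  have "osc W f = (\<integral>\<^sup>+s. osc W (indicator {x. s < f x}) \<partial>lborel)" by (rule osc_coarea[OF W(1) fm])
  also have "\<dots> \<le> (\<integral>\<^sup>+s. a * osc W1 (indicator {x. s < f x}) + b * osc W2 (indicator {x. s < f x}) \<partial>lborel)"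
  proof (rule nn_integral_mono_AE)
    show "AE s in lborel. osc W (indicator {x. s < f x}) \<le> a * osc W1 (indicator {x. s < f x}) + b * osc W2 (indicator {x. s < f x})"
      using AE_lborel_singleton[of "0::real"] by eventually_elim (rule step)
  qed
  also have "\<dots> = a * osc W1 f + b * osc W2 f"
    unfolding osc_coarea(1)[OF W(2) fm] osc_coarea(1)[OF W(3) fm]
    using osc_coarea(2)[OF W(2) fm] osc_coarea(2)[OF W(3) fm]
    by (subst nn_integral_add) (auto simp: nn_integral_cmult)
  finally show ?thesis .
qed

text \<open>The telescoped bound for indicators is transferred to f by coarea, with the times (j
  \<tau>)^(-\<kappa>/dW) summed. The constant is free of g, \<open>M\<close>, \<delta>, \<omega> and
  n, which leaves the number of steps available as a parameter.\<close>

lemma heat_en_le: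
  "\<exists>C>0. \<forall>t>0. \<forall>n>0. \<forall>\<delta>>0. \<forall>M \<omega> g f. g \<in> borel_measurable borel \<longrightarrow> (\<forall>z. 0 \<le> g z \<and> g z \<le> M) \<longrightarrow>
    (\<forall>x z. dist x z < \<delta> \<longrightarrow> \<bar>g z - g x\<bar> \<le> \<omega>) \<longrightarrow> integrable \<mu> f \<longrightarrow>
    heat_en g t f \<le> ennreal M * heat_en (\<lambda>_. 1) (t / real n) f
      + ennreal (C * t powr (lam / dW) / (t / real n)) * phi_en (\<lambda>x. g x + (\<omega> + M * (sc t / \<delta>) powr \<kappa>)) (t / real n) f"
proof -
  obtain C0 where C0: "0 < C0" and loc0: "\<forall>s>0. \<forall>\<delta>>0. \<forall>M \<omega> g k x y. g \<in> borel_measurable borel \<longrightarrow> k \<in> borel_measurable borel \<longrightarrow>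
    (\<forall>z. \<bar>k z\<bar> \<le> g z \<and> g z \<le> M) \<longrightarrow> (\<forall>z. dist x z < \<delta> \<longrightarrow> \<bar>g z - g x\<bar> \<le> \<omega>) \<longrightarrow>
    \<bar>P s k x - P s k y\<bar> \<le> C0 * (dist x y / sc s) powr \<kappa> * (g x + \<omega> + M * (sc s / \<delta>) powr \<kappa>)"
    using heat_Hoelder_local by (elim exE conjE) (rule that; assumption)
  define C where "C = C0 * (dW / lam)"
  have C: "0 < C" using C0 lam_pos dW_pos by (simp add: C_def)
  have main: "heat_en g t f \<le> ennreal M * heat_en (\<lambda>_. 1) (t / real n) f
      + ennreal (C * t powr (lam / dW) / (t / real n)) * phi_en (\<lambda>x. g x + (\<omega> + M * (sc t / \<delta>) powr \<kappa>)) (t / real n) f"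
    if t: "0 < t" and n: "0 < n" and d: "0 < \<delta>" and g: "g \<in> borel_measurable borel" "\<And>z. 0 \<le> g z" "\<And>z. g z \<le> M"
      and om: "\<And>x z. dist x z < \<delta> \<Longrightarrow> \<bar>g z - g x\<bar> \<le> \<omega>" and f: "integrable \<mu> f"
    for t n \<delta> M \<omega> g f
  proof -
    define \<tau> where "\<tau> = t / real n"
    have tp: "0 < \<tau>" using t n by (simp add: \<tau>_def)
    \<comment> \<open>Majorizes the localized bound at all times s \<le> t simultaneously, because
      the tail term increases with s.\<close>
    define G where "G x = g x + (\<omega> + M * (sc t / \<delta>) powr \<kappa>)" for x
    have M: "0 \<le> M" using g order_trans by blast
    have om0: "0 \<le> \<omega>" using om[of undefined undefined] d by simp
    have G: "G \<in> borel_measurable borel" "\<And>z. 0 \<le> G z"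
      using g M om0 unfolding G_def[abs_def] by auto
    have S: "(\<Sum>j=1..<n. sc (real j * \<tau>) powr (- \<kappa>)) \<le> dW / lam * t powr (lam / dW) / \<tau>"
    proof -
      define a where "a = \<kappa> / dW"
      have a: "0 < a" "a < 1" using kappa_pos kappa_less dW_pos by (auto simp: a_def)
      have la: "lam / dW = 1 - a" using dW_pos by (simp add: lam_def a_def diff_divide_distrib)
      have "(\<Sum>j=1..<n. sc (real j * \<tau>) powr (- \<kappa>)) = (\<Sum>j=1..<n. \<tau> powr (- a) * real j powr (- a))"
        using tp by (intro sum.cong) (auto simp: sc_powr a_def powr_mult)
      also have "\<dots> = \<tau> powr (- a) * (\<Sum>j=1..<n. real j powr (- a))" by (simp add: sum_distrib_left)
      also have "\<dots> \<le> \<tau> powr (- a) * (\<Sum>j=1..n. real j powr (- a))"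
        by (intro mult_left_mono sum_mono2) auto
      also have "\<dots> \<le> \<tau> powr (- a) * (real n powr (1 - a) / (1 - a))"
        by (intro mult_left_mono sum_powr_le a) auto
      also have "\<dots> = \<tau> powr (- a) * real n powr (1 - a) / (lam / dW)" by (simp add: la)
      also have "\<tau> powr (- a) * real n powr (1 - a) = t powr (1 - a) / \<tau>"
      proof -
        have "t = \<tau> * real n" using n by (simp add: \<tau>_def)
        then have "t powr (1 - a) = \<tau> powr (1 - a) * real n powr (1 - a)" using tp by (simp add: powr_mult)
        also have "\<tau> powr (1 - a) = \<tau> * \<tau> powr (- a)" using tp by (simp add: powr_diff powr_minus divide_inverse)
        finally show ?thesis using tp by simp
      qed
      finally show ?thesis unfolding la[symmetric] using dW_pos lam_pos tp by (simp add: field_simps)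
    qed
    have "osc (\<lambda>z. g (fst z) * pp t z) f \<le> ennreal M * osc (pp \<tau>) f
      + ennreal (C * t powr (lam / dW) / \<tau>) * osc (\<lambda>z. G (fst z) * pp \<tau> z * dd z powr \<kappa>) f"
    proof (rule osc_coarea_le[OF f])
      fix E :: "'a set" assume E: "E \<in> sets borel" "emeasure \<mu> E < \<infinity>"
      have "osc (\<lambda>z. g (fst z) * pp t z) (indicator E)
        \<le> ennreal M * osc (pp \<tau>) (indicator E)
        + ennreal (C0 * (\<Sum>j=1..<n. sc (real j * \<tau>) powr (- \<kappa>)))
          * osc (\<lambda>z. G (fst z) * pp \<tau> z * dd z powr \<kappa>) (indicator E)"
      proof (rule osc_indicator_telescope[OF E g G _ t n \<tau>_def])
        show "0 \<le> C0" using C0 by simp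
        fix s k x y assume s: "0 < s" "s \<le> t" and k: "k \<in> borel_measurable borel" "\<And>z. \<bar>k z\<bar> \<le> g z"
        have "\<bar>P s k x - P s k y\<bar> \<le> C0 * (dist x y / sc s) powr \<kappa> * (g x + \<omega> + M * (sc s / \<delta>) powr \<kappa>)"
          using loc0[rule_format, OF s(1) d g(1) k(1), of M x \<omega> y] k(2) g(3) om by blast
        also have "\<dots> \<le> C0 * (dist x y / sc s) powr \<kappa> * G x"
        proof (rule mult_left_mono)
          have "(sc s / \<delta>) powr \<kappa> \<le> (sc t / \<delta>) powr \<kappa>"
            using sc_mono[OF s] sc_pos[OF s(1)] d kappa_pos by (intro powr_mono2 divide_right_mono) auto
          then have "M * (sc s / \<delta>) powr \<kappa> \<le> M * (sc t / \<delta>) powr \<kappa>" using M by (rule mult_left_mono)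
          then show "g x + \<omega> + M * (sc s / \<delta>) powr \<kappa> \<le> G x" by (simp add: G_def)
        qed (use C0 in simp)
        finally show "\<bar>P s k x - P s k y\<bar> \<le> C0 * (dist x y / sc s) powr \<kappa> * G x" .
      qed
      also have "\<dots> \<le> ennreal M * osc (pp \<tau>) (indicator E)
        + ennreal (C * t powr (lam / dW) / \<tau>) * osc (\<lambda>z. G (fst z) * pp \<tau> z * dd z powr \<kappa>) (indicator E)"
      proof (intro add_left_mono mult_right_mono ennreal_leI)
        show "C0 * (\<Sum>j=1..<n. sc (real j * \<tau>) powr (- \<kappa>)) \<le> C * t powr (lam / dW) / \<tau>"
          using mult_left_mono[OF S, of C0] C0 by (simp add: C_def mult.assoc)
      qed simp
      finally show "osc (\<lambda>z. g (fst z) * pp t z) (indicator E) \<le> ennreal M * osc (pp \<tau>) (indicator E)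
        + ennreal (C * t powr (lam / dW) / \<tau>) * osc (\<lambda>z. G (fst z) * pp \<tau> z * dd z powr \<kappa>) (indicator E)" .
    qed (use g(1) G(1) t tp in measurable)
    then show ?thesis by (simp add: heat_en_def phi_en_def G_def \<tau>_def)
  qed
  show ?thesis
  proof (intro exI[of _ C] conjI allI impI C)
    fix t \<delta> M \<omega> :: real and n :: nat and g f :: "'a \<Rightarrow> real"
    assume "0 < t" "0 < n" "0 < \<delta>" "g \<in> borel_measurable borel" "\<forall>z. 0 \<le> g z \<and> g z \<le> M"
      "\<forall>x z. dist x z < \<delta> \<longrightarrow> \<bar>g z - g x\<bar> \<le> \<omega>" "integrable \<mu> f"
    then show "heat_en g t f \<le> ennreal M * heat_en (\<lambda>_. 1) (t / real n) f
      + ennreal (C * t powr (lam / dW) / (t / real n)) * phi_en (\<lambda>x. g x + (\<omega> + M * (sc t / \<delta>) powr \<kappa>)) (t / real n) f"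
      by (intro main) auto
  qed
qed

text \<open>Dyadic domination with a = \<open>lam + dH\<close> cancels the growth of the ball
  energies at radius 2^k sc t. Since these radii are unbounded, the ball bound is assumed for all r
  and not only for small ones.\<close>

lemma heat_en_bounded:
  "\<exists>C>0. \<forall>K\<ge>0. \<forall>f. f \<in> borel_measurable borel \<longrightarrow>
    (\<forall>r>0. ball_en (\<lambda>_. 1) r f \<le> ennreal (K * r powr (lam + dH))) \<longrightarrow>
    (\<forall>t>0. heat_en (\<lambda>_. 1) t f \<le> ennreal (C * K * t powr (lam / dW)))"
proof -
  define a where "a = lam + dH"
  have "0 \<le> a" using lam_pos dH_pos by (simp add: a_def)
  from p_dyadic[OF this] obtain C where C: "0 < C" and dy: "\<And>t x y. 0 < t \<Longrightarrow> ennreal (p t x y) \<le>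
    (\<Sum>k. ennreal (C * sc t powr (- dH) * ((1/2)^k / (2^k) powr a)) * indicator {..<2^k * sc t} (dist x y))"
    by blast
  have "heat_en (\<lambda>_. 1) t f \<le> ennreal (2 * C * K * t powr (lam / dW))"
    if K: "0 \<le> K" and f: "f \<in> borel_measurable borel" and t: "0 < t"
      and b: "\<And>r. 0 < r \<Longrightarrow> ball_en (\<lambda>_. 1) r f \<le> ennreal (K * r powr (lam + dH))" for K f t
  proof -
    define c where "c k = C * sc t powr (- dH) * ((1/2)^k / (2^k) powr a)" for k :: nat
    have c0: "0 \<le> c k" for k using C by (simp add: c_def)
    have bm: "(\<lambda>z. ennreal (1 * indicator {..<r} (dd z)) * ennreal \<bar>f (fst z) - f (snd z)\<bar>) \<in> borel_measurable M2" for r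
      by (rule osc_measurable_integrand) (use f in auto)
    have "heat_en (\<lambda>_. 1) t f = (\<integral>\<^sup>+z. ennreal (pp t z) * ennreal \<bar>f (fst z) - f (snd z)\<bar> \<partial>M2)"
      by (simp add: heat_en_def osc_def)
    also have "\<dots> \<le> (\<integral>\<^sup>+z. (\<Sum>k. ennreal (c k) * (ennreal (1 * indicator {..<2^k * sc t} (dd z)) * ennreal \<bar>f (fst z) - f (snd z)\<bar>)) \<partial>M2)"
    proof (rule nn_integral_mono)
      fix z :: "'a \<times> 'a"
      have "ennreal (pp t z) * ennreal \<bar>f (fst z) - f (snd z)\<bar> \<le> (\<Sum>k. ennreal (c k) * indicator {..<2^k * sc t} (dd z)) * ennreal \<bar>f (fst z) - f (snd z)\<bar>"
        unfolding c_def by (rule mult_right_mono[OF dy[OF t]]) simp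
      also have "\<dots> = (\<Sum>k. (ennreal (c k) * indicator {..<2^k * sc t} (dd z)) * ennreal \<bar>f (fst z) - f (snd z)\<bar>)"
        by (rule ennreal_suminf_multc[symmetric])
      also have "\<dots> = (\<Sum>k. ennreal (c k) * (ennreal (1 * indicator {..<2^k * sc t} (dd z)) * ennreal \<bar>f (fst z) - f (snd z)\<bar>))"
        by (simp add: mult.assoc ennreal_indicator)
      finally show "ennreal (pp t z) * ennreal \<bar>f (fst z) - f (snd z)\<bar> \<le> (\<Sum>k. ennreal (c k) * (ennreal (1 * indicator {..<2^k * sc t} (dd z)) * ennreal \<bar>f (fst z) - f (snd z)\<bar>))" .
    qed
    also have "\<dots> = (\<Sum>k. \<integral>\<^sup>+z. ennreal (c k) * (ennreal (1 * indicator {..<2^k * sc t} (dd z)) * ennreal \<bar>f (fst z) - f (snd z)\<bar>) \<partial>M2)"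
      by (rule nn_integral_suminf) (intro borel_measurable_times_ennreal borel_measurable_const bm)
    also have "\<dots> = (\<Sum>k. ennreal (c k) * ball_en (\<lambda>_. 1) (2^k * sc t) f)"
      unfolding ball_en_def osc_def by (subst nn_integral_cmult[OF bm]) simp
    also have "\<dots> \<le> (\<Sum>k. ennreal ((C * K * sc t powr lam) * (1/2)^k))"
    proof (intro suminf_le summableI)
      fix k
      have "ennreal (c k) * ball_en (\<lambda>_. 1) (2^k * sc t) f \<le> ennreal (c k) * ennreal (K * (2^k * sc t) powr (lam + dH))"
        using sc_pos[OF t] by (intro mult_left_mono b) auto
      also have "\<dots> = ennreal (c k * (K * (2^k * sc t) powr (lam + dH)))"
        using c0 K by (simp add: ennreal_mult)
      also have "c k * (K * (2^k * sc t) powr (lam + dH)) = (C * K * sc t powr lam) * (1/2)^k"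
      proof -
        have "(2^k * sc t) powr (lam + dH) = (2^k) powr a * (sc t powr lam * sc t powr dH)"
          using sc_pos[OF t] by (simp add: powr_mult a_def powr_add)
        then show ?thesis using sc_pos[OF t] by (simp add: c_def powr_minus)
      qed
      finally show "ennreal (c k) * ball_en (\<lambda>_. 1) (2^k * sc t) f \<le> ennreal ((C * K * sc t powr lam) * (1/2)^k)" .
    qed
    also have "\<dots> = ennreal (2 * (C * K * sc t powr lam))"
      using C K by (intro suminf_half_ennreal) auto
    also have "2 * (C * K * sc t powr lam) = 2 * C * K * t powr (lam / dW)" using t by (simp add: sc_powr)
    finally show ?thesis .
  qed
  then show ?thesis using C by (intro exI[of _ "2 * C"]) auto
qed

text \<open>For dist < r the kernel is at most its prefactor and dist^\<kappa> at most r^\<kappa>.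
  For dist \<ge> r the ratio dist / sc \<tau> is at least A; comparing kernels with the power
  \<kappa> + 1, one more than needed, leaves a factor 1/A that can be made small. The range r \<le>
  2 A sc \<tau> gives room for rounding the number of steps.\<close>

lemma phi_en_le:
  assumes e: "0 < e"
  shows "\<exists>A>0. \<exists>CA>0. \<forall>\<tau>>0. \<forall>r g f. A * sc \<tau> \<le> r \<longrightarrow> r \<le> 2 * A * sc \<tau> \<longrightarrow>
    g \<in> borel_measurable borel \<longrightarrow> (\<forall>x. 0 \<le> g x) \<longrightarrow> f \<in> borel_measurable borel \<longrightarrow>
    phi_en g \<tau> f \<le> ennreal (\<tau> * CA * r powr (- (lam + dH))) * ball_en g r f
      + ennreal (\<tau> * e * (tB * \<tau>) powr (- (lam / dW))) * heat_en g (tB * \<tau>) f"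
proof -
  have "0 < \<kappa> + 1" using kappa_pos by simp
  from p_compare[OF this] obtain C1 where C1: "0 < C1"
    and cmp: "\<And>t x y. 0 < t \<Longrightarrow> p t x y * (1 + dist x y / sc t) powr (\<kappa> + 1) \<le> C1 * p (tB * t) x y" by blast
  \<comment> \<open>Chosen so that C1 / A = e sc(tB)^(-lam); the power of tB restores the
    normalization at time tB \<tau>.\<close>
  define A where "A = C1 * sc tB powr lam / e"
  have A: "0 < A" using C1 e sc_pos[OF tB_pos] by (simp add: A_def)
  \<comment> \<open>The prefactor sc(\<tau>)^(-dH) is \<tau> sc(\<tau>)^(-(dH + dW)), and sc \<tau>
    is at least r / (2A).\<close>
  define CA where "CA = c3 * (2 * A) powr (dH + dW)"
  have CA: "0 < CA" using c_pos A by (simp add: CA_def)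
  have "phi_en g \<tau> f \<le> ennreal (\<tau> * CA * r powr (- (lam + dH))) * ball_en g r f
      + ennreal (\<tau> * e * (tB * \<tau>) powr (- (lam / dW))) * heat_en g (tB * \<tau>) f"
    if tp: "0 < \<tau>" and r: "A * sc \<tau> \<le> r" "r \<le> 2 * A * sc \<tau>"
      and g: "g \<in> borel_measurable borel" "\<And>x. 0 \<le> g x" and f: "f \<in> borel_measurable borel" for \<tau> r g f
  proof -
    have sp: "0 < sc \<tau>" by (rule sc_pos[OF tp])
    have rp: "0 < r" using A sp r(1) by (meson less_le_trans mult_pos_pos)
    have tBt: "0 < tB * \<tau>" using tB_pos tp by simp
    define a b where "a = \<tau> * CA * r powr (- (lam + dH))" and "b = \<tau> * e * (tB * \<tau>) powr (- (lam / dW))"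
    have ab: "0 \<le> a" "0 \<le> b" using tp CA e by (auto simp: a_def b_def)
    have scd: "sc \<tau> powr dW = \<tau>" by (rule sc_powr_dW[OF tp])
    have point: "pp \<tau> z * dd z powr \<kappa> \<le> a * indicator {..<r} (dd z) + b * pp (tB * \<tau>) z" for z
    proof (cases "dd z < r")
      case True
      have "exp (- c4 * (dd z / sc \<tau>) powr (dW / (dW - 1))) \<le> 1" using c_pos by simp
      then have "c3 * sc \<tau> powr (- dH) * exp (- c4 * (dd z / sc \<tau>) powr (dW / (dW - 1))) \<le> c3 * sc \<tau> powr (- dH) * 1"
        using c_pos by (intro mult_left_mono) auto
      with p_upper'[OF tp, of "fst z" "snd z"] have "pp \<tau> z \<le> c3 * sc \<tau> powr (- dH)" by simp
      also have "sc \<tau> powr (- dH) = \<tau> * sc \<tau> powr (- (dH + dW))"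
      proof -
        have "\<tau> * sc \<tau> powr (- (dH + dW)) = sc \<tau> powr dW * sc \<tau> powr (- (dH + dW))" by (simp only: scd)
        also have "\<dots> = sc \<tau> powr (- dH)" by (simp add: powr_add[symmetric])
        finally show ?thesis by simp
      qed
      also have "sc \<tau> powr (- (dH + dW)) \<le> (r / (2 * A)) powr (- (dH + dW))"
        using r(2) A rp dH_pos dW_pos by (intro powr_mono2') (auto simp: field_simps)
      also have "(r / (2 * A)) powr (- (dH + dW)) = (2 * A) powr (dH + dW) * r powr (- (dH + dW))"
      proof -
        have "(r / (2 * A)) powr (- q) = (2 * A) powr q * r powr (- q)" for q
          using A rp by (simp add: powr_divide powr_minus_divide)
        then show ?thesis .
      qed
      finally have 1: "pp \<tau> z \<le> \<tau> * CA * r powr (- (dH + dW))"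
        using c_pos tp by (simp add: CA_def mult_ac)
      have "pp \<tau> z * dd z powr \<kappa> \<le> \<tau> * CA * r powr (- (dH + dW)) * r powr \<kappa>"
        using 1 True kappa_pos CA tp by (intro mult_mono powr_mono2) auto
      also have "\<dots> = a" by (simp add: a_def lam_def powr_add[symmetric] algebra_simps)
      finally show ?thesis using True mult_nonneg_nonneg[OF ab(2) p_nonneg[OF tBt, of "fst z" "snd z"]] by simp
    next
      case False
      define D where "D = dd z / sc \<tau>"
      have D: "A \<le> D"
      proof -
        have "A * sc \<tau> \<le> dd z" using r(1) False by simp
        then show ?thesis using sp by (simp add: D_def pos_le_divide_eq)
      qed
      have D0: "0 \<le> D" using D A by simp
      have "A * D powr \<kappa> \<le> (1 + D) * (1 + D) powr \<kappa>"
        using D D0 A kappa_pos by (intro mult_mono powr_mono2) auto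
      also have "\<dots> = (1 + D) powr (\<kappa> + 1)" using D0 by (simp add: powr_add)
      finally have "pp \<tau> z * (A * D powr \<kappa>) \<le> pp \<tau> z * (1 + D) powr (\<kappa> + 1)"
        by (intro mult_left_mono p_nonneg tp)
      also have "\<dots> \<le> C1 * pp (tB * \<tau>) z" unfolding D_def by (rule cmp[OF tp])
      finally have "pp \<tau> z * D powr \<kappa> \<le> C1 / A * pp (tB * \<tau>) z" using A by (simp add: field_simps)
      also have "C1 / A = e * sc tB powr (- lam)"
        using C1 e sc_pos[OF tB_pos] by (simp add: A_def powr_minus field_simps)
      finally have 2: "sc \<tau> powr \<kappa> * (pp \<tau> z * D powr \<kappa>) \<le> sc \<tau> powr \<kappa> * (e * sc tB powr (- lam) * pp (tB * \<tau>) z)"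
        by (rule mult_left_mono) simp
      have "dd z powr \<kappa> = sc \<tau> powr \<kappa> * D powr \<kappa>" using sp by (simp add: D_def powr_mult[symmetric])
      then have "pp \<tau> z * dd z powr \<kappa> \<le> sc \<tau> powr \<kappa> * (e * sc tB powr (- lam) * pp (tB * \<tau>) z)"
        using 2 by (simp add: mult_ac)
      also have "sc \<tau> powr \<kappa> = \<tau> * sc \<tau> powr (- lam)"
      proof -
        have "\<tau> * sc \<tau> powr (- lam) = sc \<tau> powr dW * sc \<tau> powr (- lam)" by (simp only: scd)
        also have "\<dots> = sc \<tau> powr \<kappa>" by (simp add: powr_add[symmetric] lam_def)
        finally show ?thesis by simp
      qed
      also have "\<tau> * sc \<tau> powr (- lam) * (e * sc tB powr (- lam) * pp (tB * \<tau>) z) = b * pp (tB * \<tau>) z"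
        using tp tB_pos by (simp add: b_def sc_powr powr_mult mult_ac)
      finally show ?thesis using False by simp
    qed
    have "phi_en g \<tau> f \<le> osc (\<lambda>z. a * (g (fst z) * indicator {..<r} (dd z)) + b * (g (fst z) * pp (tB * \<tau>) z)) f"
      unfolding phi_en_def
    proof (rule osc_mono)
      fix z :: "'a \<times> 'a"
      show "g (fst z) * pp \<tau> z * dd z powr \<kappa> \<le> a * (g (fst z) * indicator {..<r} (dd z)) + b * (g (fst z) * pp (tB * \<tau>) z)"
        using mult_left_mono[OF point[of z] g(2)[of "fst z"]] by (simp add: algebra_simps)
    qed
    also have "\<dots> = osc (\<lambda>z. a * (g (fst z) * indicator {..<r} (dd z))) f + osc (\<lambda>z. b * (g (fst z) * pp (tB * \<tau>) z)) f"
      using g f ab tBt p_nonneg[OF tBt] by (intro osc_add) (auto intro!: borel_measurable_times)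
    also have "osc (\<lambda>z. a * (g (fst z) * indicator {..<r} (dd z))) f = ennreal a * ball_en g r f"
      unfolding ball_en_def using g f ab by (intro osc_cmult) (auto intro!: borel_measurable_times)
    also have "osc (\<lambda>z. b * (g (fst z) * pp (tB * \<tau>) z)) f = ennreal b * heat_en g (tB * \<tau>) f"
      unfolding heat_en_def using g f ab tBt p_nonneg[OF tBt] by (intro osc_cmult) (auto intro!: borel_measurable_times)
    finally show ?thesis by (simp add: a_def b_def)
  qed
  with A CA show ?thesis by blast
qed

text \<open>The time r^dW has scale r, so on pairs with dist < r the lower kernel bound is at least
  \<open>c5\<close> exp(-\<open>c6\<close>) r^(-dH).\<close>

lemma ball_en_le:
  assumes r: "0 < r" and g: "g \<in> borel_measurable borel" "\<And>x. 0 \<le> g x" and f: "f \<in> borel_measurable borel"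
  shows "ball_en g r f \<le> ennreal (exp c6 / c5 * r powr dH) * heat_en g (r powr dW) f"
proof -
  define c where "c = exp c6 / c5 * r powr dH"
  have c: "0 \<le> c" using c_pos by (simp add: c_def)
  have tp: "0 < r powr dW" using r by simp
  have "ball_en g r f \<le> osc (\<lambda>z. c * (g (fst z) * pp (r powr dW) z)) f"
    unfolding ball_en_def
  proof (rule osc_mono)
    fix z :: "'a \<times> 'a"
    have b: "indicator {..<r} (dd z) \<le> c * pp (r powr dW) z"
    proof (cases "dd z < r")
      case True
      then have "(dd z / r) powr (dW / (dW - 1)) \<le> 1"
        using r exponent_ge_1 by (intro powr_le1) auto
      then have "exp (- c6) \<le> exp (- c6 * (dd z / r) powr (dW / (dW - 1)))"
        using c_pos by (simp add: mult_left_le)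
      then have "c5 * r powr (- dH) * exp (- c6) \<le> c5 * r powr (- dH) * exp (- c6 * (dd z / r) powr (dW / (dW - 1)))"
        using c_pos by (intro mult_left_mono) auto
      also have "\<dots> \<le> pp (r powr dW) z"
        using p_lower'[OF tp, of "fst z" "snd z"] sc_of_powr[OF r] by simp
      finally have "c * (c5 * r powr (- dH) * exp (- c6)) \<le> c * pp (r powr dW) z"
        using c by (rule mult_left_mono)
      moreover have "c * (c5 * r powr (- dH) * exp (- c6)) = 1"
        using c_pos r by (simp add: c_def powr_minus exp_minus field_simps)
      ultimately show ?thesis using True by simp
    qed (use c p_nonneg[OF tp] in simp)
    show "g (fst z) * indicator {..<r} (dd z) \<le> c * (g (fst z) * pp (r powr dW) z)"
      using mult_left_mono[OF b g(2)[of "fst z"]] by (simp add: mult.left_commute)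
  qed
  also have "\<dots> = ennreal c * heat_en g (r powr dW) f"
    unfolding heat_en_def using g f c tp p_nonneg[OF tp] by (intro osc_cmult) (auto intro!: borel_measurable_times)
  finally show ?thesis by (simp add: c_def)
qed

end


section \<open>Passage to the limit in the energies\<close>

lemma Liminf_filterlim_le:
  fixes f :: "'b \<Rightarrow> ennreal"
  assumes "filterlim u F G"
  shows "Liminf F f \<le> Liminf G (\<lambda>x. f (u x))"
  unfolding Liminf_def[of F]
proof (rule SUP_least)
  fix P assume "P \<in> {P. eventually P F}"
  then have "eventually (\<lambda>x. P (u x)) G" using assms by (simp add: filterlim_iff)
  then have "\<forall>\<^sub>F x in G. (INF x\<in>Collect P. f x) \<le> f (u x)"
    by eventually_elim (auto intro: INF_lower)
  then show "(INF x\<in>Collect P. f x) \<le> Liminf G (\<lambda>x. f (u x))" by (rule Liminf_bounded)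
qed

lemma Liminf_cmult_ennreal:
  assumes "F \<noteq> bot"
  shows "Liminf F (\<lambda>x. ennreal c * f x) = ennreal c * Liminf F f"
  by (rule Liminf_compose_continuous_mono[where f="\<lambda>y. ennreal c * y", OF _ _ assms])
    (auto intro!: ennreal_continuous_on_cmult monoI mult_left_mono)

context heat_kernel_wBE
begin

lemma filterlim_sc: "filterlim sc (at_right 0) (at_right 0)"
  unfolding filterlim_at
proof
  have "(sc \<longlongrightarrow> 0 powr (1 / dW)) (at_right 0)" unfolding sc_def
    using dW_pos by (intro tendsto_powr' tendsto_intros) (auto simp: eventually_at_filter)
  then show "(sc \<longlongrightarrow> 0) (at_right 0)" by simp
  show "\<forall>\<^sub>F x in at_right 0. sc x \<in> {0<..} \<and> sc x \<noteq> 0"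
    using eventually_at_right_less[of 0] by eventually_elim (use sc_pos in \<open>simp add: less_imp_neq[symmetric]\<close>)
qed

text \<open>The hypotheses of the absorption lemma are verified for the normalized energies. Once t
  is small, the localization error is small; with t fixed, r tending to 0 forces n to infinity,
  which removes the first increment. The modulus of continuity of g affects only how small t must
  be.\<close>

lemma heat_ball_limit:
  "\<exists>C>0. \<forall>f g M K. integrable \<mu> f \<longrightarrow> 0 \<le> K \<longrightarrow>
    (\<forall>r>0. ball_en (\<lambda>_. 1) r f \<le> ennreal (K * r powr (lam + dH))) \<longrightarrow>
    uniformly_continuous_on UNIV g \<longrightarrow> (\<forall>x. 0 \<le> g x \<and> g x \<le> M) \<longrightarrow>
    Limsup (at_right 0) (\<lambda>t. ennreal (t powr (- (lam / dW))) * heat_en g t f)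
      \<le> ennreal C * Liminf (at_right 0) (\<lambda>r. ennreal (r powr (- (lam + dH))) * ball_en g r f)"
proof -
  obtain C0 where C0: "0 < C0" and H0: "\<forall>t>0. \<forall>n>0. \<forall>\<delta>>0. \<forall>M \<omega> g f. g \<in> borel_measurable borel \<longrightarrow> (\<forall>z. 0 \<le> g z \<and> g z \<le> M) \<longrightarrow>
    (\<forall>x z. dist x z < \<delta> \<longrightarrow> \<bar>g z - g x\<bar> \<le> \<omega>) \<longrightarrow> integrable \<mu> f \<longrightarrow>
    heat_en g t f \<le> ennreal M * heat_en (\<lambda>_. 1) (t / real n) f
      + ennreal (C0 * t powr (lam / dW) / (t / real n)) * phi_en (\<lambda>x. g x + (\<omega> + M * (sc t / \<delta>) powr \<kappa>)) (t / real n) f"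
    using heat_en_le by (elim exE conjE) (rule that; assumption)
  obtain C1 where C1: "0 < C1" and H1: "\<forall>K\<ge>0. \<forall>f. f \<in> borel_measurable borel \<longrightarrow>
    (\<forall>r>0. ball_en (\<lambda>_. 1) r f \<le> ennreal (K * r powr (lam + dH))) \<longrightarrow>
    (\<forall>t>0. heat_en (\<lambda>_. 1) t f \<le> ennreal (C1 * K * t powr (lam / dW)))"
    using heat_en_bounded by (elim exE conjE) (rule that; assumption)
  \<comment> \<open>Makes the coefficient of the energy at time tB \<tau> exactly 1/2, as absorption
    requires.\<close>
  define \<epsilon> where "\<epsilon> = 1 / (2 * C0)"
  have eps: "0 < \<epsilon>" "C0 * \<epsilon> = 1 / 2" using C0 by (auto simp: \<epsilon>_def)
  obtain A CA where A: "0 < A" and CA: "0 < CA" and H2: "\<forall>\<tau>>0. \<forall>r g f. A * sc \<tau> \<le> r \<longrightarrow> r \<le> 2 * A * sc \<tau> \<longrightarrow>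
    g \<in> borel_measurable borel \<longrightarrow> (\<forall>x. 0 \<le> g x) \<longrightarrow> f \<in> borel_measurable borel \<longrightarrow>
    phi_en g \<tau> f \<le> ennreal (\<tau> * CA * r powr (- (lam + dH))) * ball_en g r f
      + ennreal (\<tau> * \<epsilon> * (tB * \<tau>) powr (- (lam / dW))) * heat_en g (tB * \<tau>) f"
    using phi_en_le[OF eps(1)] by (elim exE conjE) (rule that; assumption)
  define C where "C = 2 * (C0 * CA)"
  have C: "0 < C" using C0 CA by (simp add: C_def)
  have main: "Limsup (at_right 0) (\<lambda>t. ennreal (t powr (- (lam / dW))) * heat_en g t f)
      \<le> ennreal C * Liminf (at_right 0) (\<lambda>r. ennreal (r powr (- (lam + dH))) * ball_en g r f)"
    if f: "integrable \<mu> f" and K: "0 \<le> K" and ball: "\<And>r. 0 < r \<Longrightarrow> ball_en (\<lambda>_. 1) r f \<le> ennreal (K * r powr (lam + dH))"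
      and ug: "uniformly_continuous_on UNIV g" and g: "\<And>x. 0 \<le> g x" "\<And>x. g x \<le> M" for f g M K
  proof -
    define l a where "l = lam / dW" and "a = lam + dH"
    have l: "0 < l" using lam_pos dW_pos by (simp add: l_def)
    have fm: "f \<in> borel_measurable borel" by (rule integrable_borel[OF f])
    have gm: "g \<in> borel_measurable borel"
      by (intro borel_measurable_continuous_onI uniformly_continuous_imp_continuous ug)
    have M: "0 \<le> M" using g order_trans by blast
    have en1: "heat_en (\<lambda>_. 1) t f \<le> ennreal (C1 * K * t powr l)" if "0 < t" for t
      unfolding l_def using H1[rule_format, OF K fm ball that] by simp
    have heM: "heat_en g t f \<le> ennreal (M * (C1 * K * t powr l))" if t: "0 < t" for t
    proof -
      have "heat_en g t f \<le> osc (\<lambda>z. M * pp t z) f" unfolding heat_en_def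
        by (intro osc_mono mult_right_mono g p_nonneg t)
      also have "\<dots> = ennreal M * heat_en (\<lambda>_. 1) t f" unfolding heat_en_def mult_1_left
        using t fm M p_nonneg[OF t] by (intro osc_cmult) auto
      also have "\<dots> \<le> ennreal M * ennreal (C1 * K * t powr l)" by (intro mult_left_mono en1 t) simp
      finally show ?thesis using M C1 K by (simp add: ennreal_mult)
    qed
    have bM: "ball_en g r f \<le> ennreal (M * (K * r powr a))" if r: "0 < r" for r
    proof -
      have "ball_en g r f \<le> osc (\<lambda>z. M * indicator {..<r} (dd z)) f" unfolding ball_en_def
        by (intro osc_mono mult_right_mono g) auto
      also have "\<dots> = ennreal M * ball_en (\<lambda>_. 1) r f" unfolding ball_en_def mult_1_left
        using fm M by (intro osc_cmult) auto
      also have "\<dots> \<le> ennreal M * ennreal (K * r powr a)" unfolding a_def by (intro mult_left_mono ball r) simp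
      finally show ?thesis using M K by (simp add: ennreal_mult)
    qed
    \<comment> \<open>Both energies are finite by the two preceding bounds, so nothing is lost in
      passing to real numbers.\<close>
    define hN where "hN t = enn2real (heat_en g t f)" for t
    define bN where "bN r = enn2real (ball_en g r f)" for r
    have hN: "heat_en g t f = ennreal (hN t)" "0 \<le> hN t" if "0 < t" for t
      using heM[OF that] unfolding hN_def by (auto simp: ennreal_enn2real_if top_unique)
    have bN: "ball_en g r f = ennreal (bN r)" "0 \<le> bN r" if "0 < r" for r
      using bM[OF that] unfolding bN_def by (auto simp: ennreal_enn2real_if top_unique)
    define N where "N t = t powr (- l) * hN t" for t
    define m where "m r = r powr (- a) * bN r" for r
    \<comment> \<open>The localized test function is g plus a constant \<eta>; the constant costs
      \<eta> times the energy for g = 1, which is uniformly bounded after normalization.\<close>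
    have addg: "heat_en (\<lambda>x. g x + \<eta>) s f \<le> ennreal (hN s + \<eta> * (C1 * K * s powr l))" if s: "0 < s" and eta: "0 \<le> \<eta>" for s \<eta>
    proof -
      have "heat_en (\<lambda>x. g x + \<eta>) s f = osc (\<lambda>z. g (fst z) * pp s z + \<eta> * pp s z) f"
        by (simp add: heat_en_def distrib_right)
      also have "\<dots> = heat_en g s f + osc (\<lambda>z. \<eta> * pp s z) f"
        unfolding heat_en_def using gm g s fm eta p_nonneg[OF s] by (intro osc_add) auto
      also have "osc (\<lambda>z. \<eta> * pp s z) f = ennreal \<eta> * heat_en (\<lambda>_. 1) s f"
        unfolding heat_en_def mult_1_left using s fm eta p_nonneg[OF s] by (intro osc_cmult) auto
      also have "heat_en g s f + ennreal \<eta> * heat_en (\<lambda>_. 1) s f \<le> ennreal (hN s) + ennreal \<eta> * ennreal (C1 * K * s powr l)"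
        unfolding hN(1)[OF s] by (intro add_left_mono mult_left_mono en1 s) simp
      also have "\<dots> = ennreal (hN s + \<eta> * (C1 * K * s powr l))"
        using hN(2)[OF s] eta C1 K by (simp add: ennreal_mult ennreal_plus)
      finally show ?thesis .
    qed
    have addb: "ball_en (\<lambda>x. g x + \<eta>) r f \<le> ennreal (bN r + \<eta> * (K * r powr a))" if r: "0 < r" and eta: "0 \<le> \<eta>" for r \<eta>
    proof -
      have "ball_en (\<lambda>x. g x + \<eta>) r f = osc (\<lambda>z. g (fst z) * indicator {..<r} (dd z) + \<eta> * indicator {..<r} (dd z)) f"
        by (simp add: ball_en_def distrib_right)
      also have "\<dots> = ball_en g r f + osc (\<lambda>z. \<eta> * indicator {..<r} (dd z)) f"
        unfolding ball_en_def using gm g fm eta by (intro osc_add) auto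
      also have "osc (\<lambda>z. \<eta> * indicator {..<r} (dd z)) f = ennreal \<eta> * ball_en (\<lambda>_. 1) r f"
        unfolding ball_en_def mult_1_left using fm eta by (intro osc_cmult) auto
      also have "ball_en g r f + ennreal \<eta> * ball_en (\<lambda>_. 1) r f \<le> ennreal (bN r) + ennreal \<eta> * ennreal (K * r powr a)"
        unfolding bN(1)[OF r] a_def by (intro add_left_mono mult_left_mono ball r) simp
      also have "\<dots> = ennreal (bN r + \<eta> * (K * r powr a))"
        using bN(2)[OF r] eta K by (simp add: ennreal_mult ennreal_plus)
      finally show ?thesis .
    qed
    define Kc where "Kc = C0 * CA * K + C1 * K / 2"
    have Kc: "0 \<le> Kc" using C0 CA C1 K by (simp add: Kc_def)
    have key: "N t \<le> M * C1 * K * ((t / real n) / t) powr l + C0 * CA * m r + N (tB * (t / real n)) / 2 + \<eta> * Kc"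
      if t: "0 < t" and n: "0 < n" and d: "0 < \<delta>" and om: "\<And>x z. dist x z < \<delta> \<Longrightarrow> \<bar>g z - g x\<bar> \<le> \<omega>"
        and r: "A * sc (t / real n) \<le> r" "r \<le> 2 * A * sc (t / real n)"
        and eta: "\<eta> = \<omega> + M * (sc t / \<delta>) powr \<kappa>" for t n \<delta> \<omega> r \<eta>
    proof -
      define \<tau> where "\<tau> = t / real n"
      have tp: "0 < \<tau>" using t n by (simp add: \<tau>_def)
      define s where "s = tB * \<tau>"
      have s: "0 < s" using tp tB_pos by (simp add: s_def)
      have rp: "0 < r" using A sc_pos[OF tp] r(1) unfolding \<tau>_def[symmetric] by (meson less_le_trans mult_pos_pos)
      have eta0: "0 \<le> \<eta>" using om[of undefined undefined] d M unfolding eta by auto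
      have "phi_en (\<lambda>x. g x + \<eta>) \<tau> f \<le> ennreal (\<tau> * CA * r powr (- a)) * ball_en (\<lambda>x. g x + \<eta>) r f
        + ennreal (\<tau> * \<epsilon> * s powr (- l)) * heat_en (\<lambda>x. g x + \<eta>) s f"
        unfolding a_def l_def s_def
        using H2[rule_format, OF tp r[folded \<tau>_def], of "\<lambda>x. g x + \<eta>" f] gm g eta0 fm by (simp add: add_nonneg_nonneg)
      also have "\<dots> \<le> ennreal (\<tau> * CA * r powr (- a)) * ennreal (bN r + \<eta> * (K * r powr a))
        + ennreal (\<tau> * \<epsilon> * s powr (- l)) * ennreal (hN s + \<eta> * (C1 * K * s powr l))"
        by (intro add_mono mult_left_mono addb addg rp s eta0) auto
      also have "\<dots> = ennreal (\<tau> * CA * r powr (- a) * (bN r + \<eta> * (K * r powr a))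
          + \<tau> * \<epsilon> * s powr (- l) * (hN s + \<eta> * (C1 * K * s powr l)))"
        using tp CA eps eta0 K C1 bN(2)[OF rp] hN(2)[OF s] by (simp add: ennreal_mult[symmetric] ennreal_plus[symmetric] del: ennreal_plus)
      also have "\<tau> * CA * r powr (- a) * (bN r + \<eta> * (K * r powr a))
          + \<tau> * \<epsilon> * s powr (- l) * (hN s + \<eta> * (C1 * K * s powr l))
        = \<tau> * (CA * (m r + \<eta> * K) + \<epsilon> * (N s + \<eta> * (C1 * K)))"
        unfolding m_def N_def using rp s by (simp add: powr_minus field_simps)
      finally have phi: "phi_en (\<lambda>x. g x + \<eta>) \<tau> f \<le> ennreal (\<tau> * (CA * (m r + \<eta> * K) + \<epsilon> * (N s + \<eta> * (C1 * K))))" .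
      define X where "X = CA * (m r + \<eta> * K) + \<epsilon> * (N s + \<eta> * (C1 * K))"
      have X: "0 \<le> X" unfolding X_def m_def N_def
        using CA eps eta0 K C1 bN(2)[OF rp] hN(2)[OF s] by (intro add_nonneg_nonneg mult_nonneg_nonneg) auto
      have "ennreal (hN t) \<le> ennreal M * heat_en (\<lambda>_. 1) \<tau> f + ennreal (C0 * t powr l / \<tau>) * phi_en (\<lambda>x. g x + \<eta>) \<tau> f"
        unfolding hN(1)[OF t, symmetric] \<tau>_def l_def eta
        using H0[rule_format, OF t n d gm _ _ f, of M \<omega>] g om by blast
      also have "\<dots> \<le> ennreal M * ennreal (C1 * K * \<tau> powr l) + ennreal (C0 * t powr l / \<tau>) * ennreal (\<tau> * X)"
        unfolding X_def by (intro add_mono mult_left_mono en1 tp phi) auto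
      also have "\<dots> = ennreal (M * (C1 * K * \<tau> powr l) + C0 * t powr l / \<tau> * (\<tau> * X))"
        using M C1 K C0 t tp X by (simp add: ennreal_mult[symmetric] ennreal_plus[symmetric] del: ennreal_plus)
      also have "C0 * t powr l / \<tau> * (\<tau> * X) = t powr l * (C0 * X)" using tp by simp
      finally have "hN t \<le> M * (C1 * K * \<tau> powr l) + t powr l * (C0 * X)"
        using M C1 K C0 X by (subst (asm) ennreal_le_iff) (auto intro!: add_nonneg_nonneg mult_nonneg_nonneg)
      then have "N t \<le> t powr (- l) * (M * (C1 * K * \<tau> powr l) + t powr l * (C0 * X))"
        unfolding N_def by (rule mult_left_mono) simp
      also have "\<dots> = M * C1 * K * (\<tau> / t) powr l + C0 * X"
      proof -
        have "(\<tau> / t) powr l = t powr (- l) * \<tau> powr l" using t tp by (simp add: powr_divide powr_minus_divide)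
        moreover have "t powr (- l) * t powr l = 1" using t by (simp add: powr_add[symmetric])
        ultimately show ?thesis by (simp add: distrib_left mult.left_commute[of "t powr (- l)"] mult_ac)
      qed
      also have "C0 * X = C0 * CA * m r + (C0 * \<epsilon>) * N s + \<eta> * (C0 * CA * K + (C0 * \<epsilon>) * (C1 * K))"
        by (simp add: X_def algebra_simps)
      also have "\<dots> = C0 * CA * m r + N s / 2 + \<eta> * Kc" unfolding eps(2) Kc_def by simp
      finally show ?thesis by (simp add: s_def \<tau>_def)
    qed
    have "Limsup (at_right 0) (\<lambda>t. ennreal (N t)) \<le> ennreal (2 * (C0 * CA)) * Liminf (at_right 0) (\<lambda>r. ennreal (m r))"
    proof (rule Limsup_absorb[where KN="M * (C1 * K)" and Km="M * K"])
      show "0 \<le> N t" if "0 < t" for t using hN(2)[OF that] by (simp add: N_def)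
      show "0 \<le> m r" if "0 < r" for r using bN(2)[OF that] by (simp add: m_def)
      show "N t \<le> M * (C1 * K)" if t: "0 < t" for t
      proof -
        have "hN t \<le> M * (C1 * K * t powr l)"
          using heM[OF t] M C1 K unfolding hN(1)[OF t] by (subst (asm) ennreal_le_iff) auto
        then have "N t \<le> t powr (- l) * (M * (C1 * K * t powr l))" unfolding N_def by (rule mult_left_mono) simp
        also have "\<dots> = M * (C1 * K)" using t by (simp add: powr_minus)
        finally show ?thesis .
      qed
      show "m r \<le> M * K" if r: "0 < r" for r
      proof -
        have "bN r \<le> M * (K * r powr a)"
          using bM[OF r] M K unfolding bN(1)[OF r] by (subst (asm) ennreal_le_iff) auto
        then have "m r \<le> r powr (- a) * (M * (K * r powr a))" unfolding m_def by (rule mult_left_mono) simp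
        also have "\<dots> = M * K" using r by (simp add: powr_minus)
        finally show ?thesis .
      qed
      show "0 \<le> C0 * CA" using C0 CA by simp
    next
      fix e :: real assume e: "0 < e"
      \<comment> \<open>Serves both as oscillation bound for g and as tail bound, so \<eta> is at
        most 2 e1 and the error \<eta> Kc at most e/2.\<close>
      define e1 where "e1 = e / (4 * (Kc + 1))"
      have e1: "0 < e1" "2 * e1 * Kc \<le> e / 2"
        using e Kc by (auto simp: e1_def field_simps)
      obtain \<delta> where d: "0 < \<delta>" and om: "\<And>x z. dist x z < \<delta> \<Longrightarrow> \<bar>g z - g x\<bar> \<le> e1"
      proof -
        obtain d where d: "0 < d" "\<And>x x'. dist x' x < d \<Longrightarrow> dist (g x') (g x) < e1"
          using ug e1(1) unfolding uniformly_continuous_on_def by (metis UNIV_I)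
        show thesis
        proof (rule that[OF d(1)])
          fix x z :: 'a assume "dist x z < d"
          then show "\<bar>g z - g x\<bar> \<le> e1" using d(2)[of z x] by (simp add: dist_commute dist_real_def)
        qed
      qed
      \<comment> \<open>Times below q^dW have scale below q, where the tail term M (sc t /
        \<delta>)^\<kappa> is at most e1.\<close>
      define q where "q = \<delta> * (e1 / (M + 1)) powr (1 / \<kappa>)"
      have q: "0 < q" using d e1 M by (simp add: q_def)
      have eta: "M * (sc t / \<delta>) powr \<kappa> \<le> e1" if t: "0 < t" "t < q powr dW" for t
      proof -
        have "sc t \<le> q" using sc_mono[OF t(1) less_imp_le[OF t(2)]] sc_of_powr[OF q] by simp
        then have "sc t / \<delta> \<le> (e1 / (M + 1)) powr (1 / \<kappa>)" using d by (simp add: q_def pos_divide_le_eq mult.commute)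
        then have "(sc t / \<delta>) powr \<kappa> \<le> ((e1 / (M + 1)) powr (1 / \<kappa>)) powr \<kappa>"
          using sc_pos[OF t(1)] d kappa_pos by (intro powr_mono2) auto
        also have "\<dots> = e1 / (M + 1)" using e1 M kappa_pos by (simp add: powr_powr)
        finally have "M * (sc t / \<delta>) powr \<kappa> \<le> M * (e1 / (M + 1))" using M by (rule mult_left_mono)
        also have "\<dots> \<le> e1" using M e1 by (simp add: field_simps)
        finally show ?thesis .
      qed
      show "\<exists>t0>0. \<forall>t. 0 < t \<longrightarrow> t < t0 \<longrightarrow>
        (\<exists>r0>0. \<forall>r. 0 < r \<longrightarrow> r < r0 \<longrightarrow> (\<exists>s. 0 < s \<and> s < e \<and> N t \<le> e + C0 * CA * m r + N s / 2))"
      proof (rule exI[of _ "q powr dW"], intro conjI allI impI)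
        show "0 < q powr dW" using q by simp
        fix t assume t: "0 < t" "t < q powr dW"
        \<comment> \<open>The ratio \<tau>/t below which the first increment contributes at most
          e/2.\<close>
        define y where "y = (e / (2 * (M * C1 * K + 1))) powr (1 / l)"
        have "0 \<le> M * C1 * K" using M C1 K by simp
        then have "0 < M * C1 * K + 1" by (rule add_nonneg_pos) simp
        then have "0 < 2 * (M * C1 * K + 1)" by (rule mult_pos_pos[rotated]) simp
        from divide_pos_pos[OF e this] have y: "0 < y"
          unfolding y_def powr_gt_zero by (rule less_imp_neq[symmetric])
        \<comment> \<open>Three requirements on \<tau> \<le> T: at least one step fits into t,
          \<tau>/t is at most y, and the time tB \<tau> is at most e/2.\<close>
        define T where "T = min t (min (t * y) (e / (2 * tB)))"
        have T: "0 < T" "T \<le> t" "T \<le> t * y" "T \<le> e / (2 * tB)" using t y e tB_pos by (auto simp: T_def)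
        show "\<exists>r0>0. \<forall>r. 0 < r \<longrightarrow> r < r0 \<longrightarrow> (\<exists>s. 0 < s \<and> s < e \<and> N t \<le> e + C0 * CA * m r + N s / 2)"
        proof (rule exI[of _ "A * sc T"], intro conjI allI impI)
          show "0 < A * sc T" using A sc_pos[OF T(1)] by simp
          fix r assume r: "0 < r" "r < A * sc T"
          define R where "R = (r / A) powr dW"
          have R: "0 < R" using r A by (simp add: R_def)
          have scR: "sc R = r / A" using r A by (simp add: R_def sc_of_powr)
          have RT: "R \<le> T"
          proof -
            have "(r / A) powr dW \<le> sc T powr dW" using r A dW_pos by (intro powr_mono2) (auto simp: field_simps)
            then show ?thesis using sc_powr_dW[OF T(1)] by (simp add: R_def)
          qed
          \<comment> \<open>R is the time of scale r/A. Rounding t/R up gives \<tau> between R/2 and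
            R, hence A sc \<tau> \<le> r \<le> 2 A sc \<tau>, because sc 2 \<le> 2.\<close>
          define n where "n = nat \<lceil>t / R\<rceil>"
          have x1: "1 \<le> t / R" using RT T(2) R by simp
          have n: "t / R \<le> real n" "real n \<le> t / R + 1"
          proof -
            have "0 \<le> \<lceil>t / R\<rceil>" using x1 by linarith
            then have "real n = of_int \<lceil>t / R\<rceil>" by (simp add: n_def)
            then show "t / R \<le> real n" "real n \<le> t / R + 1" by linarith+
          qed
          have n0: "0 < n" using n(1) x1 by (cases n) auto
          define \<tau> where "\<tau> = t / real n"
          have tau: "0 < \<tau>" "\<tau> \<le> R" "R \<le> 2 * \<tau>"
          proof -
            show "0 < \<tau>" using t n0 by (simp add: \<tau>_def)
            show "\<tau> \<le> R" using n(1) R n0 by (simp add: \<tau>_def field_simps)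
            have "real n \<le> 2 * (t / R)" using n(2) x1 by simp
            then show "R \<le> 2 * \<tau>" using R n0 by (simp add: \<tau>_def field_simps)
          qed
          have r1: "A * sc \<tau> \<le> r"
            using sc_mono[OF tau(1,2)] A scR by (simp add: field_simps)
          have r2: "r \<le> 2 * A * sc \<tau>"
          proof -
            have "sc R \<le> sc (2 * \<tau>)" using R tau(3) by (rule sc_mono)
            also have "\<dots> = sc 2 * sc \<tau>" using tau by (simp add: sc_mult)
            also have "\<dots> \<le> 2 * sc \<tau>"
            proof (rule mult_right_mono)
              have "sc 2 \<le> 2 powr 1" unfolding sc_def using dW_gt_2 by (intro powr_mono) auto
              then show "sc 2 \<le> 2" by simp
            qed (use sc_pos[OF tau(1)] in simp)
            finally show ?thesis using A by (simp add: scR field_simps)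
          qed
          have "N t \<le> M * C1 * K * (\<tau> / t) powr l + C0 * CA * m r + N (tB * \<tau>) / 2 + (e1 + M * (sc t / \<delta>) powr \<kappa>) * Kc"
            unfolding \<tau>_def by (rule key[OF t(1) n0 d om r1[unfolded \<tau>_def] r2[unfolded \<tau>_def] refl])
          moreover have "(e1 + M * (sc t / \<delta>) powr \<kappa>) * Kc \<le> 2 * e1 * Kc"
            using eta[OF t] Kc by (intro mult_right_mono) auto
          moreover have "M * C1 * K * (\<tau> / t) powr l \<le> e / 2"
          proof -
            have "\<tau> / t \<le> y" using tau(2) RT T(3) t(1) by (simp add: field_simps)
            then have "(\<tau> / t) powr l \<le> y powr l" using tau(1) t(1) l by (intro powr_mono2) auto
            also have "y powr l = e / (2 * (M * C1 * K + 1))" using e M C1 K l by (simp add: y_def powr_powr add_nonneg_pos)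
            finally have "M * C1 * K * (\<tau> / t) powr l \<le> M * C1 * K * (e / (2 * (M * C1 * K + 1)))"
              using M C1 K by (intro mult_left_mono) auto
            also have "\<dots> \<le> e / 2"
            proof -
              define z where "z = M * C1 * K"
              have "0 \<le> z" using M C1 K by (simp add: z_def)
              then have "z * (e / (2 * (z + 1))) \<le> e / 2" using e by (simp add: field_simps)
              then show ?thesis by (simp add: z_def)
            qed
            finally show ?thesis .
          qed
          moreover have "e / 2 + e / 2 = e" by simp
          ultimately have fin: "N t \<le> e + C0 * CA * m r + N (tB * \<tau>) / 2" using e1(2) by linarith
          have "tB * \<tau> < e"
          proof -
            have "tB * \<tau> \<le> tB * (e / (2 * tB))" using tau(2) RT T(4) tB_pos by (intro mult_left_mono) auto
            also have "\<dots> < e" using tB_pos e by simp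
            finally show ?thesis .
          qed
          then show "\<exists>s. 0 < s \<and> s < e \<and> N t \<le> e + C0 * CA * m r + N s / 2"
            using fin tB_pos tau(1) by (intro exI[of _ "tB * \<tau>"]) auto
        qed
      qed
    qed
    moreover have "Limsup (at_right 0) (\<lambda>t. ennreal (t powr (- (lam / dW))) * heat_en g t f) = Limsup (at_right 0) (\<lambda>t. ennreal (N t))"
      by (rule Limsup_eq) (use hN in \<open>auto simp: eventually_at_right_field N_def l_def ennreal_mult intro!: exI[of _ 1]\<close>)
    moreover have "Liminf (at_right 0) (\<lambda>r. ennreal (r powr (- (lam + dH))) * ball_en g r f) = Liminf (at_right 0) (\<lambda>r. ennreal (m r))"
      by (rule Liminf_eq) (use bN in \<open>auto simp: eventually_at_right_field m_def a_def ennreal_mult intro!: exI[of _ 1]\<close>)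
    ultimately show ?thesis by (simp add: C_def)
  qed
  show ?thesis
  proof (intro exI[of _ C] conjI allI impI C)
    fix f g :: "'a \<Rightarrow> real" and M K :: real
    assume "integrable \<mu> f" "0 \<le> K" "\<forall>r>0. ball_en (\<lambda>_. 1) r f \<le> ennreal (K * r powr (lam + dH))"
      "uniformly_continuous_on UNIV g" "\<forall>x. 0 \<le> g x \<and> g x \<le> M"
    then show "Limsup (at_right 0) (\<lambda>t. ennreal (t powr (- (lam / dW))) * heat_en g t f)
      \<le> ennreal C * Liminf (at_right 0) (\<lambda>r. ennreal (r powr (- (lam + dH))) * ball_en g r f)"
      by (intro main) auto
  qed
qed

end

section \<open>BV measures\<close>


lemma Limsup_filterlim_ge:
  fixes f :: "'b \<Rightarrow> ennreal"
  assumes "filterlim u F G"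
  shows "Limsup G (\<lambda>x. f (u x)) \<le> Limsup F f"
  unfolding Limsup_def[of F]
proof (rule INF_greatest)
  fix P assume "P \<in> {P. eventually P F}"
  then have "eventually (\<lambda>x. P (u x)) G" using assms by (simp add: filterlim_iff)
  then have "\<forall>\<^sub>F x in G. f (u x) \<le> (SUP x\<in>Collect P. f x)"
    by eventually_elim (auto intro: SUP_upper)
  then show "Limsup G (\<lambda>x. f (u x)) \<le> (SUP x\<in>Collect P. f x)" by (rule Limsup_bounded)
qed

lemma Limsup_cmult_ennreal:
  assumes "F \<noteq> bot"
  shows "Limsup F (\<lambda>x. ennreal c * f x) = ennreal c * Limsup F f"
  by (rule Limsup_compose_continuous_mono[where f="\<lambda>y. ennreal c * y", OF _ _ assms])
    (auto intro!: ennreal_continuous_on_cmult monoI mult_left_mono)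

lemma Cc_bounded:
  fixes u :: "'a::metric_space \<Rightarrow> real"
  assumes "u \<in> Cc"
  shows "\<exists>M>0. \<forall>x. \<bar>u x\<bar> \<le> M"
proof -
  have "compact (u ` closure {x. u x \<noteq> 0})"
    using assms unfolding Cc_def by (auto intro!: compact_continuous_image intro: continuous_on_subset)
  then have "bounded (u ` closure {x. u x \<noteq> 0})" by (rule compact_imp_bounded)
  then obtain M where M: "0 < M" "\<And>y. y \<in> u ` closure {x. u x \<noteq> 0} \<Longrightarrow> norm y \<le> M"
    unfolding bounded_pos by auto
  have "\<bar>u x\<bar> \<le> M" for x
  proof (cases "u x = 0")
    case False
    then have "x \<in> closure {x. u x \<noteq> 0}" using closure_subset by fastforce
    then show ?thesis using M(2)[of "u x"] by simp
  qed (use M in simp)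
  with M show ?thesis by blast
qed

lemma Cc_borel: "u \<in> Cc \<Longrightarrow> u \<in> borel_measurable borel"
  unfolding Cc_def by (auto intro: borel_measurable_continuous_onI)

lemma radon_measureD:
  assumes "radon_measure M"
  shows "sets M = sets borel"
    and "compact C \<Longrightarrow> emeasure M C < \<infinity>"
    and "A \<in> sets borel \<Longrightarrow> emeasure M A = (INF U\<in>{U. open U \<and> A \<subseteq> U}. emeasure M U)"
    and "open U \<Longrightarrow> emeasure M U = (SUP C\<in>{C. compact C \<and> C \<subseteq> U}. emeasure M C)"
  using assms unfolding radon_measure_def by blast+

text \<open>Domination gives absolute continuity and thus a Radon-Nikodym density h. On the set N
  where h > K the integral of h is \<gamma>'(N) \<le> K \<gamma>(N), so h - K has integral 0
  there.\<close>

lemma density_bounded: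
  assumes sg: "sigma_finite_measure \<gamma>" and sets: "sets \<gamma> = sets borel" "sets \<gamma>' = sets borel"
    and le: "\<And>A. A \<in> sets borel \<Longrightarrow> emeasure \<gamma>' A \<le> ennreal K * emeasure \<gamma> A"
  shows "\<exists>h\<in>borel_measurable borel. \<gamma>' = density \<gamma> h \<and> (AE x in \<gamma>. h x \<le> ennreal K)"
proof -
  interpret sigma_finite_measure \<gamma> by (rule sg)
  have "absolutely_continuous \<gamma> \<gamma>'"
    unfolding absolutely_continuous_def
  proof
    fix N assume "N \<in> null_sets \<gamma>"
    then show "N \<in> null_sets \<gamma>'" using le[of N] sets by (auto simp: null_sets_def)
  qed
  from Radon_Nikodym[OF this] obtain h where h: "h \<in> borel_measurable \<gamma>" and d: "density \<gamma> h = \<gamma>'"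
    using sets by auto
  have [measurable_cong]: "sets \<gamma> = sets borel" by (rule sets)
  note h [measurable]
  obtain B :: "nat \<Rightarrow> 'a set" where B: "range B \<subseteq> sets \<gamma>" "(\<Union>i. B i) = space \<gamma>" "\<And>i. emeasure \<gamma> (B i) \<noteq> \<infinity>"
    using sigma_finite by metis
  have Bm [measurable]: "B i \<in> sets \<gamma>" for i using B(1) by auto
  have "AE x in \<gamma>. x \<in> B i \<longrightarrow> h x \<le> ennreal K" for i
  proof -
    \<comment> \<open>Intersecting with a set of finite measure makes K \<gamma>(N) finite, hence
      cancellable in \<open>ennreal\<close>.\<close>
    define N where "N = {x \<in> space \<gamma>. ennreal K < h x} \<inter> B i"
    have N [measurable]: "N \<in> sets \<gamma>" unfolding N_def by measurable
    have Nfin: "emeasure \<gamma> N < \<infinity>"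
      using emeasure_mono[of N "B i" \<gamma>] B(3)[of i] by (auto simp: N_def less_top[symmetric] top_unique)
    have "(\<integral>\<^sup>+x. (h x - ennreal K) * indicator N x \<partial>\<gamma>) + ennreal K * emeasure \<gamma> N
       = (\<integral>\<^sup>+x. (h x - ennreal K) * indicator N x \<partial>\<gamma>) + (\<integral>\<^sup>+x. ennreal K * indicator N x \<partial>\<gamma>)"
      by (simp add: nn_integral_cmult_indicator)
    also have "\<dots> = (\<integral>\<^sup>+x. (h x - ennreal K) * indicator N x + ennreal K * indicator N x \<partial>\<gamma>)"
      by (rule nn_integral_add[symmetric]) measurable
    also have "\<dots> = (\<integral>\<^sup>+x. h x * indicator N x \<partial>\<gamma>)"
      by (intro nn_integral_cong) (auto simp: N_def indicator_def diff_add_cancel_ennreal less_imp_le)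
    also have "\<dots> = emeasure \<gamma>' N" unfolding d[symmetric] by (rule emeasure_density[symmetric]) measurable
    also have "\<dots> \<le> ennreal K * emeasure \<gamma> N" using N sets by (intro le) auto
    finally have "(\<integral>\<^sup>+x. (h x - ennreal K) * indicator N x \<partial>\<gamma>) + ennreal K * emeasure \<gamma> N \<le> 0 + ennreal K * emeasure \<gamma> N"
      by simp
    moreover have "ennreal K * emeasure \<gamma> N \<noteq> \<top>" using Nfin by (simp add: ennreal_mult_eq_top_iff)
    ultimately have "(\<integral>\<^sup>+x. (h x - ennreal K) * indicator N x \<partial>\<gamma>) = 0"
      by (simp add: ennreal_add_left_cancel_le add.commute[of _ "ennreal K * emeasure \<gamma> N"])
    then have "AE x in \<gamma>. (h x - ennreal K) * indicator N x = 0"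
      by (subst (asm) nn_integral_0_iff_AE) measurable
    with AE_space show ?thesis
      by eventually_elim (auto simp: N_def indicator_def diff_eq_0_iff_ennreal not_less less_le_not_le split: if_splits)
  qed
  then have "AE x in \<gamma>. \<forall>i. x \<in> B i \<longrightarrow> h x \<le> ennreal K" by (subst AE_all_countable) blast
  with AE_space have "AE x in \<gamma>. h x \<le> ennreal K"
    by eventually_elim (use B(2) in blast)
  moreover have "h \<in> borel_measurable borel" using h measurable_cong_sets[OF sets(1) refl] by blast
  ultimately show ?thesis using d by blast
qed

section \<open>Mean oscillations, Korevaar-Schoen bounds and BV measures\<close>

context heat_kernel_wBE
begin

text \<open>Kernel symmetry reconciles the conventions: \<open>heat_osc\<close> integrates over the
  first kernel argument, while \<open>heat_en\<close> puts the base point of g there.\<close>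

lemma heat_osc_integral:
  assumes t: "0 < t" and g: "g \<in> borel_measurable borel" "\<And>x. 0 \<le> g x" and f: "f \<in> borel_measurable borel"
  shows "(\<integral>\<^sup>+y. ennreal (g y) * heat_osc \<mu> p dW \<kappa> t f y \<partial>\<mu>) = ennreal (t powr (- (lam / dW))) * heat_en g t f"
proof -
  define W where "W z = ennreal (g (fst z) * pp t z) * ennreal \<bar>f (fst z) - f (snd z)\<bar>" for z
  have W: "W \<in> borel_measurable M2" unfolding W_def
    by (rule osc_measurable_integrand) (use g(1) t f in measurable)
  have c: "1 / t powr (1 - \<kappa> / dW) = t powr (- (lam / dW))"
  proof -
    have "lam / dW = 1 - \<kappa> / dW" using dW_pos by (simp add: lam_def diff_divide_distrib)
    then show ?thesis by (simp only: powr_minus_divide)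
  qed
  have "ennreal (t powr (- (lam / dW))) * heat_en g t f = ennreal (t powr (- (lam / dW))) * (\<integral>\<^sup>+y. \<integral>\<^sup>+x. W (y, x) \<partial>\<mu> \<partial>\<mu>)"
    unfolding heat_en_def osc_def W_def[symmetric] by (simp only: nn_integral_fst[OF W])
  also have "\<dots> = (\<integral>\<^sup>+y. ennreal (t powr (- (lam / dW))) * (\<integral>\<^sup>+x. W (y, x) \<partial>\<mu>) \<partial>\<mu>)"
    by (rule nn_integral_cmult[symmetric], rule borel_measurable_nn_integral_fst[OF W])
  also have "\<dots> = (\<integral>\<^sup>+y. ennreal (g y) * heat_osc \<mu> p dW \<kappa> t f y \<partial>\<mu>)"
  proof (intro nn_integral_cong)
    fix y
    have m: "(\<lambda>x. ennreal (p t x y * \<bar>f x - f y\<bar>)) \<in> borel_measurable \<mu>"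
      using t f by (auto intro!: measurable_compose[OF _ measurable_ennreal] borel_measurable_times p_measurable)
    have "(\<integral>\<^sup>+x. W (y, x) \<partial>\<mu>) = (\<integral>\<^sup>+x. ennreal (g y) * ennreal (p t x y * \<bar>f x - f y\<bar>) \<partial>\<mu>)"
      using g(2) p_nonneg[OF t]
      by (intro nn_integral_cong) (simp add: W_def ennreal_mult[symmetric] p_sym[OF t, of _ y] abs_minus_commute mult.assoc)
    also have "\<dots> = ennreal (g y) * (\<integral>\<^sup>+x. ennreal (p t x y * \<bar>f x - f y\<bar>) \<partial>\<mu>)"
      by (rule nn_integral_cmult[OF m])
    finally show "ennreal (t powr (- (lam / dW))) * (\<integral>\<^sup>+x. W (y, x) \<partial>\<mu>) = ennreal (g y) * heat_osc \<mu> p dW \<kappa> t f y"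
      by (simp add: heat_osc_def c mult.left_commute)
  qed
  finally show ?thesis by simp
qed

lemma measure_ball_bounds:
  assumes r: "0 < r"
  shows "c1 * r powr dH \<le> measure \<mu> (ball x r)" "measure \<mu> (ball x r) \<le> c2 * r powr dH" "0 < measure \<mu> (ball x r)"
proof -
  have e: "emeasure \<mu> (ball x r) = ennreal (measure \<mu> (ball x r))"
    using ball_finite[of x r] by (intro emeasure_eq_ennreal_measure) auto
  show 1: "c1 * r powr dH \<le> measure \<mu> (ball x r)"
    using ball_lower[of r x] r c_pos unfolding e by (simp add: ennreal_le_iff)
  show "measure \<mu> (ball x r) \<le> c2 * r powr dH"
    using ball_upper[of r x] r c_pos(2) unfolding e by (simp add: ennreal_le_iff)
  have "0 < c1 * r powr dH" using c_pos r by simp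
  with 1 show "0 < measure \<mu> (ball x r)" by simp
qed

lemma ball_en_iterated:
  assumes g: "g \<in> borel_measurable borel" "\<And>x. 0 \<le> g x" and f: "f \<in> borel_measurable borel"
  shows "ball_en g r f = (\<integral>\<^sup>+y. ennreal (g y) * (\<integral>\<^sup>+x. ennreal (indicator {..<r} (dist y x) * \<bar>f x - f y\<bar>) \<partial>\<mu>) \<partial>\<mu>)"
proof -
  define W where "W z = ennreal (g (fst z) * indicator {..<r} (dd z)) * ennreal \<bar>f (fst z) - f (snd z)\<bar>" for z
  have W: "W \<in> borel_measurable M2" unfolding W_def
    by (rule osc_measurable_integrand) (use g(1) f in measurable)
  have "ball_en g r f = (\<integral>\<^sup>+y. \<integral>\<^sup>+x. W (y, x) \<partial>\<mu> \<partial>\<mu>)"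
    unfolding ball_en_def osc_def W_def[symmetric] by (simp only: nn_integral_fst[OF W])
  also have "\<dots> = (\<integral>\<^sup>+y. ennreal (g y) * (\<integral>\<^sup>+x. ennreal (indicator {..<r} (dist y x) * \<bar>f x - f y\<bar>) \<partial>\<mu>) \<partial>\<mu>)"
  proof (intro nn_integral_cong)
    fix y
    have "(\<lambda>x. ennreal (indicator {..<r} (dist y x) * \<bar>f x - f y\<bar>)) \<in> borel_measurable \<mu>"
      using f by measurable
    from nn_integral_cmult[OF this, of "ennreal (g y)"]
    show "(\<integral>\<^sup>+x. W (y, x) \<partial>\<mu>) = ennreal (g y) * (\<integral>\<^sup>+x. ennreal (indicator {..<r} (dist y x) * \<bar>f x - f y\<bar>) \<partial>\<mu>)"
      using g(2) by (simp add: W_def ennreal_mult[symmetric] abs_minus_commute mult.assoc)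
  qed
  finally show ?thesis .
qed

text \<open>Ahlfors regularity replaces the volume in the mean oscillation by r^dH up to
  \<open>c1\<close> and \<open>c2\<close>. Finiteness of the ball energy ensures that the Bochner
  integral is the true value of the nonnegative integral and not the default 0.\<close>

lemma mean_osc_integral:
  assumes r: "0 < r" and f: "integrable \<mu> f" and g: "g \<in> borel_measurable borel" "\<And>x. 0 \<le> g x"
    and fin: "ball_en g r f < \<infinity>"
  shows "ennreal (r powr (- (lam + dH))) * ball_en g r f \<le> ennreal c2 * ennreal (\<integral>y. g y * mean_osc \<mu> dW \<kappa> r f y \<partial>\<mu>)"
    and "ennreal c1 * ennreal (\<integral>y. g y * mean_osc \<mu> dW \<kappa> r f y \<partial>\<mu>) \<le> ennreal (r powr (- (lam + dH))) * ball_en g r f"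
proof -
  have fm [measurable]: "f \<in> borel_measurable borel" by (rule integrable_borel[OF f])
  note g(1) [measurable]
  define a where "a = lam + dH"
  define I where "I y = (\<integral>x. indicator {..<r} (dist y x) * \<bar>f x - f y\<bar> \<partial>\<mu>)" for y
  define V where "V y = measure \<mu> (ball y r)" for y
  have V: "c1 * r powr dH \<le> V y" "V y \<le> c2 * r powr dH" "0 < V y" for y
    unfolding V_def using measure_ball_bounds[OF r] by auto
  have int: "integrable \<mu> (\<lambda>x. indicator {..<r} (dist y x) * \<bar>f x - f y\<bar>)" for y
  proof (rule Bochner_Integration.integrable_bound)
    show "integrable \<mu> (\<lambda>x. \<bar>f x\<bar> + \<bar>f y\<bar> * indicator (ball y r) x)"
      using f ball_finite[of y r]
      by (intro Bochner_Integration.integrable_add integrable_abs integrable_mult_right integrable_real_indicator) (auto simp: sets_mu)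
    show "AE x in \<mu>. norm (indicator {..<r} (dist y x) * \<bar>f x - f y\<bar>) \<le> norm (\<bar>f x\<bar> + \<bar>f y\<bar> * indicator (ball y r) x)"
      by (rule AE_I2) (auto split: split_indicator)
  qed measurable
  have I: "(\<integral>\<^sup>+x. ennreal (indicator {..<r} (dist y x) * \<bar>f x - f y\<bar>) \<partial>\<mu>) = ennreal (I y)" "0 \<le> I y" for y
    unfolding I_def by (rule nn_integral_eq_integral[OF int], simp) (rule Bochner_Integration.integral_nonneg, simp)
  have mo: "mean_osc \<mu> dW \<kappa> r f y = 1 / (r powr lam * V y) * I y" for y
  proof -
    have "(LINT x:ball y r|\<mu>. \<bar>f x - f y\<bar>) = I y"
      unfolding I_def set_lebesgue_integral_def
      by (intro Bochner_Integration.integral_cong) (auto simp: indicator_def)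
    then show ?thesis by (simp add: mean_osc_def lam_def V_def)
  qed
  have mo0: "0 \<le> mean_osc \<mu> dW \<kappa> r f y" for y unfolding mo using I(2) V(3)[of y] by simp
  \<comment> \<open>Measurability of the volume in the centre comes from Tonelli applied to the
    indicator of dist < r on pairs.\<close>
  have Vm: "V \<in> borel_measurable borel"
  proof -
    have m: "(\<lambda>z. ennreal (indicator {..<r} (dd z))) \<in> borel_measurable M2"
      by (intro measurable_compose[OF _ measurable_ennreal] indicator_dd_measurable)
    have "V y = enn2real (\<integral>\<^sup>+x. ennreal (indicator {..<r} (dd (y, x))) \<partial>\<mu>)" for y
    proof -
      have "emeasure \<mu> (ball y r) = (\<integral>\<^sup>+x. indicator (ball y r) x \<partial>\<mu>)" by (simp add: sets_mu)
      also have "\<dots> = (\<integral>\<^sup>+x. ennreal (indicator {..<r} (dd (y, x))) \<partial>\<mu>)"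
        by (intro nn_integral_cong) (auto simp: indicator_def)
      finally show ?thesis by (simp add: V_def measure_def)
    qed
    then have "V = (\<lambda>y. enn2real (\<integral>\<^sup>+x. ennreal (indicator {..<r} (dd (y, x))) \<partial>\<mu>))" by (rule ext)
    moreover have "(\<lambda>y. \<integral>\<^sup>+x. ennreal (indicator {..<r} (dd (y, x))) \<partial>\<mu>) \<in> borel_measurable \<mu>"
      by (rule borel_measurable_nn_integral_fst[OF m])
    ultimately have "V \<in> borel_measurable \<mu>" by simp
    then show ?thesis using measurable_cong_sets[OF sets_mu refl] by blast
  qed
  have Im: "I \<in> borel_measurable borel"
  proof -
    have "(\<lambda>z. indicator {..<r} (dd z) * \<bar>f (snd z) - f (fst z)\<bar>) \<in> borel_measurable M2"
      using fm by measurable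
    then have "I \<in> borel_measurable \<mu>" unfolding I_def
      by (intro borel_measurable_lebesgue_integral) (simp add: case_prod_beta')
    then show ?thesis using measurable_cong_sets[OF sets_mu refl] by blast
  qed
  have gm: "(\<lambda>y. g y * mean_osc \<mu> dW \<kappa> r f y) \<in> borel_measurable \<mu>"
    unfolding mo using g(1) Vm Im by measurable
  define S where "S = (\<integral>\<^sup>+y. ennreal (g y * mean_osc \<mu> dW \<kappa> r f y) \<partial>\<mu>)"
  have be: "ball_en g r f = (\<integral>\<^sup>+y. ennreal (g y * I y) \<partial>\<mu>)"
    unfolding ball_en_iterated[OF g fm] I(1) using g(2) I(2) by (simp add: ennreal_mult[symmetric])
  have gI: "(\<lambda>y. ennreal (g y * I y)) \<in> borel_measurable \<mu>" using g(1) Im by measurable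
  have powr_a: "r powr (- a) = 1 / (r powr lam * r powr dH)" unfolding powr_minus_divide a_def powr_add ..
  have up: "c1 * mean_osc \<mu> dW \<kappa> r f y \<le> r powr (- a) * I y" for y
  proof -
    have "c1 / (r powr lam * V y) \<le> 1 / (r powr lam * r powr dH)"
      using V(1)[of y] V(3)[of y] r by (simp add: field_simps)
    from mult_right_mono[OF this I(2)[of y]] show ?thesis unfolding mo powr_a by simp
  qed
  have low: "r powr (- a) * I y \<le> c2 * mean_osc \<mu> dW \<kappa> r f y" for y
  proof -
    have "1 / (r powr lam * r powr dH) \<le> c2 / (r powr lam * V y)"
      using V(2)[of y] V(3)[of y] r by (simp add: field_simps)
    from mult_right_mono[OF this I(2)[of y]] show ?thesis unfolding mo powr_a by simp
  qed
  have gm': "(\<lambda>y. ennreal (g y * mean_osc \<mu> dW \<kappa> r f y)) \<in> borel_measurable \<mu>"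
    using gm by measurable
  have up': "ennreal c1 * S \<le> ennreal (r powr (- a)) * ball_en g r f"
  proof -
    have "ennreal c1 * S = (\<integral>\<^sup>+y. ennreal c1 * ennreal (g y * mean_osc \<mu> dW \<kappa> r f y) \<partial>\<mu>)"
      unfolding S_def by (rule nn_integral_cmult[OF gm', symmetric])
    also have "\<dots> \<le> (\<integral>\<^sup>+y. ennreal (r powr (- a)) * ennreal (g y * I y) \<partial>\<mu>)"
    proof (rule nn_integral_mono)
      fix y
      have "c1 * (g y * mean_osc \<mu> dW \<kappa> r f y) \<le> r powr (- a) * (g y * I y)"
        using mult_left_mono[OF up[of y] g(2)[of y]] by (simp add: mult_ac)
      then show "ennreal c1 * ennreal (g y * mean_osc \<mu> dW \<kappa> r f y) \<le> ennreal (r powr (- a)) * ennreal (g y * I y)"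
        using c_pos g(2) mo0 I(2) by (simp add: ennreal_mult[symmetric] ennreal_leI)
    qed
    also have "\<dots> = ennreal (r powr (- a)) * ball_en g r f" unfolding be by (rule nn_integral_cmult[OF gI])
    finally show ?thesis .
  qed
  have low': "ennreal (r powr (- a)) * ball_en g r f \<le> ennreal c2 * S"
  proof -
    have "ennreal (r powr (- a)) * ball_en g r f = (\<integral>\<^sup>+y. ennreal (r powr (- a)) * ennreal (g y * I y) \<partial>\<mu>)"
      unfolding be by (rule nn_integral_cmult[OF gI, symmetric])
    also have "\<dots> \<le> (\<integral>\<^sup>+y. ennreal c2 * ennreal (g y * mean_osc \<mu> dW \<kappa> r f y) \<partial>\<mu>)"
    proof (rule nn_integral_mono)
      fix y
      have "r powr (- a) * (g y * I y) \<le> c2 * (g y * mean_osc \<mu> dW \<kappa> r f y)"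
        using mult_left_mono[OF low[of y] g(2)[of y]] by (simp add: mult_ac)
      then show "ennreal (r powr (- a)) * ennreal (g y * I y) \<le> ennreal c2 * ennreal (g y * mean_osc \<mu> dW \<kappa> r f y)"
        using c_pos g(2) mo0 I(2) by (simp add: ennreal_mult[symmetric] ennreal_leI)
    qed
    also have "\<dots> = ennreal c2 * S" unfolding S_def by (rule nn_integral_cmult[OF gm'])
    finally show ?thesis .
  qed
  have "ennreal (r powr (- a)) * ball_en g r f < \<top>" using fin by (simp add: ennreal_mult_less_top)
  with up' have "ennreal c1 * S < \<top>" by (rule le_less_trans)
  then have "S < \<top>" using c_pos by (auto simp: ennreal_mult_less_top)
  moreover have "(\<integral>y. g y * mean_osc \<mu> dW \<kappa> r f y \<partial>\<mu>) = enn2real S"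
    unfolding S_def by (rule integral_eq_nn_integral[OF gm]) (simp add: g(2) mo0)
  ultimately have S: "ennreal (\<integral>y. g y * mean_osc \<mu> dW \<kappa> r f y \<partial>\<mu>) = S" by simp
  show "ennreal (r powr (- (lam + dH))) * ball_en g r f \<le> ennreal c2 * ennreal (\<integral>y. g y * mean_osc \<mu> dW \<kappa> r f y \<partial>\<mu>)"
    unfolding S using low' by (simp add: a_def)
  show "ennreal c1 * ennreal (\<integral>y. g y * mean_osc \<mu> dW \<kappa> r f y \<partial>\<mu>) \<le> ennreal (r powr (- (lam + dH))) * ball_en g r f"
    unfolding S using up' by (simp add: a_def)
qed

text \<open>The triangle inequality splits the increment into two halves that are equal by symmetry
  of the distance. The bound grows only like r^dH, which is why it serves for radii away from
  0.\<close>

lemma ball_en_L1: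
  assumes r: "0 < r" and f: "integrable \<mu> f"
  shows "ball_en (\<lambda>_. 1) r f \<le> ennreal (2 * c2 * r powr dH * (\<integral>x. \<bar>f x\<bar> \<partial>\<mu>))"
proof -
  have fm [measurable]: "f \<in> borel_measurable borel" by (rule integrable_borel[OF f])
  define F where "F = (\<integral>x. \<bar>f x\<bar> \<partial>\<mu>)"
  have F: "(\<integral>\<^sup>+x. ennreal \<bar>f x\<bar> \<partial>\<mu>) = ennreal F" "0 \<le> F"
    unfolding F_def using integrable_abs[OF f] by (auto simp: nn_integral_eq_integral)
  define W where "W z = ennreal (\<bar>f (fst z)\<bar>) * ennreal (indicator {..<r} (dd z))" for z :: "'a \<times> 'a"
  have W: "W \<in> borel_measurable M2" unfolding W_def using fm by measurable
  have W': "(\<lambda>z. W (snd z, fst z)) \<in> borel_measurable M2"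
    unfolding W_def using fm by measurable
  have one: "(\<integral>\<^sup>+x. \<integral>\<^sup>+y. W (x, y) \<partial>\<mu> \<partial>\<mu>) \<le> ennreal (c2 * r powr dH * F)"
  proof -
    have "(\<integral>\<^sup>+x. \<integral>\<^sup>+y. W (x, y) \<partial>\<mu> \<partial>\<mu>) \<le> (\<integral>\<^sup>+x. ennreal (c2 * r powr dH) * ennreal \<bar>f x\<bar> \<partial>\<mu>)"
    proof (rule nn_integral_mono)
      fix x
      have "(\<integral>\<^sup>+y. W (x, y) \<partial>\<mu>) = (\<integral>\<^sup>+y. ennreal \<bar>f x\<bar> * indicator (ball x r) y \<partial>\<mu>)"
        by (intro nn_integral_cong) (auto simp: W_def indicator_def)
      also have "\<dots> = ennreal \<bar>f x\<bar> * emeasure \<mu> (ball x r)"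
        by (rule nn_integral_cmult_indicator) (simp add: sets_mu)
      also have "\<dots> \<le> ennreal \<bar>f x\<bar> * ennreal (c2 * r powr dH)"
        using r by (intro mult_left_mono ball_upper) auto
      finally show "(\<integral>\<^sup>+y. W (x, y) \<partial>\<mu>) \<le> ennreal (c2 * r powr dH) * ennreal \<bar>f x\<bar>" by (simp add: mult.commute)
    qed
    also have "\<dots> = ennreal (c2 * r powr dH) * ennreal F"
      unfolding F(1)[symmetric] using fm by (intro nn_integral_cmult) measurable
    finally show ?thesis using c_pos F(2) by (simp add: ennreal_mult)
  qed
  have "ball_en (\<lambda>_. 1) r f \<le> (\<integral>\<^sup>+z. W z + W (snd z, fst z) \<partial>M2)"
    unfolding ball_en_def osc_def
  proof (rule nn_integral_mono)
    fix z :: "'a \<times> 'a"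
    show "ennreal (1 * indicator {..<r} (dd z)) * ennreal \<bar>f (fst z) - f (snd z)\<bar> \<le> W z + W (snd z, fst z)"
      by (auto simp: W_def dist_commute ennreal_plus[symmetric] simp del: ennreal_plus intro!: ennreal_leI split: split_indicator)
  qed
  also have "\<dots> = (\<integral>\<^sup>+z. W z \<partial>M2) + (\<integral>\<^sup>+z. W (snd z, fst z) \<partial>M2)"
    by (rule nn_integral_add[OF W W'])
  also have "(\<integral>\<^sup>+z. W (snd z, fst z) \<partial>M2) = (\<integral>\<^sup>+x. \<integral>\<^sup>+y. W (x, y) \<partial>\<mu> \<partial>\<mu>)"
    using pair.nn_integral_snd[OF W'] by simp
  also have "(\<integral>\<^sup>+z. W z \<partial>M2) = (\<integral>\<^sup>+x. \<integral>\<^sup>+y. W (x, y) \<partial>\<mu> \<partial>\<mu>)"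
    using nn_integral_fst[OF W] by simp
  also have "(\<integral>\<^sup>+x. \<integral>\<^sup>+y. W (x, y) \<partial>\<mu> \<partial>\<mu>) + (\<integral>\<^sup>+x. \<integral>\<^sup>+y. W (x, y) \<partial>\<mu> \<partial>\<mu>) \<le> ennreal (c2 * r powr dH * F) + ennreal (c2 * r powr dH * F)"
    by (intro add_mono one)
  also have "\<dots> = ennreal (2 * c2 * r powr dH * F)"
    using c_pos F(2) by (simp add: ennreal_plus[symmetric] del: ennreal_plus)
  finally show ?thesis by (simp add: F_def)
qed

text \<open>The finite limsup controls radii below some r1; for larger radii the L1 bound is enough,
  since r^(-lam) \<le> r1^(-lam).\<close>

lemma KS_ball_en:
  assumes f: "f \<in> KS \<mu> lam"
  shows "integrable \<mu> f" "\<exists>K\<ge>0. \<forall>r>0. ball_en (\<lambda>_. 1) r f \<le> ennreal (K * r powr (lam + dH))"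
proof -
  show fi: "integrable \<mu> f" using f by (simp add: KS_def)
  have fm [measurable]: "f \<in> borel_measurable borel" by (rule integrable_borel[OF fi])
  define Q where "Q r = (\<integral>\<^sup>+x. \<integral>\<^sup>+y. ennreal (\<bar>f y - f x\<bar> / (r powr lam * measure \<mu> (ball x r))) * indicator (diagonal_nbhd r) (x, y) \<partial>\<mu> \<partial>\<mu>)" for r
  have "Limsup (at_right 0) Q < \<infinity>" using f unfolding KS_def Q_def by simp
  then obtain K0 where K0: "0 \<le> K0" "Limsup (at_right 0) Q < ennreal K0"
  proof (cases "Limsup (at_right 0) Q")
    case (real q)
    then have "Limsup (at_right 0) Q < ennreal (q + 1)" by (simp add: ennreal_lessI)
    then show ?thesis using real by (intro that[of "q + 1"]) auto
  qed simp
  from Limsup_lessD[OF K0(2)] obtain r1 where r1: "0 < r1" "\<And>r. 0 < r \<Longrightarrow> r < r1 \<Longrightarrow> Q r < ennreal K0"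
    unfolding eventually_at_right_field by auto
  define a where "a = lam + dH"
  define F where "F = (\<integral>x. \<bar>f x\<bar> \<partial>\<mu>)"
  have F: "0 \<le> F" unfolding F_def by (rule Bochner_Integration.integral_nonneg) simp
  define K where "K = c2 * K0 + 2 * c2 * F * r1 powr (- lam)"
  have K: "c2 * K0 \<le> K" "2 * c2 * F * r1 powr (- lam) \<le> K" "0 \<le> K" using c_pos K0 F by (auto simp: K_def)
  have "ball_en (\<lambda>_. 1) r f \<le> ennreal (K * r powr a)" if r: "0 < r" for r
  proof (cases "r < r1")
    case True
    define c where "c = c2 * r powr a"
    have c: "0 < c" using c_pos r by (simp add: c_def)
    define W where "W x y = ennreal (indicator {..<r} (dist x y) * \<bar>f y - f x\<bar>)" for x y
    have Wm: "(\<lambda>z. W (fst z) (snd z)) \<in> borel_measurable M2"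
      unfolding W_def using fm by measurable
    have "ennreal (1 / c) * ball_en (\<lambda>_. 1) r f = ennreal (1 / c) * (\<integral>\<^sup>+x. \<integral>\<^sup>+y. W x y \<partial>\<mu> \<partial>\<mu>)"
      using ball_en_iterated[of "\<lambda>_. 1" f r] by (simp add: W_def)
    also have "\<dots> = (\<integral>\<^sup>+x. ennreal (1 / c) * (\<integral>\<^sup>+y. W x y \<partial>\<mu>) \<partial>\<mu>)"
      using borel_measurable_nn_integral_fst[OF Wm] by (intro nn_integral_cmult[symmetric]) simp
    also have "\<dots> \<le> Q r" unfolding Q_def
    proof (rule nn_integral_mono)
      fix x
      define V where "V = measure \<mu> (ball x r)"
      have V: "V \<le> c2 * r powr dH" "0 < V" unfolding V_def using measure_ball_bounds[OF r] by auto
      have "W x \<in> borel_measurable \<mu>" unfolding W_def using fm by measurable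
      then have "ennreal (1 / c) * (\<integral>\<^sup>+y. W x y \<partial>\<mu>) = (\<integral>\<^sup>+y. ennreal (1 / c) * W x y \<partial>\<mu>)"
        by (rule nn_integral_cmult[symmetric])
      also have "\<dots> \<le> (\<integral>\<^sup>+y. ennreal (\<bar>f y - f x\<bar> / (r powr lam * V)) * indicator (diagonal_nbhd r) (x, y) \<partial>\<mu>)"
      proof (rule nn_integral_mono)
        fix y
        have "r powr lam * V \<le> c"
          using mult_left_mono[OF V(1), of "r powr lam"] by (simp add: c_def a_def powr_add mult_ac)
        then have "1 / c * \<bar>f y - f x\<bar> \<le> \<bar>f y - f x\<bar> / (r powr lam * V)"
          using c V(2) r by (simp add: divide_left_mono)
        then have "ennreal (1 / c) * ennreal \<bar>f y - f x\<bar> \<le> ennreal (\<bar>f y - f x\<bar> / (r powr lam * V))"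
          using c by (simp add: ennreal_mult[symmetric] ennreal_leI)
        then show "ennreal (1 / c) * W x y \<le> ennreal (\<bar>f y - f x\<bar> / (r powr lam * V)) * indicator (diagonal_nbhd r) (x, y)"
          by (simp add: W_def diagonal_nbhd_def split: split_indicator)
      qed
      finally show "ennreal (1 / c) * (\<integral>\<^sup>+y. W x y \<partial>\<mu>) \<le> (\<integral>\<^sup>+y. ennreal (\<bar>f y - f x\<bar> / (r powr lam * measure \<mu> (ball x r))) * indicator (diagonal_nbhd r) (x, y) \<partial>\<mu>)"
        by (simp add: V_def)
    qed
    also have "\<dots> \<le> ennreal K0" using r1(2)[OF r True] by simp
    finally have "ennreal c * (ennreal (1 / c) * ball_en (\<lambda>_. 1) r f) \<le> ennreal c * ennreal K0" by (rule mult_left_mono) simp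
    moreover have "ennreal c * (ennreal (1 / c) * ball_en (\<lambda>_. 1) r f) = ball_en (\<lambda>_. 1) r f"
      using c by (simp add: mult.assoc[symmetric] ennreal_mult[symmetric])
    ultimately have "ball_en (\<lambda>_. 1) r f \<le> ennreal (c * K0)" using c K0 by (simp add: ennreal_mult)
    also have "\<dots> \<le> ennreal (K * r powr a)"
      using mult_right_mono[OF K(1), of "r powr a"] by (intro ennreal_leI) (simp add: c_def mult_ac)
    finally show ?thesis .
  next
    case False
    have "r powr (- lam) \<le> r1 powr (- lam)" using False r1(1) lam_pos by (intro powr_mono2') auto
    then have "2 * c2 * F * r powr (- lam) \<le> 2 * c2 * F * r1 powr (- lam)"
      using c_pos F by (intro mult_left_mono) auto
    then have "2 * c2 * F * r powr (- lam) \<le> K" using K(2) by linarith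
    then have "2 * c2 * F * r powr (- lam) * r powr a \<le> K * r powr a" by (rule mult_right_mono) simp
    moreover have "r powr (- lam) * r powr a = r powr dH" using r by (simp add: powr_add[symmetric] a_def)
    ultimately have "2 * c2 * r powr dH * F \<le> K * r powr a" by (simp add: mult_ac)
    then show ?thesis using ball_en_L1[OF r fi] by (auto simp: F_def intro: order_trans ennreal_leI)
  qed
  then show "\<exists>K\<ge>0. \<forall>r>0. ball_en (\<lambda>_. 1) r f \<le> ennreal (K * r powr (lam + dH))"
    using K(3) by (auto simp: a_def)
qed

text \<open>Along the defining sequence of \<gamma>, the integral of g is comparable to the limit of
  the ball energies, which lies between their liminf and limsup over all r. The lower kernel bound
  and the limit comparison enclose both in terms of heat energies, so the sequence leaves no
  trace.\<close>

lemma BV_measure_bounds: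
  "\<exists>c>0. \<exists>C>0. \<forall>f\<in>KS \<mu> lam. \<forall>\<gamma> g M. is_BV_measure \<mu> dW \<kappa> f \<gamma> \<longrightarrow> g \<in> C0 \<longrightarrow>
    uniformly_continuous_on UNIV g \<longrightarrow> (\<forall>x. 0 \<le> g x \<and> g x \<le> M) \<longrightarrow>
    ennreal c * Limsup (at_right 0) (\<lambda>t. \<integral>\<^sup>+y. ennreal (g y) * heat_osc \<mu> p dW \<kappa> t f y \<partial>\<mu>) \<le> (\<integral>\<^sup>+y. ennreal (g y) \<partial>\<gamma>) \<and>
    (\<integral>\<^sup>+y. ennreal (g y) \<partial>\<gamma>) \<le> ennreal C * Liminf (at_right 0) (\<lambda>t. \<integral>\<^sup>+y. ennreal (g y) * heat_osc \<mu> p dW \<kappa> t f y \<partial>\<mu>)"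
proof -
  obtain C where C: "0 < C" and H: "\<forall>f g M K. integrable \<mu> f \<longrightarrow> 0 \<le> K \<longrightarrow>
    (\<forall>r>0. ball_en (\<lambda>_. 1) r f \<le> ennreal (K * r powr (lam + dH))) \<longrightarrow>
    uniformly_continuous_on UNIV g \<longrightarrow> (\<forall>x. 0 \<le> g x \<and> g x \<le> M) \<longrightarrow>
    Limsup (at_right 0) (\<lambda>t. ennreal (t powr (- (lam / dW))) * heat_en g t f)
      \<le> ennreal C * Liminf (at_right 0) (\<lambda>r. ennreal (r powr (- (lam + dH))) * ball_en g r f)"
    using heat_ball_limit by (elim exE conjE) (rule that; assumption)
  define C' where "C' = exp c6 / c5"
  have C': "0 < C'" using c_pos by (simp add: C'_def)
  define cl where "cl = 1 / (C * c2)"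
  have cl: "0 < cl" "cl * (C * c2) = 1" using C c_pos by (auto simp: cl_def)
  \<comment> \<open>From \<gamma> to the limsup of heat energies (C'/c1), from there to the liminf
    of ball energies (C), and back to the liminf of heat energies (C').\<close>
  define cu where "cu = C' * C * C' / c1"
  have cu: "0 < cu" using C C' c_pos by (simp add: cu_def)
  have main: "ennreal cl * Limsup (at_right 0) (\<lambda>t. \<integral>\<^sup>+y. ennreal (g y) * heat_osc \<mu> p dW \<kappa> t f y \<partial>\<mu>) \<le> (\<integral>\<^sup>+y. ennreal (g y) \<partial>\<gamma>) \<and>
    (\<integral>\<^sup>+y. ennreal (g y) \<partial>\<gamma>) \<le> ennreal cu * Liminf (at_right 0) (\<lambda>t. \<integral>\<^sup>+y. ennreal (g y) * heat_osc \<mu> p dW \<kappa> t f y \<partial>\<mu>)"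
    if fK: "f \<in> KS \<mu> lam" and bv: "is_BV_measure \<mu> dW \<kappa> f \<gamma>" and gC: "g \<in> C0"
      and ug: "uniformly_continuous_on UNIV g" and g: "\<And>x. 0 \<le> g x" "\<And>x. g x \<le> M" for f \<gamma> g M
  proof -
    have f: "integrable \<mu> f" by (rule KS_ball_en[OF fK])
    have fm: "f \<in> borel_measurable borel" by (rule integrable_borel[OF f])
    obtain K where K: "0 \<le> K" "\<And>r. 0 < r \<Longrightarrow> ball_en (\<lambda>_. 1) r f \<le> ennreal (K * r powr (lam + dH))"
      using KS_ball_en(2)[OF fK] by blast
    have gm: "g \<in> borel_measurable borel"
      by (intro borel_measurable_continuous_onI uniformly_continuous_imp_continuous ug)
    have M: "0 \<le> M" using g order_trans by blast
    define N where "N t = ennreal (t powr (- (lam / dW))) * heat_en g t f" for t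
    define m where "m r = ennreal (r powr (- (lam + dH))) * ball_en g r f" for r
    have Nosc: "(\<integral>\<^sup>+y. ennreal (g y) * heat_osc \<mu> p dW \<kappa> t f y \<partial>\<mu>) = N t" if "0 < t" for t
      unfolding N_def by (rule heat_osc_integral[OF that gm g(1) fm])
    have bfin: "ball_en g r f < \<infinity>" if r: "0 < r" for r
    proof -
      have "ball_en g r f \<le> osc (\<lambda>z. M * (1 * indicator {..<r} (dd z))) f" unfolding ball_en_def
        using g by (intro osc_mono) (auto split: split_indicator)
      also have "\<dots> = ennreal M * ball_en (\<lambda>_. 1) r f" unfolding ball_en_def
        using fm M by (intro osc_cmult) auto
      also have "\<dots> < \<infinity>" using K(2)[OF r] by (auto simp: ennreal_mult_less_top intro: le_less_trans)
      finally show ?thesis .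
    qed
    have mN: "m r \<le> ennreal C' * N (r powr dW)" if r: "0 < r" for r
    proof -
      have "m r \<le> ennreal (r powr (- (lam + dH))) * (ennreal (C' * r powr dH) * heat_en g (r powr dW) f)"
        unfolding m_def C'_def by (intro mult_left_mono ball_en_le r gm g fm) simp
      also have "\<dots> = ennreal (r powr (- (lam + dH)) * (C' * r powr dH)) * heat_en g (r powr dW) f"
        using C' by (simp add: mult.assoc[symmetric] ennreal_mult[symmetric])
      also have "r powr (- (lam + dH)) * (C' * r powr dH) = C' * (r powr dW) powr (- (lam / dW))"
        using r dW_pos by (simp add: powr_powr powr_add[symmetric])
      finally show ?thesis using C' by (simp add: N_def mult.assoc[symmetric] ennreal_mult[symmetric])
    qed
    have lim: "Limsup (at_right 0) N \<le> ennreal C * Liminf (at_right 0) m"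
      unfolding N_def m_def using H[rule_format, OF f K ug] g by blast
    obtain r where r: "\<And>n. 0 < r n" "r \<longlonglongrightarrow> 0" and ig: "integrable \<gamma> g"
      and conv: "(\<lambda>n. \<integral>y. g y * mean_osc \<mu> dW \<kappa> (r n) f y \<partial>\<mu>) \<longlonglongrightarrow> (\<integral>y. g y \<partial>\<gamma>)"
      using bv gC unfolding is_BV_measure_def by blast
    define S where "S = (\<integral>\<^sup>+y. ennreal (g y) \<partial>\<gamma>)"
    define I where "I n = ennreal (\<integral>y. g y * mean_osc \<mu> dW \<kappa> (r n) f y \<partial>\<mu>)" for n
    have "S = ennreal (\<integral>y. g y \<partial>\<gamma>)" unfolding S_def by (rule nn_integral_eq_integral[OF ig]) (simp add: g)
    then have IS: "I \<longlonglongrightarrow> S" unfolding I_def using tendsto_ennrealI[OF conv] by simp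
    have rn: "r n \<noteq> 0" for n using r(1)[of n] by simp
    have fr: "filterlim r (at_right 0) sequentially" unfolding filterlim_at using r rn by simp
    have Liminf_I: "Liminf sequentially I = S" "Limsup sequentially I = S"
      using lim_imp_Liminf[OF _ IS] lim_imp_Limsup[OF _ IS] by auto
    have nb: "sequentially \<noteq> bot" "at_right (0::real) \<noteq> bot" by auto
    have "Liminf (at_right 0) m \<le> Liminf sequentially (\<lambda>n. m (r n))" by (rule Liminf_filterlim_le[OF fr])
    also have "\<dots> \<le> Liminf sequentially (\<lambda>n. ennreal c2 * I n)"
      unfolding m_def I_def
      by (intro Liminf_mono always_eventually allI mean_osc_integral(1)[OF r(1) f gm g(1) bfin[OF r(1)]])
    also have "\<dots> = ennreal c2 * S" using Liminf_cmult_ennreal[OF nb(1), of c2 I] Liminf_I by simp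
    finally have "Limsup (at_right 0) N \<le> ennreal C * (ennreal c2 * S)"
      using lim mult_left_mono[of "Liminf (at_right 0) m" "ennreal c2 * S" "ennreal C"] by (meson order_trans zero_le)
    then have "ennreal cl * Limsup (at_right 0) N \<le> ennreal cl * (ennreal C * (ennreal c2 * S))"
      by (rule mult_left_mono) simp
    also have "\<dots> = ennreal (cl * (C * c2)) * S"
      using cl(1) C c_pos(2) by (simp add: ennreal_mult mult.assoc)
    finally have A: "ennreal cl * Limsup (at_right 0) N \<le> S" by (simp add: cl(2))
    have fr2: "filterlim (\<lambda>n. r n powr dW) (at_right 0) sequentially"
      unfolding filterlim_at
    proof
      have "(\<lambda>n. r n powr dW) \<longlonglongrightarrow> 0 powr dW"
        using r dW_pos by (intro tendsto_powr' tendsto_intros) (auto simp: less_imp_le)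
      then show "(\<lambda>n. r n powr dW) \<longlonglongrightarrow> 0" by simp
      show "\<forall>\<^sub>F n in sequentially. r n powr dW \<in> {0<..} \<and> r n powr dW \<noteq> 0"
        using r(1) by (auto simp: less_imp_neq[symmetric])
    qed
    have "ennreal c1 * S = Limsup sequentially (\<lambda>n. ennreal c1 * I n)"
      using Limsup_cmult_ennreal[OF nb(1), of c1 I] Liminf_I by simp
    also have "\<dots> \<le> Limsup sequentially (\<lambda>n. ennreal C' * N (r n powr dW))"
    proof (intro Limsup_mono always_eventually allI)
      fix n
      have "ennreal c1 * I n \<le> m (r n)" unfolding m_def I_def
        by (rule mean_osc_integral(2)[OF r(1) f gm g(1) bfin[OF r(1)]])
      also have "\<dots> \<le> ennreal C' * N (r n powr dW)" by (rule mN[OF r(1)])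
      finally show "ennreal c1 * I n \<le> ennreal C' * N (r n powr dW)" .
    qed
    also have "\<dots> = ennreal C' * Limsup sequentially (\<lambda>n. N (r n powr dW))"
      by (rule Limsup_cmult_ennreal[OF nb(1)])
    also have "\<dots> \<le> ennreal C' * Limsup (at_right 0) N"
      by (intro mult_left_mono Limsup_filterlim_ge[OF fr2]) simp
    also have "\<dots> \<le> ennreal C' * (ennreal C * Liminf (at_right 0) m)"
      by (intro mult_left_mono lim) simp
    also have "\<dots> \<le> ennreal C' * (ennreal C * (ennreal C' * Liminf (at_right 0) N))"
    proof (intro mult_left_mono)
      have "Liminf (at_right 0) m \<le> Liminf (at_right 0) (\<lambda>t. m (sc t))"
        by (rule Liminf_filterlim_le[OF filterlim_sc])
      also have "\<dots> \<le> Liminf (at_right 0) (\<lambda>t. ennreal C' * N t)"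
      proof (rule Liminf_mono)
        show "\<forall>\<^sub>F t in at_right 0. m (sc t) \<le> ennreal C' * N t"
          using eventually_at_right_less[of 0]
        proof eventually_elim
          case (elim t)
          then show ?case using mN[OF sc_pos[OF elim]] sc_powr_dW[OF elim] by simp
        qed
      qed
      also have "\<dots> = ennreal C' * Liminf (at_right 0) N" by (rule Liminf_cmult_ennreal[OF nb(2)])
      finally show "Liminf (at_right 0) m \<le> ennreal C' * Liminf (at_right 0) N" .
    qed auto
    finally have "ennreal (1 / c1) * (ennreal c1 * S) \<le> ennreal (1 / c1) * (ennreal C' * (ennreal C * (ennreal C' * Liminf (at_right 0) N)))"
      by (rule mult_left_mono) simp
    moreover have "ennreal (1 / c1) * (ennreal c1 * S) = S"
      using c_pos by (simp add: mult.assoc[symmetric] ennreal_mult[symmetric])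
    moreover have "ennreal (1 / c1) * (ennreal C' * (ennreal C * (ennreal C' * Liminf (at_right 0) N))) = ennreal cu * Liminf (at_right 0) N"
      using c_pos C C' by (simp add: mult.assoc[symmetric] ennreal_mult[symmetric] cu_def)
    ultimately have B: "S \<le> ennreal cu * Liminf (at_right 0) N" by simp
    have evN: "\<forall>\<^sub>F t in at_right 0. (\<integral>\<^sup>+y. ennreal (g y) * heat_osc \<mu> p dW \<kappa> t f y \<partial>\<mu>) = N t"
      using eventually_at_right_less[of 0] by eventually_elim (rule Nosc)
    have "Limsup (at_right 0) (\<lambda>t. \<integral>\<^sup>+y. ennreal (g y) * heat_osc \<mu> p dW \<kappa> t f y \<partial>\<mu>) = Limsup (at_right 0) N"
      by (rule Limsup_eq[OF evN])
    moreover have "Liminf (at_right 0) (\<lambda>t. \<integral>\<^sup>+y. ennreal (g y) * heat_osc \<mu> p dW \<kappa> t f y \<partial>\<mu>) = Liminf (at_right 0) N"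
      by (rule Liminf_eq[OF evN])
    ultimately show ?thesis using A B unfolding S_def by simp
  qed
  show ?thesis
  proof (rule exI[of _ cl], rule conjI[OF cl(1)], rule exI[of _ cu], rule conjI[OF cu], intro ballI allI impI)
    fix f \<gamma> M and g :: "'a \<Rightarrow> real"
    assume "f \<in> KS \<mu> lam" "is_BV_measure \<mu> dW \<kappa> f \<gamma>" "g \<in> C0" "uniformly_continuous_on UNIV g" "\<forall>x. 0 \<le> g x \<and> g x \<le> M"
    then show "ennreal cl * Limsup (at_right 0) (\<lambda>t. \<integral>\<^sup>+y. ennreal (g y) * heat_osc \<mu> p dW \<kappa> t f y \<partial>\<mu>) \<le> (\<integral>\<^sup>+y. ennreal (g y) \<partial>\<gamma>) \<and>
    (\<integral>\<^sup>+y. ennreal (g y) \<partial>\<gamma>) \<le> ennreal cu * Liminf (at_right 0) (\<lambda>t. \<integral>\<^sup>+y. ennreal (g y) * heat_osc \<mu> p dW \<kappa> t f y \<partial>\<mu>)"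
      by (intro main) auto
  qed
qed

section \<open>Admissible test functions and comparison of Radon measures\<close>

lemma heat_class_regular:
  assumes "g \<in> heat_class \<mu> p"
  shows "g \<in> C0" "uniformly_continuous_on UNIV g" "\<exists>M. \<forall>x. \<bar>g x\<bar> \<le> M"
proof -
  obtain t u where t: "0 < t" and u: "u \<in> Cc" and gdef: "g = P t u"
    using assms unfolding heat_class_def by auto
  have um: "u \<in> borel_measurable borel" by (rule Cc_borel[OF u])
  obtain M where M: "0 < M" and ub: "\<And>x. \<bar>u x\<bar> \<le> M" using Cc_bounded[OF u] by blast
  show uc: "uniformly_continuous_on UNIV g" unfolding gdef by (rule heat_uniformly_continuous[OF t um ub])
  show "\<exists>M. \<forall>x. \<bar>g x\<bar> \<le> M" unfolding gdef using heat_abs_le_bound[OF t um ub] by blast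
  have cont: "continuous_on UNIV g" by (rule uniformly_continuous_imp_continuous[OF uc])
  fix x0 :: 'a
  have "bounded {x. u x \<noteq> 0}"
    using u compact_imp_bounded bounded_subset closure_subset unfolding Cc_def by blast
  then obtain R where R: "\<And>x. u x \<noteq> 0 \<Longrightarrow> dist x0 x \<le> R"
    unfolding bounded_any_center[where a=x0] by blast
  obtain C1 where C1: "0 < C1" and mom: "\<forall>s>0. \<forall>\<delta>>0. \<forall>u x. u \<in> borel_measurable borel \<longrightarrow> (\<forall>y. \<bar>u y\<bar> \<le> 1) \<longrightarrow>
    (\<forall>y\<in>ball x \<delta>. u y = 0) \<longrightarrow> \<bar>P s u x\<bar> \<le> C1 * (sc s / \<delta>) powr 1"
    using heat_tail[of 1] by auto
  have decay: "\<bar>g x\<bar> \<le> M * (C1 * (sc t / D))" if D: "0 < D" and x: "R + D \<le> dist x0 x" for x D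
  proof -
    have "\<bar>P t (\<lambda>y. u y / M) x\<bar> \<le> C1 * (sc t / D) powr 1"
    proof (rule mom[rule_format, OF t D])
      show "(\<lambda>y. u y / M) \<in> borel_measurable borel" using um by simp
      show "\<bar>u y / M\<bar> \<le> 1" for y using ub[of y] M by simp
      fix y assume "y \<in> ball x D"
      then have "R < dist x0 y" using x dist_triangle[of x0 x y] by (simp add: dist_commute)
      then show "u y / M = 0" using R[of y] by auto
    qed
    moreover have "P t (\<lambda>y. u y / M) x = g x / M"
      using heat_cmult[of t "1 / M" u x] by (simp add: gdef)
    ultimately show ?thesis using M sc_pos[OF t] D by (simp add: field_simps)
  qed
  show "g \<in> C0" unfolding C0_def
  proof (intro CollectI allI impI)
    fix e :: real assume e: "0 < e"
    \<comment> \<open>The distance from the support of u at which the tail bound for g has come down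
      to e.\<close>
    define D where "D = M * C1 * sc t / e"
    have D: "0 < D" using M C1 sc_pos[OF t] e by (simp add: D_def)
    \<comment> \<open>Soft thresholding: h is continuous, differs from g by at most e and vanishes
      where |g| \<le> e, hence outside a ball whose closure is compact.\<close>
    define h where "h x = g x - max (- e) (min e (g x))" for x
    have "continuous_on UNIV h" unfolding h_def by (intro continuous_intros cont)
    moreover have "compact (closure {x. h x \<noteq> 0})"
    proof -
      have "{x. h x \<noteq> 0} \<subseteq> ball x0 (\<bar>R\<bar> + D)"
      proof
        fix x assume "x \<in> {x. h x \<noteq> 0}"
        then have "e < \<bar>g x\<bar>" using e by (auto simp: h_def max_def min_def abs_if split: if_splits)
        moreover have "M * (C1 * (sc t / D)) = e" using M C1 sc_pos[OF t] e by (simp add: D_def)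
        ultimately have "\<not> R + D \<le> dist x0 x" using decay[OF D, of x] by auto
        then show "x \<in> ball x0 (\<bar>R\<bar> + D)" by simp
      qed
      then have "closure {x. h x \<noteq> 0} \<subseteq> closure (ball x0 (\<bar>R\<bar> + D))" by (rule closure_mono)
      moreover have "compact (closure (ball x0 (\<bar>R\<bar> + D)))" using D by (intro compact_balls) auto
      ultimately show ?thesis using closed_closure compact_Int_closed by (metis inf.absorb_iff2)
    qed
    moreover have "\<bar>g x - h x\<bar> \<le> e" for x using e by (auto simp: h_def)
    ultimately show "\<exists>h\<in>Cc. \<forall>x. \<bar>g x - h x\<bar> \<le> e" unfolding Cc_def by blast
  qed
qed

lemma radon_sigma_finite:
  fixes \<gamma> :: "'a measure"
  assumes "radon_measure \<gamma>"
  shows "sigma_finite_measure \<gamma>"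
proof
  fix x0 :: 'a
  have s: "sets \<gamma> = sets borel" by (rule radon_measureD(1)[OF assms])
  have f: "emeasure \<gamma> (closure (ball x0 (real (Suc n)))) < \<infinity>" for n
    by (rule radon_measureD(2)[OF assms compact_balls]) simp
  have "x \<in> (\<Union>n. closure (ball x0 (real (Suc n))))" for x
  proof -
    obtain n where "dist x0 x < real n" using reals_Archimedean2 by blast
    then have "x \<in> closure (ball x0 (real (Suc n)))" using closure_subset by fastforce
    then show ?thesis by blast
  qed
  then have "(\<Union>n. closure (ball x0 (real (Suc n)))) = space \<gamma>" using sets_eq_imp_space_eq[OF s] by auto
  then show "\<exists>A. countable A \<and> A \<subseteq> sets \<gamma> \<and> \<Union>A = space \<gamma> \<and> (\<forall>a\<in>A. emeasure \<gamma> a \<noteq> \<infinity>)"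
    using f by (intro exI[of _ "range (\<lambda>n. closure (ball x0 (real (Suc n))))"]) (auto simp: s less_top[symmetric])
qed

text \<open>For C compact inside U open, a Lipschitz cut-off between their indicators gives the
  inequality between \<gamma>(C) and \<gamma>'(U). Inner regularity of \<gamma> on open sets and
  outer regularity of \<gamma>' extend it to Borel sets. The hypothesis is limited to uniformly
  continuous functions because only those are covered by the energy comparison.\<close>

lemma radon_measure_le:
  fixes \<gamma> \<gamma>' :: "'a measure"
  assumes r: "radon_measure \<gamma>" "radon_measure \<gamma>'" and K: "0 < K"
    and H: "\<And>u. u \<in> Cc \<Longrightarrow> uniformly_continuous_on UNIV u \<Longrightarrow> (\<And>x. 0 \<le> u x \<and> u x \<le> 1) \<Longrightarrow>
      (\<integral>\<^sup>+x. ennreal (u x) \<partial>\<gamma>) \<le> ennreal K * (\<integral>\<^sup>+x. ennreal (u x) \<partial>\<gamma>')"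
    and A: "A \<in> sets borel"
  shows "emeasure \<gamma> A \<le> ennreal K * emeasure \<gamma>' A"
proof -
  have s: "sets \<gamma> = sets borel" "sets \<gamma>' = sets borel" by (rule radon_measureD(1)[OF r(1)], rule radon_measureD(1)[OF r(2)])
  have compact_le: "emeasure \<gamma> C \<le> ennreal K * emeasure \<gamma>' U" if C: "compact C" and U: "open U" "C \<subseteq> U" for C U
  proof (cases "C = {}")
    case False
    obtain e where e: "0 < e" "(\<Union>x\<in>C. ball x e) \<subseteq> U"
      using compact_subset_open_imp_ball_epsilon_subset[OF C U] by blast
    \<comment> \<open>Its support condition uses that the e-neighbourhood of C is inside U, and
      slope 1/e yields uniform continuity.\<close>
    define u where "u x = max 0 (1 - infdist x C / e)" for x
    have supp: "\<exists>y\<in>C. dist x y < e" if "u x \<noteq> 0" for x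
    proof -
      have "infdist x C < e" using that e by (auto simp: u_def max_def field_simps split: if_splits)
      then show ?thesis unfolding infdist_notempty[OF False] using False by (subst (asm) cINF_less_iff) auto
    qed
    have Lip: "\<bar>u x - u y\<bar> \<le> 1 / e * dist x y powr 1" for x y
    proof -
      have "\<bar>u x - u y\<bar> \<le> \<bar>(1 - infdist x C / e) - (1 - infdist y C / e)\<bar>" unfolding u_def by linarith
      also have "\<dots> = \<bar>infdist y C - infdist x C\<bar> / e" using e by (simp add: diff_divide_distrib[symmetric] abs_divide)
      also have "\<dots> \<le> dist x y / e" using infdist_triangle_abs[of y C x] e by (simp add: divide_right_mono dist_commute)
      finally show ?thesis by simp
    qed
    have uc: "uniformly_continuous_on UNIV u" by (rule uniformly_continuous_Hoelder[OF _ Lip]) simp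
    have u01: "0 \<le> u x \<and> u x \<le> 1" for x using infdist_nonneg[of x C] e by (simp add: u_def)
    have "u \<in> Cc"
    proof -
      fix x0 :: 'a
      obtain R where R: "\<And>y. y \<in> C \<Longrightarrow> dist x0 y \<le> R"
        using compact_imp_bounded[OF C] unfolding bounded_any_center[where a=x0] by blast
      have "{x. u x \<noteq> 0} \<subseteq> ball x0 (\<bar>R\<bar> + e)"
      proof
        fix x assume "x \<in> {x. u x \<noteq> 0}"
        then obtain y where "y \<in> C" "dist x y < e" using supp by blast
        then show "x \<in> ball x0 (\<bar>R\<bar> + e)" using R[of y] dist_triangle[of x0 x y] by (simp add: dist_commute)
      qed
      then have "closure {x. u x \<noteq> 0} \<subseteq> closure (ball x0 (\<bar>R\<bar> + e))" by (rule closure_mono)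
      moreover have "compact (closure (ball x0 (\<bar>R\<bar> + e)))" using e by (intro compact_balls) auto
      ultimately have "compact (closure {x. u x \<noteq> 0})" using closed_closure compact_Int_closed by (metis inf.absorb_iff2)
      then show ?thesis using uniformly_continuous_imp_continuous[OF uc] by (simp add: Cc_def)
    qed
    have "emeasure \<gamma> C = (\<integral>\<^sup>+x. indicator C x \<partial>\<gamma>)" using C s by (simp add: compact_imp_closed)
    also have "\<dots> \<le> (\<integral>\<^sup>+x. ennreal (u x) \<partial>\<gamma>)"
      by (intro nn_integral_mono) (auto simp: u_def split: split_indicator)
    also have "\<dots> \<le> ennreal K * (\<integral>\<^sup>+x. ennreal (u x) \<partial>\<gamma>')" by (rule H[OF \<open>u \<in> Cc\<close> uc u01])
    also have "\<dots> \<le> ennreal K * (\<integral>\<^sup>+x. indicator U x \<partial>\<gamma>')"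
    proof (intro mult_left_mono nn_integral_mono)
      fix x
      show "ennreal (u x) \<le> indicator U x"
      proof (cases "u x = 0")
        case False
        then have "x \<in> U" using supp[OF False] e(2) by (force simp: dist_commute)
        then show ?thesis using u01[of x] by simp
      qed simp
    qed simp
    also have "(\<integral>\<^sup>+x. indicator U x \<partial>\<gamma>') = emeasure \<gamma>' U" using U s by simp
    finally show ?thesis .
  qed simp
  have open_le: "emeasure \<gamma> U \<le> ennreal K * emeasure \<gamma>' U" if U: "open U" for U
  proof -
    have "emeasure \<gamma> U = (SUP C\<in>{C. compact C \<and> C \<subseteq> U}. emeasure \<gamma> C)"
      by (rule radon_measureD(4)[OF r(1) U])
    also have "\<dots> \<le> ennreal K * emeasure \<gamma>' U" by (rule SUP_least) (use compact_le U in auto)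
    finally show ?thesis .
  qed
  have "emeasure \<gamma> A \<le> ennreal K * y" if y: "emeasure \<gamma>' A < y" for y
  proof -
    have "emeasure \<gamma>' A = (INF U\<in>{U. open U \<and> A \<subseteq> U}. emeasure \<gamma>' U)"
      by (rule radon_measureD(3)[OF r(2) A])
    with y obtain U where U: "open U" "A \<subseteq> U" "emeasure \<gamma>' U < y" by (auto simp: INF_less_iff)
    have "emeasure \<gamma> A \<le> emeasure \<gamma> U" using U s by (intro emeasure_mono) auto
    also have "\<dots> \<le> ennreal K * emeasure \<gamma>' U" by (rule open_le[OF U(1)])
    also have "\<dots> \<le> ennreal K * y" using U(3) by (intro mult_left_mono) auto
    finally show ?thesis .
  qed
  note bound = this
  show ?thesis
  proof (cases "emeasure \<gamma>' A")
    case top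
    then show ?thesis using K by (simp add: ennreal_mult_top)
  next
    case (real a)
    have "emeasure \<gamma> A \<le> ennreal (K * a) + ennreal e" if e: "0 < e" for e
    proof -
      have "emeasure \<gamma> A \<le> ennreal K * ennreal (a + e / K)"
        using real e K by (intro bound) (auto intro!: ennreal_lessI)
      also have "\<dots> = ennreal (K * a + e)" using real(1) e K by (simp add: ennreal_mult[symmetric] distrib_left)
      finally show ?thesis using real(1) e K by (simp add: ennreal_plus)
    qed
    then have "emeasure \<gamma> A \<le> ennreal (K * a)" by (rule ennreal_le_epsilon)
    then show ?thesis using real K by (simp add: ennreal_mult)
  qed
qed

end

theorem theorem4p24:
  fixes \<mu> :: "'a::metric_space measure"
    and \<E> :: "('a \<Rightarrow> real) \<Rightarrow> ('a \<Rightarrow> real) \<Rightarrow> real"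
    and \<F> :: "('a \<Rightarrow> real) set"
    and p :: "real \<Rightarrow> 'a \<Rightarrow> 'a \<Rightarrow> real"
    and d\<^sub>H d\<^sub>W \<kappa> :: real
  assumes "sub_gaussian_dirichlet_space \<mu> \<E> \<F> p d\<^sub>H d\<^sub>W"
    and "ereal \<kappa> = ereal d\<^sub>W - critical_exponent \<mu>"
    and "wBE \<mu> p d\<^sub>W \<kappa>"
  shows "(\<exists>c>0. \<exists>C>0. \<forall>f \<in> BV \<mu> \<inter> Linf \<mu>. \<forall>\<gamma>. is_BV_measure \<mu> d\<^sub>W \<kappa> f \<gamma> \<longrightarrow>
           (\<forall>g \<in> heat_class \<mu> p. (\<forall>y. 0 \<le> g y) \<longrightarrow>
              ennreal c * Limsup (at_right 0) (\<lambda>t. \<integral>\<^sup>+y. ennreal (g y) * heat_osc \<mu> p d\<^sub>W \<kappa> t f y \<partial>\<mu>)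
                \<le> (\<integral>\<^sup>+y. ennreal (g y) \<partial>\<gamma>) \<and>
              (\<integral>\<^sup>+y. ennreal (g y) \<partial>\<gamma>)
                \<le> ennreal C * Liminf (at_right 0) (\<lambda>t. \<integral>\<^sup>+y. ennreal (g y) * heat_osc \<mu> p d\<^sub>W \<kappa> t f y \<partial>\<mu>)))
       \<and> (\<exists>K>0. \<forall>f \<in> BV \<mu> \<inter> Linf \<mu>. \<forall>\<gamma> \<gamma>'.
           is_BV_measure \<mu> d\<^sub>W \<kappa> f \<gamma> \<longrightarrow> is_BV_measure \<mu> d\<^sub>W \<kappa> f \<gamma>' \<longrightarrow>
             absolutely_continuous \<gamma> \<gamma>' \<and> absolutely_continuous \<gamma>' \<gamma> \<and>
             (\<exists>h \<in> borel_measurable borel. \<gamma>' = density \<gamma> h \<and> (AE x in \<gamma>. h x \<le> ennreal K)))"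
proof -
  interpret S: sub_gaussian_dirichlet_space \<mu> \<E> \<F> p d\<^sub>H d\<^sub>W by (rule assms(1))
  obtain c1 c2 c3 c4 c5 c6 cB where "heat_kernel_wBE \<mu> p d\<^sub>H d\<^sub>W \<kappa> c1 c2 c3 c4 c5 c6 cB"
    using S.heat_kernel_wBE_exists[OF assms(3)] by blast
  then interpret W: heat_kernel_wBE \<mu> p d\<^sub>H d\<^sub>W \<kappa> c1 c2 c3 c4 c5 c6 cB .
  \<comment> \<open>Equality with a real \<kappa> excludes infinite exponents, so
    \<open>real_of_ereal\<close> in the definition of BV does not fall back to a default
    value.\<close>
  have "critical_exponent \<mu> = ereal (d\<^sub>W - \<kappa>)"
    using assms(2) by (cases "critical_exponent \<mu>") auto
  then have "real_of_ereal (critical_exponent \<mu>) = W.lam" by (simp add: W.lam_def)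
  then have BV: "BV \<mu> = KS \<mu> W.lam" by (simp add: BV_def)
  obtain c C where c: "0 < c" and C: "0 < C" and H: "\<forall>f\<in>KS \<mu> W.lam. \<forall>\<gamma> g M. is_BV_measure \<mu> d\<^sub>W \<kappa> f \<gamma> \<longrightarrow> g \<in> C0 \<longrightarrow>
    uniformly_continuous_on UNIV g \<longrightarrow> (\<forall>x. 0 \<le> g x \<and> g x \<le> M) \<longrightarrow>
    ennreal c * Limsup (at_right 0) (\<lambda>t. \<integral>\<^sup>+y. ennreal (g y) * heat_osc \<mu> p d\<^sub>W \<kappa> t f y \<partial>\<mu>) \<le> (\<integral>\<^sup>+y. ennreal (g y) \<partial>\<gamma>) \<and>
    (\<integral>\<^sup>+y. ennreal (g y) \<partial>\<gamma>) \<le> ennreal C * Liminf (at_right 0) (\<lambda>t. \<integral>\<^sup>+y. ennreal (g y) * heat_osc \<mu> p d\<^sub>W \<kappa> t f y \<partial>\<mu>)"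
    using W.BV_measure_bounds by (elim exE conjE) (rule that; assumption)
  have part1: "ennreal c * Limsup (at_right 0) (\<lambda>t. \<integral>\<^sup>+y. ennreal (g y) * heat_osc \<mu> p d\<^sub>W \<kappa> t f y \<partial>\<mu>)
                \<le> (\<integral>\<^sup>+y. ennreal (g y) \<partial>\<gamma>) \<and>
              (\<integral>\<^sup>+y. ennreal (g y) \<partial>\<gamma>)
                \<le> ennreal C * Liminf (at_right 0) (\<lambda>t. \<integral>\<^sup>+y. ennreal (g y) * heat_osc \<mu> p d\<^sub>W \<kappa> t f y \<partial>\<mu>)"
    if f: "f \<in> BV \<mu> \<inter> Linf \<mu>" and \<gamma>: "is_BV_measure \<mu> d\<^sub>W \<kappa> f \<gamma>" and g: "g \<in> heat_class \<mu> p" "\<forall>y. 0 \<le> g y" for f \<gamma> g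
  proof -
    obtain M where M: "\<And>x. \<bar>g x\<bar> \<le> M" using W.heat_class_regular(3)[OF g(1)] by blast
    have "0 \<le> g x \<and> g x \<le> M" for x using M[of x] g(2) by (auto simp: abs_le_iff)
    then show ?thesis
      using f BV H[rule_format, OF _ \<gamma> W.heat_class_regular(1,2)[OF g(1)], of M] by blast
  qed
  \<comment> \<open>The upper bound for one BV measure is chained with the lower bound for the other
    through liminf \<le> limsup. The roles are interchangeable, so one K serves both directions and
    every f.\<close>
  define K where "K = C / c"
  have K: "0 < K" using c C by (simp add: K_def)
  have le: "emeasure \<gamma> A \<le> ennreal K * emeasure \<gamma>' A"
    if f: "f \<in> BV \<mu> \<inter> Linf \<mu>" and \<gamma>: "is_BV_measure \<mu> d\<^sub>W \<kappa> f \<gamma>" "is_BV_measure \<mu> d\<^sub>W \<kappa> f \<gamma>'" and A: "A \<in> sets borel" for f \<gamma> \<gamma>' A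
  proof (rule W.radon_measure_le[OF _ _ K _ A])
    show "radon_measure \<gamma>" "radon_measure \<gamma>'" using \<gamma> by (auto simp: is_BV_measure_def)
    fix u :: "'a \<Rightarrow> real"
    assume u: "u \<in> Cc" "uniformly_continuous_on UNIV u" "\<And>x. 0 \<le> u x \<and> u x \<le> 1"
    have fK: "f \<in> KS \<mu> W.lam" using f BV by simp
    have uC0: "u \<in> C0" unfolding C0_def using u(1) by (auto intro!: bexI[of _ u])
    define N where "N t = (\<integral>\<^sup>+y. ennreal (u y) * heat_osc \<mu> p d\<^sub>W \<kappa> t f y \<partial>\<mu>)" for t
    have "(\<integral>\<^sup>+x. ennreal (u x) \<partial>\<gamma>) \<le> ennreal C * Liminf (at_right 0) N"
      unfolding N_def using H[rule_format, OF fK \<gamma>(1) uC0 u(2), of 1] u(3) by blast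
    also have "\<dots> \<le> ennreal C * Limsup (at_right 0) N"
      by (intro mult_left_mono Liminf_le_Limsup) auto
    also have "\<dots> = ennreal K * (ennreal c * Limsup (at_right 0) N)"
      using c C by (simp add: K_def mult.assoc[symmetric] ennreal_mult[symmetric])
    also have "\<dots> \<le> ennreal K * (\<integral>\<^sup>+x. ennreal (u x) \<partial>\<gamma>')"
    proof (rule mult_left_mono)
      show "ennreal c * Limsup (at_right 0) N \<le> (\<integral>\<^sup>+x. ennreal (u x) \<partial>\<gamma>')"
        unfolding N_def using H[rule_format, OF fK \<gamma>(2) uC0 u(2), of 1] u(3) by blast
    qed simp
    finally show "(\<integral>\<^sup>+x. ennreal (u x) \<partial>\<gamma>) \<le> ennreal K * (\<integral>\<^sup>+x. ennreal (u x) \<partial>\<gamma>')" .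
  qed
  have part2: "absolutely_continuous \<gamma> \<gamma>' \<and> absolutely_continuous \<gamma>' \<gamma> \<and>
             (\<exists>h \<in> borel_measurable borel. \<gamma>' = density \<gamma> h \<and> (AE x in \<gamma>. h x \<le> ennreal K))"
    if f: "f \<in> BV \<mu> \<inter> Linf \<mu>" and \<gamma>: "is_BV_measure \<mu> d\<^sub>W \<kappa> f \<gamma>" "is_BV_measure \<mu> d\<^sub>W \<kappa> f \<gamma>'" for f \<gamma> \<gamma>'
  proof -
    have r: "radon_measure \<gamma>" "radon_measure \<gamma>'" using \<gamma> by (auto simp: is_BV_measure_def)
    have s: "sets \<gamma> = sets borel" "sets \<gamma>' = sets borel" by (rule radon_measureD(1)[OF r(1)], rule radon_measureD(1)[OF r(2)])
    have ac: "absolutely_continuous \<alpha> \<beta>" if "sets \<alpha> = sets borel" "sets \<beta> = sets borel"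
      "\<And>A. A \<in> sets borel \<Longrightarrow> emeasure \<beta> A \<le> ennreal K * emeasure \<alpha> A" for \<alpha> \<beta> :: "'a measure"
      unfolding absolutely_continuous_def
    proof
      fix N assume "N \<in> null_sets \<alpha>"
      then show "N \<in> null_sets \<beta>" using that(3)[of N] that(1,2) by (auto simp: null_sets_def)
    qed
    show ?thesis
      by (intro conjI ac s le[OF f \<gamma>(2,1)] le[OF f \<gamma>] density_bounded[OF W.radon_sigma_finite[OF r(1)] s])
  qed
  show ?thesis
  proof (rule conjI)
    show "\<exists>c>0. \<exists>C>0. \<forall>f \<in> BV \<mu> \<inter> Linf \<mu>. \<forall>\<gamma>. is_BV_measure \<mu> d\<^sub>W \<kappa> f \<gamma> \<longrightarrow>
           (\<forall>g \<in> heat_class \<mu> p. (\<forall>y. 0 \<le> g y) \<longrightarrow>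
              ennreal c * Limsup (at_right 0) (\<lambda>t. \<integral>\<^sup>+y. ennreal (g y) * heat_osc \<mu> p d\<^sub>W \<kappa> t f y \<partial>\<mu>)
                \<le> (\<integral>\<^sup>+y. ennreal (g y) \<partial>\<gamma>) \<and>
              (\<integral>\<^sup>+y. ennreal (g y) \<partial>\<gamma>)
                \<le> ennreal C * Liminf (at_right 0) (\<lambda>t. \<integral>\<^sup>+y. ennreal (g y) * heat_osc \<mu> p d\<^sub>W \<kappa> t f y \<partial>\<mu>))"
      by (rule exI[of _ c], rule conjI[OF c], rule exI[of _ C], rule conjI[OF C])
        (intro ballI allI impI, rule part1)
    show "\<exists>K>0. \<forall>f \<in> BV \<mu> \<inter> Linf \<mu>. \<forall>\<gamma> \<gamma>'.
           is_BV_measure \<mu> d\<^sub>W \<kappa> f \<gamma> \<longrightarrow> is_BV_measure \<mu> d\<^sub>W \<kappa> f \<gamma>' \<longrightarrow>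
             absolutely_continuous \<gamma> \<gamma>' \<and> absolutely_continuous \<gamma>' \<gamma> \<and>
             (\<exists>h \<in> borel_measurable borel. \<gamma>' = density \<gamma> h \<and> (AE x in \<gamma>. h x \<le> ennreal K))"
      by (rule exI[of _ K], rule conjI[OF K]) (intro ballI allI impI, rule part2)
  qed
qed

end
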